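(* Let $S$ be a finite semigroup, $K$ a commutative ring with unit, and $E=\{e_J\mid J\in\mathscr U(S)\}$ an idempotent transversal to the set $\mathscr U(S)$ of regular $\mathscr J$-classes of $S$ (that is, $e_J$ is an idempotent belonging to $J$ for each $J\in\mathscr U(S)$). For $J\in\mathscr U(S)$ let $G_J=G_{e_J}$ be the maximal subgroup of $S$ at $e_J$. Define functors $\mathrm{Ind}_{G_J}^S,\mathrm{Coind}_{G_J}^S$ from the category of (unital, right) $KG_J$-modules to the category of right $KS$-modules by $$\mathrm{Ind}_{G_J}^S(V)=V\otimes_{KG_J}e_J(KS/KI_J),\qquad \mathrm{Coind}_{G_J}^S(V)=\mathrm{Hom}_{KG_J}\bigl((KS/KI_J)e_J,V\bigr).$$ Then, for every $J\in\mathscr U(S)$: (1) If $M$ is a simple $KS$-module with apex $J$, then $Me_J$ is a simple $KG_J$-module. (2) If $V$ is a simple $KG_J$-module, then $$N=\{w\in\mathrm{Ind}_{G_J}^S(V)\mid w\,KS\,e_J=0\}$$ is the unique maximal $KS$-submodule of $\mathrm{Ind}_{G_J}^S(V)$, and $\mathrm{Ind}_{G_J}^S(V)/N$ is the unique (up to isomorphism) simple $KS$-module $M$ with apex $J$ such that $Me_J\cong V$ as $KG_J$-modules. (3) If $V$ is a simple $KG_J$-module, then $\mathrm{Coind}_{G_J}^S(V)\,e_J\,KS$ is the unique minimal (non-zero) $KS$-submodule of $\mathrm{Coind}_{G_J}^S(V)$, and moreover it is the unique (up to isomorphism) simple $KS$-module $M$ with apex $J$ such that $Me_J\cong V$ as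 $KG_J$-modules. Consequently, if $K$ is a field, there is a bijection between the set of isomorphism classes of irreducible representations of $S$ over $K$ (simple $KS$-modules) and the disjoint union over $J\in\mathscr U(S)$ of the sets of isomorphism classes of irreducible representations of $G_J$ over $K$ (simple $KG_J$-modules).
   Context: Semigroup notions. $S^1$ denotes $S$ with an adjoined identity. For $s\in S$, $J(s)=S^1sS^1$ is the principal two-sided ideal generated by $s$. Elements $s,t\in S$ are $\mathscr J$-equivalent if $J(s)=J(t)$; the equivalence classes are the $\mathscr J$-classes. An element $s\in S$ is regular if $s=sts$ for some $t\in S$. A $\mathscr J$-class $J$ of the finite semigroup $S$ is regular if it satisfies the following equivalent conditions: it contains an idempotent; it contains a regular element; all its elements are regular; $J^2\cap J\neq\emptyset$. The set of regular $\mathscr J$-classes is $\mathscr U(S)$. For an idempotent $e\in S$, $eSe$ is a monoid with identity $e$, and its group of units $G_e$ is called the maximal subgroup of $S$ at $e$. For a $\mathscr J$-class $J$, put $I_J=\{s\in S\mid J\nsubseteq J(s)\}$; this is a (possibly empty) two-sided ideal of $S$. Algebras and modules. $KS$ is the semigroup algebra of $S$ over $K$; it need not be unital. $KI_J$ is the $K$-span of $I_J$, a two-sided ideal of $KS$, and $KS/KI_J$ is the quotient algebra; $e_J$ also denotes the image of $e_J$ in it. One has $e_J(KS/KI_J)e_J= KG_J$ (since $e_JSe_J\cap J=G_J$), so $e_J(KS/KI_J)$ is a $KG_J$-$KS$-bimodule and $(KS/KI_J)e_J$ is a $KS$-$KG_J$-bimodule. The right $KS$-module structure on $\mathrm{Ind}_{G_J}^S(V)$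 is by right multiplication on the second factor; that on $\mathrm{Coind}_{G_J}^S(V)$ is $(\varphi a)(x)=\varphi(ax)$ for $a\in KS$, $x\in (KS/KI_J)e_J$. All modules are right modules; modules over a unital algebra are assumed unital. For a $K$-algebra $A$, not necessarily unital, a simple $A$-module is an $A$-module $M$ such that $MA\neq 0$ and $M$ contains no proper non-zero submodules (equivalently, $M\neq 0$ and $mA=M$ for all $0\neq m\in M$). Apex. For a $KS$-module $M$, let $\mathrm{Ann}_S(M)=\{s\in S\mid Ms=0\}$. A regular $\mathscr J$-class $J$ is said to be the apex of $M$ if $\mathrm{Ann}_S(M)=I_J$. *)

theory Defs
  imports "HOL-Algebra.QuotRing" "HOL-Algebra.Module" "HOL-Algebra.Free_Abelian_Groups"
begin

section \<open>Finite semigroups\<close>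

text \<open>
  A semigroup is given by a carrier and a multiplication; as HOL-Algebra has no record for
  this, we use \<^typ>\<open>'s monoid\<close> and ignore its field for the unit.
\<close>

locale finite_semigroup =
  fixes S :: "('s, 'x) monoid_scheme" (structure)
  assumes mult_closed: "\<lbrakk>s \<in> carrier S; t \<in> carrier S\<rbrakk> \<Longrightarrow> s \<otimes> t \<in> carrier S"
    and mult_assoc:
      "\<lbrakk>s \<in> carrier S; t \<in> carrier S; u \<in> carrier S\<rbrakk> \<Longrightarrow> (s \<otimes> t) \<otimes> u = s \<otimes> (t \<otimes> u)"
    and finite_carrier: "finite (carrier S)"

text \<open>The four parts are the products \<open>x s y\<close> where \<open>x\<close>, \<open>y\<close> are in \<open>S\<close> or the adjoined identity.\<close>

definition principal_ideal :: "('s, 'x) monoid_scheme \<Rightarrow> 's \<Rightarrow> 's set" where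
  "principal_ideal S s =
     {s} \<union> {x \<otimes>\<^bsub>S\<^esub> s | x. x \<in> carrier S} \<union> {s \<otimes>\<^bsub>S\<^esub> y | y. y \<in> carrier S}
       \<union> {x \<otimes>\<^bsub>S\<^esub> s \<otimes>\<^bsub>S\<^esub> y | x y. x \<in> carrier S \<and> y \<in> carrier S}"

definition J_rel :: "('s, 'x) monoid_scheme \<Rightarrow> 's rel" where
  "J_rel S = {(s, t). s \<in> carrier S \<and> t \<in> carrier S \<and> principal_ideal S s = principal_ideal S t}"

definition regular_J_classes :: "('s, 'x) monoid_scheme \<Rightarrow> 's set set" where
  "regular_J_classes S = {J \<in> carrier S // J_rel S. \<exists>f\<in>J. f \<otimes>\<^bsub>S\<^esub> f = f}"

definition apex_ideal :: "('s, 'x) monoid_scheme \<Rightarrow> 's set \<Rightarrow> 's set" where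
  "apex_ideal S J = {s \<in> carrier S. \<not> J \<subseteq> principal_ideal S s}"

definition local_monoid :: "('s, 'x) monoid_scheme \<Rightarrow> 's \<Rightarrow> 's monoid" where
  "local_monoid S e =
     \<lparr>carrier = {e \<otimes>\<^bsub>S\<^esub> s \<otimes>\<^bsub>S\<^esub> e | s. s \<in> carrier S}, monoid.mult = monoid.mult S, one = e\<rparr>"

definition maximal_subgroup :: "('s, 'x) monoid_scheme \<Rightarrow> 's \<Rightarrow> 's monoid" where
  "maximal_subgroup S e = units_of (local_monoid S e)"


section \<open>Right modules over not necessarily unital algebras\<close>

text \<open>
  An algebra over \<open>K\<close> is a \<^typ>\<open>('k, 'a) module\<close> record, whose multiplication need be neither
  commutative nor unital. In the records for modules the fields for the multiplication
  and the unit are junk, as usual in HOL-Algebra.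
\<close>

record ('k, 'a, 'm) rmodule = "('k, 'm) module" +
  act :: "'m \<Rightarrow> 'a \<Rightarrow> 'm"  (infixl \<open>\<triangleleft>\<index>\<close> 70)

locale right_module = module K M
  for K :: "('k, 'x) ring_scheme"
    and A :: "('k, 'a, 'y) module_scheme"
    and M :: "('k, 'a, 'm, 'z) rmodule_scheme" +
  assumes act_closed: "\<lbrakk>m \<in> carrier M; a \<in> carrier A\<rbrakk> \<Longrightarrow> m \<triangleleft>\<^bsub>M\<^esub> a \<in> carrier M"
    and act_add_left:
      "\<lbrakk>m \<in> carrier M; n \<in> carrier M; a \<in> carrier A\<rbrakk> \<Longrightarrow>
         (m \<oplus>\<^bsub>M\<^esub> n) \<triangleleft>\<^bsub>M\<^esub> a = (m \<triangleleft>\<^bsub>M\<^esub> a) \<oplus>\<^bsub>M\<^esub> (n \<triangleleft>\<^bsub>M\<^esub> a)"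
    and act_add_right:
      "\<lbrakk>m \<in> carrier M; a \<in> carrier A; b \<in> carrier A\<rbrakk> \<Longrightarrow>
         m \<triangleleft>\<^bsub>M\<^esub> (a \<oplus>\<^bsub>A\<^esub> b) = (m \<triangleleft>\<^bsub>M\<^esub> a) \<oplus>\<^bsub>M\<^esub> (m \<triangleleft>\<^bsub>M\<^esub> b)"
    and act_smult_left:
      "\<lbrakk>k \<in> carrier K; m \<in> carrier M; a \<in> carrier A\<rbrakk> \<Longrightarrow>
         (k \<odot>\<^bsub>M\<^esub> m) \<triangleleft>\<^bsub>M\<^esub> a = k \<odot>\<^bsub>M\<^esub> (m \<triangleleft>\<^bsub>M\<^esub> a)"
    and act_smult_right:
      "\<lbrakk>k \<in> carrier K; m \<in> carrier M; a \<in> carrier A\<rbrakk> \<Longrightarrow>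
         m \<triangleleft>\<^bsub>M\<^esub> (k \<odot>\<^bsub>A\<^esub> a) = k \<odot>\<^bsub>M\<^esub> (m \<triangleleft>\<^bsub>M\<^esub> a)"
    and act_mult:
      "\<lbrakk>m \<in> carrier M; a \<in> carrier A; b \<in> carrier A\<rbrakk> \<Longrightarrow>
         m \<triangleleft>\<^bsub>M\<^esub> (a \<otimes>\<^bsub>A\<^esub> b) = (m \<triangleleft>\<^bsub>M\<^esub> a) \<triangleleft>\<^bsub>M\<^esub> b"

locale unital_right_module = right_module +
  assumes act_one: "m \<in> carrier M \<Longrightarrow> m \<triangleleft>\<^bsub>M\<^esub> \<one>\<^bsub>A\<^esub> = m"

definition right_submodule ::
  "('k, 'x) ring_scheme \<Rightarrow> ('k, 'a, 'y) module_scheme \<Rightarrow> 'm set \<Rightarrow> ('k, 'a, 'm, 'z) rmodule_scheme \<Rightarrow> bool"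
  where
  "right_submodule K A N M \<longleftrightarrow>
     submodule N K M \<and> (\<forall>n\<in>N. \<forall>a\<in>carrier A. n \<triangleleft>\<^bsub>M\<^esub> a \<in> N)"

definition maximal_submodule ::
  "('k, 'x) ring_scheme \<Rightarrow> ('k, 'a, 'y) module_scheme \<Rightarrow> 'm set \<Rightarrow> ('k, 'a, 'm, 'z) rmodule_scheme \<Rightarrow> bool"
  where
  "maximal_submodule K A N M \<longleftrightarrow>
     right_submodule K A N M \<and> N \<noteq> carrier M \<and>
     (\<forall>N'. right_submodule K A N' M \<and> N \<subseteq> N' \<longrightarrow> N' = N \<or> N' = carrier M)"

definition minimal_submodule ::
  "('k, 'x) ring_scheme \<Rightarrow> ('k, 'a, 'y) module_scheme \<Rightarrow> 'm set \<Rightarrow> ('k, 'a, 'm, 'z) rmodule_scheme \<Rightarrow> bool"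
  where
  "minimal_submodule K A N M \<longleftrightarrow>
     right_submodule K A N M \<and> N \<noteq> {\<zero>\<^bsub>M\<^esub>} \<and>
     (\<forall>N'. right_submodule K A N' M \<and> N' \<subseteq> N \<longrightarrow> N' = N \<or> N' = {\<zero>\<^bsub>M\<^esub>})"

definition simple_module ::
  "('k, 'x) ring_scheme \<Rightarrow> ('k, 'a, 'y) module_scheme \<Rightarrow> ('k, 'a, 'm, 'z) rmodule_scheme \<Rightarrow> bool"
  where
  "simple_module K A M \<longleftrightarrow>
     right_module K A M \<and>
     (\<exists>m\<in>carrier M. \<exists>a\<in>carrier A. m \<triangleleft>\<^bsub>M\<^esub> a \<noteq> \<zero>\<^bsub>M\<^esub>) \<and>
     (\<forall>N. right_submodule K A N M \<longrightarrow> N = {\<zero>\<^bsub>M\<^esub>} \<or> N = carrier M)"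

definition simple_unital_module ::
  "('k, 'x) ring_scheme \<Rightarrow> ('k, 'a, 'y) module_scheme \<Rightarrow> ('k, 'a, 'm, 'z) rmodule_scheme \<Rightarrow> bool"
  where
  "simple_unital_module K A M \<longleftrightarrow> unital_right_module K A M \<and> simple_module K A M"

definition rmodule_hom ::
  "('k, 'x) ring_scheme \<Rightarrow> ('k, 'a, 'y) module_scheme \<Rightarrow>
   ('k, 'a, 'm, 'z) rmodule_scheme \<Rightarrow> ('k, 'a, 'n, 'w) rmodule_scheme \<Rightarrow> ('m \<Rightarrow> 'n) set"
  where
  "rmodule_hom K A M N =
     {f \<in> carrier M \<rightarrow> carrier N.
        (\<forall>x\<in>carrier M. \<forall>y\<in>carrier M. f (x \<oplus>\<^bsub>M\<^esub> y) = f x \<oplus>\<^bsub>N\<^esub> f y) \<and>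
        (\<forall>k\<in>carrier K. \<forall>x\<in>carrier M. f (k \<odot>\<^bsub>M\<^esub> x) = k \<odot>\<^bsub>N\<^esub> f x) \<and>
        (\<forall>x\<in>carrier M. \<forall>a\<in>carrier A. f (x \<triangleleft>\<^bsub>M\<^esub> a) = f x \<triangleleft>\<^bsub>N\<^esub> a)}"

definition rmodule_iso ::
  "('k, 'x) ring_scheme \<Rightarrow> ('k, 'a, 'y) module_scheme \<Rightarrow>
   ('k, 'a, 'm, 'z) rmodule_scheme \<Rightarrow> ('k, 'a, 'n, 'w) rmodule_scheme \<Rightarrow> bool"
  where
  "rmodule_iso K A M N \<longleftrightarrow> (\<exists>f\<in>rmodule_hom K A M N. bij_betw f (carrier M) (carrier N))"

definition quotient_rmodule :: "('k, 'a, 'm, 'z) rmodule_scheme \<Rightarrow> 'm set \<Rightarrow> ('k, 'a, 'm set) rmodule"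
  where
  "quotient_rmodule M N =
     \<lparr>carrier = a_rcosets\<^bsub>M\<^esub> N, monoid.mult = undefined, one = undefined, ring.zero = N,
      add = set_add M,
      smult = (\<lambda>k X. \<Union>x\<in>X. N +>\<^bsub>M\<^esub> (k \<odot>\<^bsub>M\<^esub> x)),
      act = (\<lambda>X a. \<Union>x\<in>X. N +>\<^bsub>M\<^esub> (x \<triangleleft>\<^bsub>M\<^esub> a))\<rparr>"

definition quotient_algebra :: "('k, 'a, 'y) module_scheme \<Rightarrow> 'a set \<Rightarrow> ('k, 'a set) module" where
  "quotient_algebra A I =
     \<lparr>carrier = carrier (A Quot I), monoid.mult = monoid.mult (A Quot I), one = one (A Quot I),
      ring.zero = ring.zero (A Quot I), add = add (A Quot I),
      smult = (\<lambda>k X. \<Union>x\<in>X. I +>\<^bsub>A\<^esub> (k \<odot>\<^bsub>A\<^esub> x))\<rparr>"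

text \<open>
  The isomorphism classes of simple modules whose carrier is a set of elements of \<open>'u\<close>. As
  the type \<open>'u\<close> plays the role of a universe, it has to be chosen large enough.
\<close>

definition simple_iso_classes ::
  "('k, 'x) ring_scheme \<Rightarrow> ('k, 'a, 'y) module_scheme \<Rightarrow> ('k, 'a, 'u) rmodule set set"
  where
  "simple_iso_classes K A =
     {M. simple_module K A M} //
       {(M, N). simple_module K A M \<and> simple_module K A N \<and> rmodule_iso K A M N}"

definition simple_unital_iso_classes ::
  "('k, 'x) ring_scheme \<Rightarrow> ('k, 'a, 'y) module_scheme \<Rightarrow> ('k, 'a, 'u) rmodule set set"
  where
  "simple_unital_iso_classes K A =
     {M. simple_unital_module K A M} //
       {(M, N). simple_unital_module K A M \<and> simple_unital_module K A N \<and> rmodule_iso K A M N}"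


section \<open>Bimodules, tensor products and modules of homomorphisms\<close>

record ('k, 'b, 'a, 'm) bimodule = "('k, 'a, 'm) rmodule" +
  lact :: "'b \<Rightarrow> 'm \<Rightarrow> 'm"  (infixr \<open>\<triangleright>\<index>\<close> 70)

text \<open>
  The tensor product over \<open>B\<close> of a right \<open>B\<close>-module \<open>V\<close> and a \<open>B\<close>-\<open>A\<close>-bimodule \<open>L\<close> is the free
  abelian group on the pairs, modulo the biadditivity and balancing relations. The actions
  of \<open>k\<close> and \<open>a\<close> are induced by \<open>(v, x) \<mapsto> (k v, x)\<close> and \<open>(v, x) \<mapsto> (v, x a)\<close>.
\<close>

definition tensor_relators ::
  "('k, 'b, 'y) module_scheme \<Rightarrow> ('k, 'b, 'v, 'z) rmodule_scheme \<Rightarrow>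
   ('k, 'b, 'a, 'l, 'w) bimodule_scheme \<Rightarrow> ('v \<times> 'l \<Rightarrow>\<^sub>0 int) set"
  where
  "tensor_relators B V L =
     {frag_of (v \<oplus>\<^bsub>V\<^esub> v', x) - frag_of (v, x) - frag_of (v', x) | v v' x.
        v \<in> carrier V \<and> v' \<in> carrier V \<and> x \<in> carrier L} \<union>
     {frag_of (v, x \<oplus>\<^bsub>L\<^esub> x') - frag_of (v, x) - frag_of (v, x') | v x x'.
        v \<in> carrier V \<and> x \<in> carrier L \<and> x' \<in> carrier L} \<union>
     {frag_of (v \<triangleleft>\<^bsub>V\<^esub> b, x) - frag_of (v, b \<triangleright>\<^bsub>L\<^esub> x) | v b x.
        v \<in> carrier V \<and> b \<in> carrier B \<and> x \<in> carrier L}"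

definition tensor_rmodule ::
  "('k, 'b, 'y) module_scheme \<Rightarrow> ('k, 'b, 'v, 'z) rmodule_scheme \<Rightarrow>
   ('k, 'b, 'a, 'l, 'w) bimodule_scheme \<Rightarrow> ('k, 'a, ('v \<times> 'l \<Rightarrow>\<^sub>0 int) set) rmodule"
  where
  "tensor_rmodule B V L =
     (let F = free_Abelian_group (carrier V \<times> carrier L);
          R = generate F (tensor_relators B V L)
      in \<lparr>carrier = carrier (F Mod R), monoid.mult = undefined, one = undefined,
          ring.zero = one (F Mod R), add = monoid.mult (F Mod R),
          smult = (\<lambda>k X. \<Union>w\<in>X. R #>\<^bsub>F\<^esub> frag_extend (\<lambda>(v, x). frag_of (k \<odot>\<^bsub>V\<^esub> v, x)) w),
          act = (\<lambda>X a. \<Union>w\<in>X. R #>\<^bsub>F\<^esub> frag_extend (\<lambda>(v, x). frag_of (v, x \<triangleleft>\<^bsub>L\<^esub> a)) w)\<rparr>)"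

text \<open>The right \<open>A\<close>-module of \<open>B\<close>-linear maps from an \<open>A\<close>-\<open>B\<close>-bimodule \<open>X\<close> to a right \<open>B\<close>-module \<open>V\<close>.\<close>

definition hom_rmodule ::
  "('k, 'x) ring_scheme \<Rightarrow> ('k, 'b, 'y) module_scheme \<Rightarrow> ('k, 'a, 'b, 'l, 'w) bimodule_scheme \<Rightarrow>
   ('k, 'b, 'v, 'z) rmodule_scheme \<Rightarrow> ('k, 'a, 'l \<Rightarrow> 'v) rmodule"
  where
  "hom_rmodule K B X V =
     \<lparr>carrier = rmodule_hom K B X V \<inter> extensional (carrier X), monoid.mult = undefined, one = undefined,
      ring.zero = (\<lambda>x\<in>carrier X. \<zero>\<^bsub>V\<^esub>),
      add = (\<lambda>\<phi> \<psi>. \<lambda>x\<in>carrier X. \<phi> x \<oplus>\<^bsub>V\<^esub> \<psi> x),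
      smult = (\<lambda>k \<phi>. \<lambda>x\<in>carrier X. k \<odot>\<^bsub>V\<^esub> \<phi> x),
      act = (\<lambda>\<phi> a. \<lambda>x\<in>carrier X. \<phi> (a \<triangleright>\<^bsub>X\<^esub> x))\<rparr>"


section \<open>Semigroup algebras\<close>

text \<open>
  Formal \<open>K\<close>-linear combinations of elements of a finite set \<open>X\<close> are functions vanishing
  outside \<open>X\<close>. Hence \<open>KX\<close> is a subset of \<open>KS\<close> if \<open>X\<close> is a subset of \<open>S\<close>, and in particular the
  algebra of a maximal subgroup of \<open>S\<close> acts on \<open>KS\<close>-modules by restriction.
\<close>

definition lin_combs :: "('k, 'x) ring_scheme \<Rightarrow> 's set \<Rightarrow> ('s \<Rightarrow> 'k) set" where
  "lin_combs K X = {f. (\<forall>s\<in>X. f s \<in> carrier K) \<and> (\<forall>s. s \<notin> X \<longrightarrow> f s = \<zero>\<^bsub>K\<^esub>)}"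

definition basis_elem :: "('k, 'x) ring_scheme \<Rightarrow> 's \<Rightarrow> 's \<Rightarrow> 'k" where
  "basis_elem K s = (\<lambda>t. if t = s then \<one>\<^bsub>K\<^esub> else \<zero>\<^bsub>K\<^esub>)"

text \<open>The unit below is junk unless \<open>S\<close> is a monoid.\<close>

definition semigroup_algebra ::
  "('k, 'x) ring_scheme \<Rightarrow> ('s, 'y) monoid_scheme \<Rightarrow> ('k, 's \<Rightarrow> 'k) module"
  where
  "semigroup_algebra K S =
     \<lparr>carrier = lin_combs K (carrier S),
      monoid.mult = (\<lambda>f g u. \<Oplus>\<^bsub>K\<^esub>p \<in> {(s, t). s \<in> carrier S \<and> t \<in> carrier S \<and> s \<otimes>\<^bsub>S\<^esub> t = u}.
                        f (fst p) \<otimes>\<^bsub>K\<^esub> g (snd p)),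
      one = basis_elem K \<one>\<^bsub>S\<^esub>,
      ring.zero = (\<lambda>s. \<zero>\<^bsub>K\<^esub>),
      add = (\<lambda>f g s. f s \<oplus>\<^bsub>K\<^esub> g s),
      smult = (\<lambda>k f s. k \<otimes>\<^bsub>K\<^esub> f s)\<rparr>"

definition annihilator ::
  "('k, 'x) ring_scheme \<Rightarrow> ('s, 'y) monoid_scheme \<Rightarrow> ('k, 's \<Rightarrow> 'k, 'm, 'z) rmodule_scheme \<Rightarrow> 's set"
  where
  "annihilator K S M =
     {s \<in> carrier S. \<forall>m\<in>carrier M. m \<triangleleft>\<^bsub>M\<^esub> basis_elem K s = \<zero>\<^bsub>M\<^esub>}"

definition is_apex ::
  "('k, 'x) ring_scheme \<Rightarrow> ('s, 'y) monoid_scheme \<Rightarrow> ('k, 's \<Rightarrow> 'k, 'm, 'z) rmodule_scheme \<Rightarrow> 's set \<Rightarrow> bool"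
  where
  "is_apex K S M J \<longleftrightarrow> J \<in> regular_J_classes S \<and> annihilator K S M = apex_ideal S J"

text \<open>The module \<open>M e\<close> over the algebra of the maximal subgroup at \<open>e\<close>, with the restricted action.\<close>

definition corner_module ::
  "('k, 'x) ring_scheme \<Rightarrow> ('k, 's \<Rightarrow> 'k, 'm, 'z) rmodule_scheme \<Rightarrow> 's \<Rightarrow> ('k, 's \<Rightarrow> 'k, 'm, 'z) rmodule_scheme"
  where
  "corner_module K M e = M\<lparr>carrier := {m \<triangleleft>\<^bsub>M\<^esub> basis_elem K e | m. m \<in> carrier M}\<rparr>"


section \<open>Induction and coinduction\<close>

definition apex_quotient ::
  "('k, 'x) ring_scheme \<Rightarrow> ('s, 'y) monoid_scheme \<Rightarrow> 's set \<Rightarrow> ('k, ('s \<Rightarrow> 'k) set) module"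
  where
  "apex_quotient K S J = quotient_algebra (semigroup_algebra K S) (lin_combs K (apex_ideal S J))"

definition apex_class ::
  "('k, 'x) ring_scheme \<Rightarrow> ('s, 'y) monoid_scheme \<Rightarrow> 's set \<Rightarrow> ('s \<Rightarrow> 'k) \<Rightarrow> ('s \<Rightarrow> 'k) set"
  where
  "apex_class K S J a = lin_combs K (apex_ideal S J) +>\<^bsub>semigroup_algebra K S\<^esub> a"

definition apex_bimodule ::
  "('k, 'x) ring_scheme \<Rightarrow> ('s, 'y) monoid_scheme \<Rightarrow> 's set \<Rightarrow>
   ('k, 's \<Rightarrow> 'k, 's \<Rightarrow> 'k, ('s \<Rightarrow> 'k) set) bimodule"
  where
  "apex_bimodule K S J =
     (let Q = apex_quotient K S J
      in \<lparr>carrier = carrier Q, monoid.mult = undefined, one = undefined,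
          ring.zero = ring.zero Q, add = add Q, smult = smult Q,
          act = (\<lambda>x a. x \<otimes>\<^bsub>Q\<^esub> apex_class K S J a),
          lact = (\<lambda>a x. apex_class K S J a \<otimes>\<^bsub>Q\<^esub> x)\<rparr>)"

text \<open>
  The bimodules \<open>e (KS/KI\<^sub>J)\<close> and \<open>(KS/KI\<^sub>J) e\<close>; in each case the \<open>KS\<close>-action on the side of \<open>e\<close> is
  only used for elements of the algebra of the maximal subgroup at \<open>e\<close>.
\<close>

definition left_corner ::
  "('k, 'x) ring_scheme \<Rightarrow> ('s, 'y) monoid_scheme \<Rightarrow> 's set \<Rightarrow> 's \<Rightarrow>
   ('k, 's \<Rightarrow> 'k, 's \<Rightarrow> 'k, ('s \<Rightarrow> 'k) set) bimodule"
  where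
  "left_corner K S J e =
     (apex_bimodule K S J)\<lparr>carrier :=
        {apex_class K S J (basis_elem K e) \<otimes>\<^bsub>apex_quotient K S J\<^esub> x | x.
           x \<in> carrier (apex_quotient K S J)}\<rparr>"

definition right_corner ::
  "('k, 'x) ring_scheme \<Rightarrow> ('s, 'y) monoid_scheme \<Rightarrow> 's set \<Rightarrow> 's \<Rightarrow>
   ('k, 's \<Rightarrow> 'k, 's \<Rightarrow> 'k, ('s \<Rightarrow> 'k) set) bimodule"
  where
  "right_corner K S J e =
     (apex_bimodule K S J)\<lparr>carrier :=
        {x \<otimes>\<^bsub>apex_quotient K S J\<^esub> apex_class K S J (basis_elem K e) | x.
           x \<in> carrier (apex_quotient K S J)}\<rparr>"

abbreviation group_algebra_at ::
  "('k, 'x) ring_scheme \<Rightarrow> ('s, 'y) monoid_scheme \<Rightarrow> 's \<Rightarrow> ('k, 's \<Rightarrow> 'k) module"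
  where
  "group_algebra_at K S e \<equiv> semigroup_algebra K (maximal_subgroup S e)"

definition Ind ::
  "('k, 'x) ring_scheme \<Rightarrow> ('s, 'y) monoid_scheme \<Rightarrow> 's set \<Rightarrow> 's \<Rightarrow>
   ('k, 's \<Rightarrow> 'k, 'v, 'z) rmodule_scheme \<Rightarrow>
   ('k, 's \<Rightarrow> 'k, ('v \<times> ('s \<Rightarrow> 'k) set \<Rightarrow>\<^sub>0 int) set) rmodule"
  where
  "Ind K S J e V = tensor_rmodule (group_algebra_at K S e) V (left_corner K S J e)"

definition Coind ::
  "('k, 'x) ring_scheme \<Rightarrow> ('s, 'y) monoid_scheme \<Rightarrow> 's set \<Rightarrow> 's \<Rightarrow>
   ('k, 's \<Rightarrow> 'k, 'v, 'z) rmodule_scheme \<Rightarrow>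
   ('k, 's \<Rightarrow> 'k, ('s \<Rightarrow> 'k) set \<Rightarrow> 'v) rmodule"
  where
  "Coind K S J e V = hom_rmodule K (group_algebra_at K S e) (right_corner K S J e) V"

definition Ind_radical ::
  "('k, 'x) ring_scheme \<Rightarrow> ('s, 'y) monoid_scheme \<Rightarrow> 's \<Rightarrow> ('k, 's \<Rightarrow> 'k, 'm, 'z) rmodule_scheme \<Rightarrow> 'm set"
  where
  "Ind_radical K S e M =
     {w \<in> carrier M. \<forall>a\<in>carrier (semigroup_algebra K S).
        w \<triangleleft>\<^bsub>M\<^esub> (a \<otimes>\<^bsub>semigroup_algebra K S\<^esub> basis_elem K e) = \<zero>\<^bsub>M\<^esub>}"

text \<open>As a product of submodules, \<open>M e KS\<close> consists of the sums of elements \<open>m e a\<close>.\<close>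

definition Coind_socle ::
  "('k, 'x) ring_scheme \<Rightarrow> ('s, 'y) monoid_scheme \<Rightarrow> 's \<Rightarrow> ('k, 's \<Rightarrow> 'k, 'm, 'z) rmodule_scheme \<Rightarrow> 'm set"
  where
  "Coind_socle K S e M =
     generate (add_monoid M)
       {(m \<triangleleft>\<^bsub>M\<^esub> basis_elem K e) \<triangleleft>\<^bsub>M\<^esub> a | m a.
          m \<in> carrier M \<and> a \<in> carrier (semigroup_algebra K S)}"

text \<open>\<open>M\<close> is a simple \<open>KS\<close>-module with apex \<open>J\<close> such that \<open>M e\<close> is isomorphic to \<open>V\<close>.\<close>

definition simple_over ::
  "('k, 'x) ring_scheme \<Rightarrow> ('s, 'y) monoid_scheme \<Rightarrow> 's set \<Rightarrow> 's \<Rightarrow>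
   ('k, 's \<Rightarrow> 'k, 'v, 'w) rmodule_scheme \<Rightarrow> ('k, 's \<Rightarrow> 'k, 'm, 'z) rmodule_scheme \<Rightarrow> bool"
  where
  "simple_over K S J e V M \<longleftrightarrow>
     simple_module K (semigroup_algebra K S) M \<and> is_apex K S M J \<and>
     rmodule_iso K (group_algebra_at K S e) (corner_module K M e) V"

end

theory Submission
  imports Defs
begin

text \<open>
  For a module \<open>M\<close> killed by \<open>I\<^sub>J\<close>, \<open>e S e \<subseteq> G\<^sub>J \<union> I\<^sub>J\<close> shows that \<open>e KS e\<close> acts on \<open>M e\<close> through \<open>KG\<^sub>J\<close>.
  Hence \<open>M e\<close> is simple if \<open>M\<close> is simple and \<open>M e \<noteq> 0\<close>. Conversely, if \<open>M e\<close> is simple, then every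
  submodule \<open>N\<close> of \<open>M\<close> with \<open>N e \<noteq> 0\<close> contains \<open>M e\<close>. So if \<open>M e\<close> generates \<open>M\<close>, the largest
  submodule killed by \<open>KS e\<close> is the only maximal one, and if no non-zero element is killed by
  \<open>KS e\<close>, then \<open>M e KS\<close> is the only minimal submodule. The first condition holds for \<open>Ind\<close>, the
  second for \<open>Coind\<close>, and the corner is \<open>V\<close> in both cases. A simple module with apex \<open>J\<close> is
  determined by its corner, since an isomorphism \<open>f\<close> of corners extends to \<open>w a \<mapsto> f(w) a\<close> for a
  fixed \<open>0 \<noteq> w \<in> M e\<close>.
\<close>

section \<open>The algebra of a finite semigroup\<close>

text \<open>The absence of a unit in \<open>KS\<close> shapes the proof: a non-zero \<open>m\<close>
  of a simple module is not obviously in \<open>m KS\<close>, and cyclicity has to be derived from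
  \<open>M KS\<close> being non-zero before anything else can be compared. Finiteness of
  \<open>S\<close> supplies two facts: one-sided inverses in \<open>eSe\<close> are two-sided, so
  that elements of \<open>eSe\<close> outside \<open>I\<close> lie in the group \<open>G\<close>;
  and closed subsets contain idempotents, so that the class found as the apex of a simple module is
  regular. That the corner of \<open>Ind\<close> is no smaller than \<open>V\<close> cannot be read
  off from generators and relations. It is detected by the balanced map sending
  \<open>(v, x)\<close> to \<open>v\<close> times the \<open>KG\<close>-component of
  \<open>e x e\<close>. The same formula, as a function of \<open>x\<close> alone, provides enough
  elements of \<open>Coind\<close>. Types act as universes for isomorphism classes. Cyclicity helps
  once more: choosing coefficients embeds the underlying set of a simple module into the functions
  from \<open>S\<close> to \<open>K\<close>, so its structure can be moved to any type that is large
  enough for those.\<close>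

lemma lin_combs_induct [consumes 2, case_names zero add]:
  assumes "finite X" and f: "f \<in> lin_combs K X" and K: "cring K"
    and zero: "P (\<lambda>s. \<zero>\<^bsub>K\<^esub>)"
    and add: "\<And>k s f. \<lbrakk>k \<in> carrier K; s \<in> X; f \<in> lin_combs K X; P f\<rbrakk> \<Longrightarrow>
      P (\<lambda>t. k \<otimes>\<^bsub>K\<^esub> basis_elem K s t \<oplus>\<^bsub>K\<^esub> f t)"
  shows "P f"
proof -
  interpret cring K by fact
  \<comment> \<open>The bound \<open>Y\<close> on the support varies in the induction while the
    ambient set \<open>X\<close> of the rule stays fixed.\<close>
  have "P f" if "finite Y" "Y \<subseteq> X" "f \<in> lin_combs K Y" for Y f
    using that
  proof (induction Y arbitrary: f rule: finite_induct)
    case empty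
    then have "f = (\<lambda>s. \<zero>\<^bsub>K\<^esub>)" by (auto simp: lin_combs_def)
    then show ?case using zero by simp
  next
    case (insert x Y)
    define g where "g = f(x := \<zero>\<^bsub>K\<^esub>)"
    have g: "g \<in> lin_combs K Y" using insert.prems(2) insert.hyps by (auto simp: g_def lin_combs_def)
    have gX: "g \<in> lin_combs K X"
      using g insert.prems(1) by (auto simp: lin_combs_def)
    have fx: "f x \<in> carrier K" "\<And>t. f t \<in> carrier K"
      using insert.prems(2) by (auto simp: lin_combs_def)
    have "f = (\<lambda>t. f x \<otimes>\<^bsub>K\<^esub> basis_elem K x t \<oplus>\<^bsub>K\<^esub> g t)"
      using fx by (auto simp: g_def basis_elem_def fun_eq_iff)
    moreover have "P \<dots>"
      by (rule add) (use insert gX fx g in auto)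
    ultimately show ?case by simp
  qed
  then show ?thesis using assms(1) f by blast
qed

text \<open>Instantiated both for \<open>S\<close> and, inside \<open>J_class\<close>, for the
  maximal subgroup \<open>G\<close>, so that the facts on \<open>KS\<close> are available for
  \<open>KG\<close> too.\<close>

locale semigroup_over_cring = finite_semigroup S + K: cring K
  for S :: "('s, 'x) monoid_scheme" (structure) and K :: "('k, 'y) ring_scheme"
begin

abbreviation "A \<equiv> semigroup_algebra K S"
abbreviation "bas \<equiv> basis_elem K"

lemma carrier_A: "carrier A = lin_combs K (carrier S)"
  and add_A: "f \<oplus>\<^bsub>A\<^esub> g = (\<lambda>s. f s \<oplus>\<^bsub>K\<^esub> g s)"
  and zero_A: "\<zero>\<^bsub>A\<^esub> = (\<lambda>s. \<zero>\<^bsub>K\<^esub>)"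
  and smult_A: "k \<odot>\<^bsub>A\<^esub> f = (\<lambda>s. k \<otimes>\<^bsub>K\<^esub> f s)"
  and one_A: "\<one>\<^bsub>A\<^esub> = bas \<one>"
  and mult_A: "f \<otimes>\<^bsub>A\<^esub> g = (\<lambda>u. \<Oplus>\<^bsub>K\<^esub>p \<in> {(s, t). s \<in> carrier S \<and> t \<in> carrier S \<and> s \<otimes> t = u}.
                        f (fst p) \<otimes>\<^bsub>K\<^esub> g (snd p))"
  by (simp_all add: semigroup_algebra_def)

lemma A_coeff: "f \<in> carrier A \<Longrightarrow> f s \<in> carrier K"
  by (cases "s \<in> carrier S") (auto simp: carrier_A lin_combs_def)

lemma A_coeff_outside: "f \<in> carrier A \<Longrightarrow> s \<notin> carrier S \<Longrightarrow> f s = \<zero>\<^bsub>K\<^esub>"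
  by (auto simp: carrier_A lin_combs_def)

lemma A_memI:
  "(\<And>s. s \<in> carrier S \<Longrightarrow> f s \<in> carrier K) \<Longrightarrow> (\<And>s. s \<notin> carrier S \<Longrightarrow> f s = \<zero>\<^bsub>K\<^esub>) \<Longrightarrow> f \<in> carrier A"
  by (auto simp: carrier_A lin_combs_def)

lemma finite_factorizations: "finite {(s, t). s \<in> carrier S \<and> t \<in> carrier S \<and> s \<otimes> t = u}"
  by (rule finite_subset[of _ "carrier S \<times> carrier S"]) (auto simp: finite_carrier)

lemma abelian_group_A: "abelian_group A"
proof (rule abelian_groupI)
  fix f assume f: "f \<in> carrier A"
  show "\<exists>g\<in>carrier A. g \<oplus>\<^bsub>A\<^esub> f = \<zero>\<^bsub>A\<^esub>"
    by (rule bexI[of _ "\<lambda>s. \<ominus>\<^bsub>K\<^esub> f s"])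
      (auto simp: add_A zero_A K.l_neg A_coeff[OF f] A_coeff_outside[OF f] intro!: A_memI)
qed (auto simp: add_A zero_A fun_eq_iff A_coeff A_coeff_outside K.a_ac intro!: A_memI)

text \<open>The product of \<open>A\<close> is in general neither commutative nor unital, so only
  the additive and scalar structure becomes an instance of a locale; the laws of the product are
  separate lemmas.\<close>

sublocale A: module K A
  by (rule moduleI)
    (auto simp: add_A smult_A zero_A fun_eq_iff A_coeff A_coeff_outside K.l_distr K.r_distr K.m_assoc
      K.cring_axioms abelian_group_A intro!: A_memI)

lemma bas_closed [simp, intro]: "s \<in> carrier S \<Longrightarrow> bas s \<in> carrier A"
  by (auto simp: basis_elem_def intro!: A_memI)

lemma A_mult_closed [simp, intro]:
  assumes "f \<in> carrier A" "g \<in> carrier A"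
  shows "f \<otimes>\<^bsub>A\<^esub> g \<in> carrier A"
proof (rule A_memI)
  fix u assume "u \<notin> carrier S"
  then have "{(s, t). s \<in> carrier S \<and> t \<in> carrier S \<and> s \<otimes> t = u} = {}"
    using mult_closed by auto
  then show "(f \<otimes>\<^bsub>A\<^esub> g) u = \<zero>\<^bsub>K\<^esub>" by (simp only: mult_A K.finsum_empty)
qed (use assms in \<open>auto simp: mult_A A_coeff intro!: K.finsum_closed\<close>)

lemma A_l_distr:
  assumes "f \<in> carrier A" "g \<in> carrier A" "h \<in> carrier A"
  shows "(f \<oplus>\<^bsub>A\<^esub> g) \<otimes>\<^bsub>A\<^esub> h = f \<otimes>\<^bsub>A\<^esub> h \<oplus>\<^bsub>A\<^esub> g \<otimes>\<^bsub>A\<^esub> h"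
  using assms
  by (auto simp: mult_A add_A fun_eq_iff A_coeff K.l_distr intro!: K.finsum_addf)

lemma A_r_distr:
  assumes "f \<in> carrier A" "g \<in> carrier A" "h \<in> carrier A"
  shows "h \<otimes>\<^bsub>A\<^esub> (f \<oplus>\<^bsub>A\<^esub> g) = h \<otimes>\<^bsub>A\<^esub> f \<oplus>\<^bsub>A\<^esub> h \<otimes>\<^bsub>A\<^esub> g"
  using assms
  by (auto simp: mult_A add_A fun_eq_iff A_coeff K.r_distr intro!: K.finsum_addf)

lemma A_smult_l:
  assumes "k \<in> carrier K" "f \<in> carrier A" "g \<in> carrier A"
  shows "(k \<odot>\<^bsub>A\<^esub> f) \<otimes>\<^bsub>A\<^esub> g = k \<odot>\<^bsub>A\<^esub> (f \<otimes>\<^bsub>A\<^esub> g)"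
  using assms
  by (auto simp: mult_A smult_A fun_eq_iff A_coeff K.finsum_rdistr finite_factorizations K.m_assoc
      intro!: K.finsum_cong')

lemma A_smult_r:
  assumes "k \<in> carrier K" "f \<in> carrier A" "g \<in> carrier A"
  shows "f \<otimes>\<^bsub>A\<^esub> (k \<odot>\<^bsub>A\<^esub> g) = k \<odot>\<^bsub>A\<^esub> (f \<otimes>\<^bsub>A\<^esub> g)"
  using assms
  by (auto simp: mult_A smult_A fun_eq_iff A_coeff K.finsum_rdistr finite_factorizations K.m_lcomm
      intro!: K.finsum_cong')

lemma A_mult_zero_left [simp]: "f \<in> carrier A \<Longrightarrow> \<zero>\<^bsub>A\<^esub> \<otimes>\<^bsub>A\<^esub> f = \<zero>\<^bsub>A\<^esub>"
  by (auto simp: mult_A zero_A fun_eq_iff A_coeff intro!: K.add.finprod_one_eqI)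

lemma A_mult_zero_right [simp]: "f \<in> carrier A \<Longrightarrow> f \<otimes>\<^bsub>A\<^esub> \<zero>\<^bsub>A\<^esub> = \<zero>\<^bsub>A\<^esub>"
  by (auto simp: mult_A zero_A fun_eq_iff A_coeff intro!: K.add.finprod_one_eqI)

text \<open>Among the factorizations of \<open>u\<close>, only the pair \<open>(s, t)\<close> can
  have both coefficients non-zero.\<close>

lemma bas_mult:
  assumes "s \<in> carrier S" "t \<in> carrier S"
  shows "bas s \<otimes>\<^bsub>A\<^esub> bas t = bas (s \<otimes> t)"
proof
  fix u
  let ?P = "{(s, t). s \<in> carrier S \<and> t \<in> carrier S \<and> s \<otimes> t = u}"
  have "(bas s \<otimes>\<^bsub>A\<^esub> bas t) u = (\<Oplus>\<^bsub>K\<^esub>p\<in>?P. if (s, t) = p then \<one>\<^bsub>K\<^esub> else \<zero>\<^bsub>K\<^esub>)"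
    by (auto simp: mult_A basis_elem_def intro!: K.finsum_cong')
  also have "\<dots> = bas (s \<otimes> t) u"
  proof (cases "s \<otimes> t = u")
    case True
    then show ?thesis
      using K.finsum_singleton[of "(s, t)" ?P "\<lambda>_. \<one>\<^bsub>K\<^esub>"] assms finite_factorizations
      by (auto simp: basis_elem_def)
  next
    case False
    then show ?thesis by (auto simp: basis_elem_def intro!: K.add.finprod_one_eqI)
  qed
  finally show "(bas s \<otimes>\<^bsub>A\<^esub> bas t) u = bas (s \<otimes> t) u" .
qed

lemma lin_combs_mono: "X \<subseteq> Y \<Longrightarrow> lin_combs K X \<subseteq> lin_combs K Y"
  by (auto simp: lin_combs_def)

lemma lin_combs_subset_A: "X \<subseteq> carrier S \<Longrightarrow> f \<in> lin_combs K X \<Longrightarrow> f \<in> carrier A"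
  using lin_combs_mono carrier_A by blast

lemma submodule_lin_combs:
  assumes "X \<subseteq> carrier S"
  shows "submodule (lin_combs K X) K A"
proof (rule A.submoduleI)
  fix f assume f: "f \<in> lin_combs K X"
  have "\<ominus>\<^bsub>A\<^esub> f = (\<lambda>s. \<ominus>\<^bsub>K\<^esub> f s)"
    using lin_combs_subset_A[OF assms f]
    by (intro A.minus_equality)
      (auto simp: add_A zero_A K.l_neg A_coeff A_coeff_outside intro!: A_memI)
  then show "\<ominus>\<^bsub>A\<^esub> f \<in> lin_combs K X" using f by (auto simp: lin_combs_def)
qed (use assms in \<open>auto simp: lin_combs_subset_A\<close>, auto simp: lin_combs_def zero_A add_A smult_A)

text \<open>Relative to a subset \<open>X\<close>, because linear statements are also needed on the
  ideal \<open>KI\<close> and on \<open>KG\<close>, both of which are subsets of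
  \<open>KS\<close>.\<close>

lemma A_induct_on [consumes 2, case_names zero add]:
  assumes "X \<subseteq> carrier S" and "f \<in> lin_combs K X"
    and "P \<zero>\<^bsub>A\<^esub>"
    and "\<And>k s f. \<lbrakk>k \<in> carrier K; s \<in> X; f \<in> lin_combs K X; P f\<rbrakk> \<Longrightarrow> P (k \<odot>\<^bsub>A\<^esub> bas s \<oplus>\<^bsub>A\<^esub> f)"
  shows "P f"
  using finite_subset[OF assms(1) finite_carrier] assms(2) K.cring_axioms
  by (rule lin_combs_induct) (use assms(3,4) in \<open>auto simp: zero_A add_A smult_A\<close>)

lemma A_induct [consumes 1, case_names zero add]:
  assumes "f \<in> carrier A"
    and "P \<zero>\<^bsub>A\<^esub>"
    and "\<And>k s f. \<lbrakk>k \<in> carrier K; s \<in> carrier S; f \<in> carrier A; P f\<rbrakk> \<Longrightarrow> P (k \<odot>\<^bsub>A\<^esub> bas s \<oplus>\<^bsub>A\<^esub> f)"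
  shows "P f"
  using subset_refl assms(1)[unfolded carrier_A]
  by (rule A_induct_on) (use assms in \<open>auto simp: carrier_A\<close>)

lemmas A_bilinear = A_l_distr A_r_distr A_smult_l A_smult_r bas_mult

text \<open>Both sides are linear in each argument, so associativity in \<open>S\<close> suffices;
  the arguments are reduced to basis elements one at a time, \<open>h\<close> first and
  \<open>f\<close> last.\<close>

lemma A_mult_assoc:
  assumes "f \<in> carrier A" "g \<in> carrier A" "h \<in> carrier A"
  shows "(f \<otimes>\<^bsub>A\<^esub> g) \<otimes>\<^bsub>A\<^esub> h = f \<otimes>\<^bsub>A\<^esub> (g \<otimes>\<^bsub>A\<^esub> h)"
proof -
  have 1: "(bas s \<otimes>\<^bsub>A\<^esub> bas t) \<otimes>\<^bsub>A\<^esub> h = bas s \<otimes>\<^bsub>A\<^esub> (bas t \<otimes>\<^bsub>A\<^esub> h)"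
    if "s \<in> carrier S" "t \<in> carrier S" for s t
    using assms(3) by (induction rule: A_induct) (use that in \<open>auto simp: A_bilinear mult_closed mult_assoc\<close>)
  have 2: "(bas s \<otimes>\<^bsub>A\<^esub> g) \<otimes>\<^bsub>A\<^esub> h = bas s \<otimes>\<^bsub>A\<^esub> (g \<otimes>\<^bsub>A\<^esub> h)" if "s \<in> carrier S" for s
    using assms(2) by (induction rule: A_induct) (use that assms 1 in \<open>auto simp: A_l_distr A_r_distr A_smult_l A_smult_r\<close>)
  show ?thesis
    using assms(1) by (induction rule: A_induct) (use assms 2 in \<open>auto simp: A_l_distr A_r_distr A_smult_l A_smult_r\<close>)
qed

end

section \<open>Regular classes and maximal subgroups\<close>

context finite_semigroup
begin

section \<open>Principal ideals and idempotents\<close>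

abbreviation "pideal \<equiv> principal_ideal S"

lemma pideal_cases [consumes 1, case_names self left right both]:
  assumes "t \<in> pideal s"
  obtains "t = s" | x where "x \<in> carrier S" "t = x \<otimes> s" | y where "y \<in> carrier S" "t = s \<otimes> y"
    | x y where "x \<in> carrier S" "y \<in> carrier S" "t = x \<otimes> s \<otimes> y"
  using assms by (auto simp: principal_ideal_def)

lemma pideal_refl [simp]: "s \<in> pideal s"
  by (auto simp: principal_ideal_def)

lemma pideal_left: "x \<in> carrier S \<Longrightarrow> x \<otimes> s \<in> pideal s"
  by (auto simp: principal_ideal_def)

lemma pideal_right: "y \<in> carrier S \<Longrightarrow> s \<otimes> y \<in> pideal s"
  by (auto simp: principal_ideal_def)

lemma pideal_both: "x \<in> carrier S \<Longrightarrow> y \<in> carrier S \<Longrightarrow> x \<otimes> s \<otimes> y \<in> pideal s"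
  by (auto simp: principal_ideal_def)

lemma pideal_subset: "s \<in> carrier S \<Longrightarrow> pideal s \<subseteq> carrier S"
  by (auto simp: principal_ideal_def mult_closed)

lemma pideal_mult_left:
  assumes "s \<in> carrier S" "t \<in> pideal s" "x \<in> carrier S"
  shows "x \<otimes> t \<in> pideal s"
proof -
  from assms(2) show ?thesis
  proof (cases rule: pideal_cases)
    case (left y)
    then show ?thesis using pideal_left[of "x \<otimes> y" s] assms by (simp add: mult_closed mult_assoc)
  next
    case (right z)
    then show ?thesis using assms pideal_both by (simp flip: mult_assoc)
  next
    case (both y z)
    then have "x \<otimes> t = (x \<otimes> y) \<otimes> s \<otimes> z" using assms by (simp add: mult_closed mult_assoc)
    then show ?thesis using both assms pideal_both mult_closed by simp
  qed (use assms pideal_left in auto)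
qed

lemma pideal_mult_right:
  assumes "s \<in> carrier S" "t \<in> pideal s" "y \<in> carrier S"
  shows "t \<otimes> y \<in> pideal s"
proof -
  from assms(2) show ?thesis
  proof (cases rule: pideal_cases)
    case (left x)
    then show ?thesis using assms pideal_both by simp
  next
    case (right z)
    then show ?thesis using pideal_right[of "z \<otimes> y" s] assms by (simp add: mult_closed mult_assoc)
  next
    case (both x z)
    then have "t \<otimes> y = x \<otimes> s \<otimes> (z \<otimes> y)" using assms by (simp add: mult_closed mult_assoc)
    then show ?thesis using both assms pideal_both mult_closed by simp
  qed (use assms pideal_right in auto)
qed

lemma pideal_mono:
  assumes "s \<in> carrier S" "t \<in> pideal s"
  shows "pideal t \<subseteq> pideal s"
proof
  fix u assume "u \<in> pideal t"
  then show "u \<in> pideal s"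
    by (cases rule: pideal_cases) (use assms pideal_mult_left pideal_mult_right in auto)
qed

text \<open>For \<open>x\<close> in a closed set \<open>T\<close>, the sets \<open>x T\<close> and
  \<open>{y. x y = x}\<close> are closed as well. If a non-empty one of them is smaller than
  \<open>T\<close>, induction on the cardinality applies. If \<open>x T = T\<close>, the second is
  non-empty, and if it is all of \<open>T\<close>, then \<open>x x = x\<close>.\<close>

lemma idempotent_in_closed_subset:
  assumes "T \<subseteq> carrier S" "T \<noteq> {}" "\<And>x y. x \<in> T \<Longrightarrow> y \<in> T \<Longrightarrow> x \<otimes> y \<in> T"
  shows "\<exists>f\<in>T. f \<otimes> f = f"
  using assms
proof (induction "card T" arbitrary: T rule: less_induct)
  case less
  have fin: "finite T" using less.prems(1) finite_carrier finite_subset by blast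
  obtain x where x: "x \<in> T" using less.prems by auto
  have smaller: ?case if "U \<subset> T" "U \<noteq> {}" "\<And>x y. x \<in> U \<Longrightarrow> y \<in> U \<Longrightarrow> x \<otimes> y \<in> U" for U
    using less.hyps[of U] psubset_card_mono[OF fin that(1)] that less.prems by blast
  let ?xT = "(\<otimes>) x ` T" and ?U = "{y \<in> T. x \<otimes> y = x}"
  have S: "y \<in> T \<Longrightarrow> y \<in> carrier S" for y using less.prems by auto
  have "?xT \<subseteq> T" "?xT \<noteq> {}" using x less.prems by auto
  moreover have "u \<otimes> v \<in> ?xT" if "u \<in> ?xT" "v \<in> ?xT" for u v
    using that less.prems(3) x by (auto simp: S mult_assoc)
  ultimately have "?xT = T \<or> ?case" using smaller[of ?xT] by blast
  moreover
  have U: "u \<otimes> v \<in> ?U" if "u \<in> ?U" "v \<in> ?U" for u v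
    using that less.prems(3) x by (auto simp: S mult_assoc[symmetric])
  have "?case" if "?xT = T"
  proof -
    have "x \<in> ?xT" by (simp only: that x)
    then obtain y where "y \<in> T" "x = x \<otimes> y" by (rule imageE)
    then have "y \<in> ?U" by simp
    then have "?U \<noteq> {}" by blast
    then have "?U = T \<or> ?case" using smaller[of ?U] U by blast
    then show ?case using x by blast
  qed
  ultimately show ?case by blast
qed

lemma J_rel_iff: "(s, t) \<in> J_rel S \<longleftrightarrow> s \<in> carrier S \<and> t \<in> carrier S \<and> pideal s = pideal t"
  by (auto simp: J_rel_def)

lemma regular_J_class_eq:
  assumes "J \<in> regular_J_classes S" "s \<in> J"
  shows "s \<in> carrier S" "J = {t \<in> carrier S. pideal t = pideal s}"
  using assms by (auto simp: regular_J_classes_def quotient_def J_rel_iff)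

text \<open>
  If \<open>a = x a b y\<close>, the elements \<open>t\<close> below \<open>b\<close> with \<open>a \<in> S\<^sup>1 a t\<close> form a subsemigroup containing
  \<open>b y\<close>. An idempotent \<open>f\<close> in it satisfies \<open>a = a f\<close>.
\<close>

lemma regular_J_classI:
  assumes a: "a \<in> carrier S" and b: "b \<in> carrier S"
    and ab: "a \<in> pideal (a \<otimes> b)" and eq: "pideal b = pideal a"
  shows "{t \<in> carrier S. pideal t = pideal a} \<in> regular_J_classes S"
proof -
  let ?T = "{t \<in> pideal b. a = a \<otimes> t \<or> (\<exists>x\<in>carrier S. a = x \<otimes> (a \<otimes> t))}"
  have Tc: "?T \<subseteq> carrier S" using pideal_subset b by auto
  have "\<exists>t. t \<in> ?T"
  proof -
    consider "a = a \<otimes> b" | x where "x \<in> carrier S" "a = x \<otimes> (a \<otimes> b)"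
      | y where "y \<in> carrier S" "a = a \<otimes> b \<otimes> y"
      | x y where "x \<in> carrier S" "y \<in> carrier S" "a = x \<otimes> (a \<otimes> b) \<otimes> y"
      using ab unfolding principal_ideal_def by blast
    then show ?thesis
    proof cases
      case (3 y)
      then have "b \<otimes> y \<in> ?T" using a b pideal_right by (auto simp: mult_assoc)
      then show ?thesis by blast
    next
      case (4 x y)
      then have "b \<otimes> y \<in> ?T" using a b pideal_right by (auto simp: mult_assoc mult_closed)
      then show ?thesis by blast
    qed (use a b in \<open>auto intro: exI[of _ b]\<close>)
  qed
  moreover have "t \<otimes> u \<in> ?T" if tT: "t \<in> ?T" and uT: "u \<in> ?T" for t u
  proof -
    have S: "t \<in> carrier S" "u \<in> carrier S" using tT uT Tc by auto
    consider "a = a \<otimes> u" | x where "x \<in> carrier S" "a = x \<otimes> (a \<otimes> u)" using uT by blast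
    then have "a = a \<otimes> (t \<otimes> u) \<or> (\<exists>x\<in>carrier S. a = x \<otimes> (a \<otimes> (t \<otimes> u)))"
    proof cases
      case 1
      have *: "a \<otimes> (t \<otimes> u) = a \<otimes> t \<otimes> u" using S a by (simp add: mult_assoc)
      consider "a = a \<otimes> t" | x where "x \<in> carrier S" "a = x \<otimes> (a \<otimes> t)" using tT by blast
      then show ?thesis
      proof cases
        case 1
        then show ?thesis using * \<open>a = a \<otimes> u\<close> by simp
      next
        case (2 x)
        have "a = x \<otimes> (a \<otimes> t) \<otimes> u" using 2 \<open>a = a \<otimes> u\<close> by simp
        also have "\<dots> = x \<otimes> (a \<otimes> (t \<otimes> u))" using 2(1) S a by (simp add: mult_assoc mult_closed)
        finally show ?thesis using 2(1) by blast
      qed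
    next
      case (2 x)
      consider "a = a \<otimes> t" | x' where "x' \<in> carrier S" "a = x' \<otimes> (a \<otimes> t)" using tT by blast
      then show ?thesis
      proof cases
        case 1
        then have "a \<otimes> (t \<otimes> u) = a \<otimes> u" using S a mult_assoc[of a t u] by simp
        then show ?thesis using 2 by auto
      next
        case (2 x')
        have "a = x \<otimes> ((x' \<otimes> (a \<otimes> t)) \<otimes> u)"
          using \<open>a = x \<otimes> (a \<otimes> u)\<close> \<open>a = x' \<otimes> (a \<otimes> t)\<close> by simp
        also have "\<dots> = (x \<otimes> x') \<otimes> (a \<otimes> (t \<otimes> u))"
          using \<open>x \<in> carrier S\<close> \<open>x' \<in> carrier S\<close> S a by (simp add: mult_assoc mult_closed)
        finally show ?thesis using \<open>x \<in> carrier S\<close> \<open>x' \<in> carrier S\<close> mult_closed by blast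
      qed
    qed
    then show ?thesis using tT pideal_mult_right[OF b _ S(2)] by auto
  qed
  ultimately obtain f where f: "f \<in> ?T" "f \<otimes> f = f"
    using idempotent_in_closed_subset[OF Tc] by blast
  have fS: "f \<in> carrier S" using f Tc by blast
  have "a \<otimes> f = a"
  proof -
    have *: "a \<otimes> f \<otimes> f = a \<otimes> f" using f(2) a fS by (simp add: mult_assoc)
    consider "a = a \<otimes> f" | x where "x \<in> carrier S" "a = x \<otimes> (a \<otimes> f)" using f(1) by blast
    then show ?thesis
    proof cases
      case (2 x)
      have "a \<otimes> f = x \<otimes> (a \<otimes> f) \<otimes> f" using 2 by simp
      also have "\<dots> = x \<otimes> (a \<otimes> f)" using * 2(1) a fS by (simp add: mult_assoc mult_closed)
      finally show ?thesis using 2 by simp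
    qed simp
  qed
  \<comment> \<open>\<open>f\<close> lies below \<open>b\<close>, hence below \<open>a\<close>, and
    now \<open>a = a f\<close> lies below \<open>f\<close>: the idempotent is in the class of
    \<open>a\<close>.\<close>
  then have "a \<in> pideal f" using pideal_left[OF a, of f] by simp
  then have "pideal f = pideal a" using pideal_mono fS f b eq by blast
  then have fJ: "f \<in> {t \<in> carrier S. pideal t = pideal a}" using fS by simp
  have "{t \<in> carrier S. pideal t = pideal a} = J_rel S `` {a}" using a by (auto simp: J_rel_iff)
  then have "{t \<in> carrier S. pideal t = pideal a} \<in> carrier S // J_rel S"
    using quotientI[OF a] by simp
  with fJ f(2) show ?thesis unfolding regular_J_classes_def by blast
qed

end

locale J_class = semigroup_over_cring S K
  for S :: "('s, 'x) monoid_scheme" (structure) and K :: "('k, 'y) ring_scheme" +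
  fixes J :: "'s set" and e :: 's
  assumes J: "J \<in> regular_J_classes S" and e_in_J: "e \<in> J" and e_idem: "e \<otimes> e = e"
begin

abbreviation "I \<equiv> apex_ideal S J"
abbreviation "G \<equiv> maximal_subgroup S e"
abbreviation "KG \<equiv> semigroup_algebra K G"
abbreviation "KI \<equiv> lin_combs K I"

lemma e_closed [simp, intro]: "e \<in> carrier S"
  and J_eq: "J = {t \<in> carrier S. pideal t = pideal e}"
  using regular_J_class_eq[OF J e_in_J] by auto

text \<open>All elements of \<open>J\<close> generate the same ideal as \<open>e\<close>, so
  \<open>pideal s\<close> contains the whole class as soon as it contains this one element.\<close>

lemma I_iff: "s \<in> I \<longleftrightarrow> s \<in> carrier S \<and> e \<notin> pideal s"
proof -
  have "J \<subseteq> pideal s \<longleftrightarrow> e \<in> pideal s" if "s \<in> carrier S"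
    using pideal_mono[OF that] pideal_refl unfolding J_eq by (metis (mono_tags, lifting) e_closed mem_Collect_eq subset_iff)
  then show ?thesis by (auto simp: apex_ideal_def)
qed

lemma e_notin_I: "e \<notin> I"
  by (simp add: I_iff)

lemma I_subset: "I \<subseteq> carrier S"
  by (auto simp: apex_ideal_def)

lemma I_left: "s \<in> I \<Longrightarrow> x \<in> carrier S \<Longrightarrow> x \<otimes> s \<in> I"
  and I_right: "s \<in> I \<Longrightarrow> x \<in> carrier S \<Longrightarrow> s \<otimes> x \<in> I"
  unfolding I_iff using mult_closed pideal_left pideal_right pideal_mono by blast+

section \<open>The local monoid at \<open>e\<close> and its group of units\<close>

lemma local_monoid_carrier: "carrier (local_monoid S e) = {s \<in> carrier S. e \<otimes> s = s \<and> s \<otimes> e = s}"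
proof -
  have "e \<otimes> (e \<otimes> s \<otimes> e) = e \<otimes> s \<otimes> e" "(e \<otimes> s \<otimes> e) \<otimes> e = e \<otimes> s \<otimes> e" if "s \<in> carrier S" for s
    using that mult_assoc[of e e s] by (simp_all add: mult_assoc mult_closed e_idem flip: mult_assoc[of e e])
  then show ?thesis by (auto simp: local_monoid_def mult_closed) metis
qed

lemma local_monoid_simps: "x \<otimes>\<^bsub>local_monoid S e\<^esub> y = x \<otimes> y" "\<one>\<^bsub>local_monoid S e\<^esub> = e"
  by (simp_all add: local_monoid_def)

lemma corner_in_local_monoid: "s \<in> carrier S \<Longrightarrow> e \<otimes> s \<otimes> e \<in> carrier (local_monoid S e)"
  by (auto simp: local_monoid_def)

sublocale L: Group.monoid "local_monoid S e"
proof (rule Group.monoidI)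
  fix x y assume "x \<in> carrier (local_monoid S e)" "y \<in> carrier (local_monoid S e)"
  then show "x \<otimes>\<^bsub>local_monoid S e\<^esub> y \<in> carrier (local_monoid S e)"
    by (auto simp: local_monoid_carrier local_monoid_simps mult_closed mult_assoc)
      (simp flip: mult_assoc)
qed (auto simp: local_monoid_carrier local_monoid_simps mult_assoc e_idem)

text \<open>A pigeonhole argument: left multiplication by \<open>p\<close> is undone by
  \<open>x\<close>, hence injective on the finite monoid \<open>eSe\<close>, hence onto. So
  \<open>p u = e\<close> for some \<open>u\<close>, and \<open>x = x p u = u\<close>.\<close>

lemma L_right_inverse_unit:
  assumes "x \<in> carrier (local_monoid S e)" "p \<in> carrier (local_monoid S e)" "x \<otimes> p = e"
  shows "p \<otimes> x = e"
proof -
  let ?M = "local_monoid S e"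
  note L = assms(1,2) L.m_closed L.m_assoc L.l_one L.r_one
  have fin: "finite (carrier ?M)" by (auto simp: local_monoid_carrier finite_carrier)
  have "inj_on ((\<otimes>) p) (carrier ?M)"
    by (rule inj_on_inverseI[of _ "(\<otimes>) x"])
      (metis L assms(3) local_monoid_simps)
  moreover have "(\<otimes>) p ` carrier ?M \<subseteq> carrier ?M" using L by (auto simp: local_monoid_simps)
  ultimately have "(\<otimes>) p ` carrier ?M = carrier ?M" using fin endo_inj_surj by blast
  then have "e \<in> (\<otimes>) p ` carrier ?M" using L.one_closed local_monoid_simps by auto
  then obtain u where u: "u \<in> carrier ?M" "p \<otimes> u = e" by auto
  have "x = x \<otimes> (p \<otimes> u)" using u assms by (simp add: local_monoid_carrier)
  also have "\<dots> = u" using L.m_assoc[OF assms(1,2) u(1)] assms(3) u by (simp add: local_monoid_simps local_monoid_carrier)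
  finally show ?thesis using u by simp
qed

text \<open>The content is that an element of \<open>eSe\<close> outside \<open>I\<close> is
  invertible. It satisfies \<open>p s q = e\<close> with \<open>p\<close> and \<open>q\<close> in
  \<open>eSe\<close>, which only makes \<open>s q\<close> a right inverse of \<open>p\<close>;
  passing twice from one-sided to two-sided inverses shows that \<open>q p\<close> inverts
  \<open>s\<close>.\<close>

lemma G_iff: "s \<in> carrier G \<longleftrightarrow> s \<in> carrier S \<and> e \<otimes> s = s \<and> s \<otimes> e = s \<and> s \<notin> I"
proof
  assume "s \<in> carrier G"
  then obtain t where t: "s \<in> carrier (local_monoid S e)" "t \<in> carrier (local_monoid S e)" "s \<otimes> t = e"
    by (auto simp: maximal_subgroup_def units_of_def Units_def local_monoid_simps)
  then have "e \<in> pideal s" using pideal_right[of t s] by (auto simp: local_monoid_carrier)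
  then show "s \<in> carrier S \<and> e \<otimes> s = s \<and> s \<otimes> e = s \<and> s \<notin> I"
    using t by (auto simp: local_monoid_carrier I_iff)
next
  assume s: "s \<in> carrier S \<and> e \<otimes> s = s \<and> s \<otimes> e = s \<and> s \<notin> I"
  let ?M = "local_monoid S e"
  have sM: "s \<in> carrier ?M" using s by (simp add: local_monoid_carrier)
  have "e \<in> pideal s" using s by (auto simp: I_iff)
  \<comment> \<open>Where a factor is the adjoined identity of \<open>S^1\<close>, the idempotent
    \<open>e\<close> can take its place, since it fixes \<open>s\<close> on both sides.\<close>
  then have "\<exists>x\<in>carrier S. \<exists>y\<in>carrier S. e = x \<otimes> s \<otimes> y"
  proof (cases rule: pideal_cases)
    case self
    then have "e = e \<otimes> s \<otimes> e" using e_idem by metis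
    then show ?thesis using e_closed by blast
  next
    case (left x)
    then have "e = x \<otimes> s \<otimes> e" using e_idem by metis
    then show ?thesis using left e_closed by blast
  next
    case (right y)
    then have "e = e \<otimes> s \<otimes> y" using s by metis
    then show ?thesis using right e_closed by blast
  qed blast
  then obtain x y where xy: "x \<in> carrier S" "y \<in> carrier S" "x \<otimes> s \<otimes> y = e" by metis
  \<comment> \<open>Cutting \<open>x\<close> and \<open>y\<close> down to \<open>eSe\<close> keeps
    the product with \<open>s\<close> equal to \<open>e\<close>, because
    \<open>e s e = s\<close>.\<close>
  define p q where "p = e \<otimes> x \<otimes> e" and "q = e \<otimes> y \<otimes> e"
  have pq: "p \<in> carrier ?M" "q \<in> carrier ?M"
    using xy corner_in_local_monoid by (auto simp: p_def q_def)
  have "s \<otimes> (e \<otimes> z) = s \<otimes> z" "e \<otimes> (s \<otimes> z) = s \<otimes> z" "x \<otimes> (s \<otimes> (y \<otimes> z)) = e \<otimes> z"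
    if "z \<in> carrier S" for z
    using that s xy mult_assoc[of s e z] mult_assoc[of e s z] mult_assoc[of x "s \<otimes> y" z]
      mult_assoc[of s y z] mult_assoc[of x s y]
    by (simp_all add: mult_closed)
  then have "p \<otimes> s \<otimes> q = e"
    using xy s e_idem by (simp add: p_def q_def mult_assoc mult_closed)
  then have 1: "p \<otimes> (s \<otimes> q) = e" and 2: "(p \<otimes> s) \<otimes> q = e"
    using pq sM by (auto simp: local_monoid_carrier mult_assoc)
  have M: "s \<otimes> q \<in> carrier ?M" "p \<otimes> s \<in> carrier ?M" "q \<otimes> p \<in> carrier ?M"
    using pq sM L.m_closed by (auto simp: local_monoid_simps)
  have "s \<otimes> (q \<otimes> p) = e"
    using L_right_inverse_unit[OF pq(1) M(1) 1] pq sM by (auto simp: local_monoid_carrier mult_assoc)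
  moreover have "(q \<otimes> p) \<otimes> s = e"
    using L_right_inverse_unit[OF sM M(3) calculation] .
  ultimately show "s \<in> carrier G"
    using sM M by (auto simp: maximal_subgroup_def units_of_def Units_def local_monoid_simps)
qed

lemma G_simps: "x \<otimes>\<^bsub>G\<^esub> y = x \<otimes> y" "\<one>\<^bsub>G\<^esub> = e"
  by (simp_all add: maximal_subgroup_def units_of_def local_monoid_def)

lemma G_subset: "carrier G \<subseteq> carrier S"
  by (auto simp: G_iff)

lemma G_disjoint_I: "carrier G \<inter> I = {}"
  by (auto simp: G_iff)

lemma e_in_G: "e \<in> carrier G"
  by (auto simp: G_iff e_idem e_notin_I)

lemma G_mult_closed: "x \<in> carrier G \<Longrightarrow> y \<in> carrier G \<Longrightarrow> x \<otimes> y \<in> carrier G"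
  using L.Units_m_closed by (simp add: maximal_subgroup_def units_of_def local_monoid_simps)

sublocale G: semigroup_over_cring G K
  by unfold_locales
    (use G_subset finite_carrier in \<open>auto simp: G_simps G_mult_closed intro: finite_subset intro!: mult_assoc\<close>)

lemma corner_cases:
  assumes "s \<in> carrier S"
  shows "e \<otimes> s \<otimes> e \<in> carrier G \<or> e \<otimes> s \<otimes> e \<in> I"
  using corner_in_local_monoid[OF assms] by (auto simp: G_iff local_monoid_carrier)

section \<open>The group algebra \<open>KG\<close> and the ideal \<open>KI\<close> inside
  \<open>KS\<close>\<close>

lemma KG_eq: "carrier KG = lin_combs K (carrier G)"
  by (rule G.carrier_A)

lemma KG_subset: "b \<in> carrier KG \<Longrightarrow> b \<in> carrier A"
  using lin_combs_subset_A[OF G_subset] by (simp add: KG_eq)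

lemma KG_ops: "f \<oplus>\<^bsub>KG\<^esub> g = f \<oplus>\<^bsub>A\<^esub> g" "k \<odot>\<^bsub>KG\<^esub> f = k \<odot>\<^bsub>A\<^esub> f" "\<zero>\<^bsub>KG\<^esub> = \<zero>\<^bsub>A\<^esub>" "\<one>\<^bsub>KG\<^esub> = bas e"
  by (simp_all add: add_A smult_A zero_A G.add_A G.smult_A G.zero_A G.one_A G_simps)

lemma KG_closed:
  "f \<in> carrier KG \<Longrightarrow> g \<in> carrier KG \<Longrightarrow> f \<oplus>\<^bsub>A\<^esub> g \<in> carrier KG"
  "k \<in> carrier K \<Longrightarrow> f \<in> carrier KG \<Longrightarrow> k \<odot>\<^bsub>A\<^esub> f \<in> carrier KG"
  using G.A.a_closed[of f g] G.A.smult_closed[of k f] by (simp_all add: KG_ops)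

text \<open>The two convolutions sum over factorizations in \<open>G\<close> and in \<open>S\<close>
  respectively; the additional factorizations contribute nothing, as both functions vanish outside
  \<open>G\<close>.\<close>

lemma KG_mult:
  assumes "f \<in> carrier KG" "g \<in> carrier KG"
  shows "f \<otimes>\<^bsub>KG\<^esub> g = f \<otimes>\<^bsub>A\<^esub> g"
proof
  fix u
  have supp: "s \<in> carrier G \<and> t \<in> carrier G" if "f s \<otimes>\<^bsub>K\<^esub> g t \<noteq> \<zero>\<^bsub>K\<^esub>" for s t
    using that assms by (metis G.A_coeff G.A_coeff_outside K.l_null K.r_null)
  show "(f \<otimes>\<^bsub>KG\<^esub> g) u = (f \<otimes>\<^bsub>A\<^esub> g) u"
    unfolding mult_A G.mult_A
    by (intro K.add.finprod_mono_neutral_cong_left)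
      (use assms finite_factorizations G_subset in \<open>auto simp: G_simps G.A_coeff dest: supp\<close>)
qed

lemma bas_e_KG: "bas e \<in> carrier KG"
  using G.bas_closed e_in_G .

lemma bas_e_idem: "bas e \<otimes>\<^bsub>A\<^esub> bas e = bas e"
  by (simp add: bas_mult e_idem)

lemma KG_e:
  assumes "b \<in> carrier KG"
  shows "bas e \<otimes>\<^bsub>A\<^esub> b = b" "b \<otimes>\<^bsub>A\<^esub> bas e = b"
proof -
  have "b \<in> lin_combs K (carrier G)" using assms KG_eq by simp
  with G_subset have "bas e \<otimes>\<^bsub>A\<^esub> b = b \<and> b \<otimes>\<^bsub>A\<^esub> bas e = b"
    by (induction rule: A_induct_on)
      (use G_subset lin_combs_subset_A[OF G_subset] in
        \<open>auto simp: A_bilinear G_iff subset_iff\<close>)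
  then show "bas e \<otimes>\<^bsub>A\<^esub> b = b" "b \<otimes>\<^bsub>A\<^esub> bas e = b" by auto
qed

sublocale KI: submodule KI K A
  by (rule submodule_lin_combs[OF I_subset])

lemma KI_subset: "c \<in> KI \<Longrightarrow> c \<in> carrier A"
  using lin_combs_subset_A[OF I_subset] .

lemma KI_closed:
  "c \<in> KI \<Longrightarrow> d \<in> KI \<Longrightarrow> c \<oplus>\<^bsub>A\<^esub> d \<in> KI"
  "k \<in> carrier K \<Longrightarrow> c \<in> KI \<Longrightarrow> k \<odot>\<^bsub>A\<^esub> c \<in> KI"
  "\<zero>\<^bsub>A\<^esub> \<in> KI"
  "s \<in> I \<Longrightarrow> bas s \<in> KI"
  using A.submoduleE[OF KI.submodule_axioms] KI.one_closed
  by (auto simp: lin_combs_def basis_elem_def)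

lemma KI_ideal:
  assumes "c \<in> KI" "a \<in> carrier A"
  shows "c \<otimes>\<^bsub>A\<^esub> a \<in> KI" "a \<otimes>\<^bsub>A\<^esub> c \<in> KI"
proof -
  have 1: "bas s \<otimes>\<^bsub>A\<^esub> a \<in> KI \<and> a \<otimes>\<^bsub>A\<^esub> bas s \<in> KI" if "s \<in> I" for s
    using assms(2) by (induction rule: A_induct)
      (use that I_subset in \<open>auto simp: A_bilinear subset_iff I_left I_right intro!: KI_closed\<close>)
  have "c \<otimes>\<^bsub>A\<^esub> a \<in> KI \<and> a \<otimes>\<^bsub>A\<^esub> c \<in> KI"
    using I_subset assms(1) by (induction rule: A_induct_on)
      (use assms(2) 1 I_subset KI_subset in
        \<open>auto simp: A_l_distr A_r_distr A_smult_l A_smult_r subset_iff intro!: KI_closed\<close>)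
  then show "c \<otimes>\<^bsub>A\<^esub> a \<in> KI" "a \<otimes>\<^bsub>A\<^esub> c \<in> KI" by auto
qed

text \<open>The isomorphism of \<open>e (KS/KI\<^sub>J) e\<close> with \<open>KG\<^sub>J\<close>, composed with \<open>a \<mapsto> e a e\<close>.\<close>

definition proj :: "('s \<Rightarrow> 'k) \<Rightarrow> 's \<Rightarrow> 'k" where
  "proj a = (\<lambda>s. if s \<in> carrier G then (bas e \<otimes>\<^bsub>A\<^esub> a \<otimes>\<^bsub>A\<^esub> bas e) s else \<zero>\<^bsub>K\<^esub>)"

lemma proj_closed [simp, intro]: "a \<in> carrier A \<Longrightarrow> proj a \<in> carrier KG"
  by (auto simp: KG_eq proj_def lin_combs_def A_coeff)

lemma proj_add: "a \<in> carrier A \<Longrightarrow> b \<in> carrier A \<Longrightarrow> proj (a \<oplus>\<^bsub>A\<^esub> b) = proj a \<oplus>\<^bsub>A\<^esub> proj b"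
  by (simp add: proj_def A_l_distr A_r_distr cong: if_cong) (auto simp: add_A A_coeff)

lemma proj_smult: "k \<in> carrier K \<Longrightarrow> a \<in> carrier A \<Longrightarrow> proj (k \<odot>\<^bsub>A\<^esub> a) = k \<odot>\<^bsub>A\<^esub> proj a"
  by (simp add: proj_def A_smult_l A_smult_r cong: if_cong) (auto simp: smult_A A_coeff)

text \<open>\<open>e c e\<close> remains in the ideal \<open>KI\<close>, whose elements vanish on
  \<open>G\<close> because \<open>G\<close> is disjoint from \<open>I\<close>.\<close>

lemma proj_KI:
  assumes "c \<in> KI"
  shows "proj c = \<zero>\<^bsub>A\<^esub>"
proof -
  have "bas e \<otimes>\<^bsub>A\<^esub> c \<otimes>\<^bsub>A\<^esub> bas e \<in> KI" using KI_ideal assms by auto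
  then show ?thesis using G_disjoint_I by (auto simp: proj_def zero_A lin_combs_def fun_eq_iff)
qed

lemma proj_KG: "b \<in> carrier KG \<Longrightarrow> proj b = b"
  by (auto simp: proj_def KG_e G.A_coeff_outside fun_eq_iff)

text \<open>The linear form of \<open>corner_cases\<close>: each \<open>e s e\<close> goes into the
  summand from \<open>KG\<close> or into the one from \<open>KI\<close>. The first summand has to be
  \<open>proj a\<close>, because the second one vanishes on \<open>G\<close>.\<close>

lemma corner_decomp:
  assumes "a \<in> carrier A"
  shows "\<exists>c\<in>KI. bas e \<otimes>\<^bsub>A\<^esub> a \<otimes>\<^bsub>A\<^esub> bas e = proj a \<oplus>\<^bsub>A\<^esub> c"
proof -
  have "\<exists>b\<in>carrier KG. \<exists>c\<in>KI. bas e \<otimes>\<^bsub>A\<^esub> a \<otimes>\<^bsub>A\<^esub> bas e = b \<oplus>\<^bsub>A\<^esub> c"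
    using assms
  proof (induction rule: A_induct)
    case zero
    show ?case by (intro bexI[of _ "\<zero>\<^bsub>A\<^esub>"]) (use KI_closed G.A.zero_closed in \<open>auto simp: KG_ops\<close>)
  next
    case (add k s f)
    then obtain b c where bc: "b \<in> carrier KG" "c \<in> KI" "bas e \<otimes>\<^bsub>A\<^esub> f \<otimes>\<^bsub>A\<^esub> bas e = b \<oplus>\<^bsub>A\<^esub> c" by blast
    let ?d = "k \<odot>\<^bsub>A\<^esub> bas (e \<otimes> s \<otimes> e)"
    have d: "?d \<in> carrier A" using add mult_closed by auto
    have eq: "bas e \<otimes>\<^bsub>A\<^esub> (k \<odot>\<^bsub>A\<^esub> bas s \<oplus>\<^bsub>A\<^esub> f) \<otimes>\<^bsub>A\<^esub> bas e = ?d \<oplus>\<^bsub>A\<^esub> (b \<oplus>\<^bsub>A\<^esub> c)"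
      using add bc by (auto simp: A_bilinear mult_closed)
    show ?case
    proof (cases "e \<otimes> s \<otimes> e \<in> I")
      case True
      have "?d \<oplus>\<^bsub>A\<^esub> (b \<oplus>\<^bsub>A\<^esub> c) = b \<oplus>\<^bsub>A\<^esub> (?d \<oplus>\<^bsub>A\<^esub> c)"
        using d bc KG_subset KI_subset by (intro A.a_lcomm) auto
      then show ?thesis using eq bc True add.hyps by (metis KI_closed)
    next
      case False
      have "?d \<oplus>\<^bsub>A\<^esub> (b \<oplus>\<^bsub>A\<^esub> c) = (?d \<oplus>\<^bsub>A\<^esub> b) \<oplus>\<^bsub>A\<^esub> c"
        using d bc KG_subset KI_subset by (intro A.a_assoc[symmetric]) auto
      moreover have "?d \<oplus>\<^bsub>A\<^esub> b \<in> carrier KG"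
        using False corner_cases add.hyps bc by (intro KG_closed) auto
      ultimately show ?thesis using eq bc by metis
    qed
  qed
  then obtain b c where bc: "b \<in> carrier KG" "c \<in> KI" "bas e \<otimes>\<^bsub>A\<^esub> a \<otimes>\<^bsub>A\<^esub> bas e = b \<oplus>\<^bsub>A\<^esub> c" by blast
  have "proj a = b"
  proof
    fix s
    show "proj a s = b s"
      using bc G_disjoint_I unfolding proj_def bc(3)
      by (auto simp: add_A G.A_coeff G.A_coeff_outside lin_combs_def)
  qed
  then show ?thesis using bc by metis
qed

lemma proj_e: "proj (bas e) = bas e"
  by (simp add: proj_KG bas_e_KG)

lemma proj_corner: "a \<in> carrier A \<Longrightarrow> proj (a \<otimes>\<^bsub>A\<^esub> bas e) = proj a" "a \<in> carrier A \<Longrightarrow> proj (bas e \<otimes>\<^bsub>A\<^esub> a) = proj a"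
  using A_mult_assoc[of "bas e" "bas e"]
  by (simp_all add: proj_def A_mult_assoc bas_e_idem cong: if_cong)

text \<open>Inserting \<open>e\<close> next to \<open>b\<close> turns \<open>a\<close> into
  \<open>e a e = proj a + c\<close> with \<open>c\<close> in \<open>KI\<close>, and the products of
  \<open>b\<close> with \<open>c\<close> are killed by \<open>proj\<close>. This linearity over
  \<open>KG\<close> later makes \<open>v\<close> times \<open>proj x\<close> a balanced expression
  for \<open>Ind\<close> and a \<open>KG\<close>-linear function of \<open>x\<close> for
  \<open>Coind\<close>.\<close>

lemma proj_mult_KG:
  assumes a: "a \<in> carrier A" and b: "b \<in> carrier KG"
  shows "proj (b \<otimes>\<^bsub>A\<^esub> a) = b \<otimes>\<^bsub>A\<^esub> proj a" "proj (a \<otimes>\<^bsub>A\<^esub> b) = proj a \<otimes>\<^bsub>A\<^esub> b"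
proof -
  note bA = KG_subset[OF b]
  obtain c where c: "c \<in> KI" "bas e \<otimes>\<^bsub>A\<^esub> a \<otimes>\<^bsub>A\<^esub> bas e = proj a \<oplus>\<^bsub>A\<^esub> c"
    using corner_decomp[OF a] by auto
  have pA: "proj a \<in> carrier A" using a KG_subset by auto
  have mG: "b \<otimes>\<^bsub>A\<^esub> proj a \<in> carrier KG" "proj a \<otimes>\<^bsub>A\<^esub> b \<in> carrier KG"
    using a b G.A_mult_closed KG_mult by (metis proj_closed)+
  have "proj (b \<otimes>\<^bsub>A\<^esub> a) = proj ((b \<otimes>\<^bsub>A\<^esub> bas e) \<otimes>\<^bsub>A\<^esub> a \<otimes>\<^bsub>A\<^esub> bas e)"
    using a bA by (simp add: proj_corner KG_e b)
  also have "\<dots> = proj (b \<otimes>\<^bsub>A\<^esub> (proj a \<oplus>\<^bsub>A\<^esub> c))"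
    using a bA by (simp add: A_mult_assoc c(2)[symmetric])
  also have "\<dots> = b \<otimes>\<^bsub>A\<^esub> proj a"
    using a bA pA c KI_subset mG by (simp add: A_r_distr proj_add proj_KI KI_ideal proj_KG)
  finally show "proj (b \<otimes>\<^bsub>A\<^esub> a) = b \<otimes>\<^bsub>A\<^esub> proj a" .
  have "proj (a \<otimes>\<^bsub>A\<^esub> b) = proj (bas e \<otimes>\<^bsub>A\<^esub> a \<otimes>\<^bsub>A\<^esub> (bas e \<otimes>\<^bsub>A\<^esub> b))"
    using a bA by (simp add: proj_corner KG_e b A_mult_assoc)
  also have "\<dots> = proj ((proj a \<oplus>\<^bsub>A\<^esub> c) \<otimes>\<^bsub>A\<^esub> b)"
    using a bA by (simp add: A_mult_assoc c(2)[symmetric])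
  also have "\<dots> = proj a \<otimes>\<^bsub>A\<^esub> b"
    using a bA pA c KI_subset mG by (simp add: A_l_distr proj_add proj_KI KI_ideal proj_KG)
  finally show "proj (a \<otimes>\<^bsub>A\<^esub> b) = proj a \<otimes>\<^bsub>A\<^esub> b" .
qed

end

section \<open>Right modules\<close>

text \<open>Operations on quotients are defined in the records as unions over all members of a
  coset. A homomorphism mapping \<open>H\<close> into \<open>H'\<close> sends all these members to
  one coset of \<open>H'\<close>, so the union collapses. This serves quotient modules, tensor
  products and \<open>KS/KI\<close> alike.\<close>

lemma UN_r_coset_hom:
  assumes "group G" "group G'" "subgroup H G" "subgroup H' G'" "f \<in> hom G G'" "f ` H \<subseteq> H'"
    and x: "x \<in> carrier G"
  shows "(\<Union>y\<in>H #>\<^bsub>G\<^esub> x. H' #>\<^bsub>G'\<^esub> f y) = H' #>\<^bsub>G'\<^esub> f x"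
proof -
  interpret G: group G by fact
  interpret G': group G' by fact
  interpret H: subgroup H G by fact
  interpret H': subgroup H' G' by fact
  have "H' #>\<^bsub>G'\<^esub> f y = H' #>\<^bsub>G'\<^esub> f x" if y: "y \<in> H #>\<^bsub>G\<^esub> x" for y
  proof -
    obtain h where h: "h \<in> H" "y = h \<otimes>\<^bsub>G\<^esub> x" using y by (auto simp: r_coset_def)
    have 1: "f h \<in> H'" "f h \<in> carrier G'" "f x \<in> carrier G'" "f y = f h \<otimes>\<^bsub>G'\<^esub> f x"
      using h assms by (auto simp: hom_def)
    then have "H' #>\<^bsub>G'\<^esub> f y = (H' #>\<^bsub>G'\<^esub> f h) #>\<^bsub>G'\<^esub> f x"
      by (simp add: G'.coset_mult_assoc H'.subset)
    also have "H' #>\<^bsub>G'\<^esub> f h = H'"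
      using G'.coset_join2[OF 1(2) assms(4) 1(1)] .
    finally show ?thesis .
  qed
  moreover have "x \<in> H #>\<^bsub>G\<^esub> x"
    using G.rcos_self[OF x assms(3)] .
  ultimately show ?thesis by blast
qed

section \<open>Homomorphisms, submodules and quotients\<close>

lemma rmodule_hom_carrier: "f \<in> rmodule_hom K A M N \<Longrightarrow> x \<in> carrier M \<Longrightarrow> f x \<in> carrier N"
  and rmodule_hom_add:
    "f \<in> rmodule_hom K A M N \<Longrightarrow> x \<in> carrier M \<Longrightarrow> y \<in> carrier M \<Longrightarrow> f (x \<oplus>\<^bsub>M\<^esub> y) = f x \<oplus>\<^bsub>N\<^esub> f y"
  and rmodule_hom_smult:
    "f \<in> rmodule_hom K A M N \<Longrightarrow> k \<in> carrier K \<Longrightarrow> x \<in> carrier M \<Longrightarrow> f (k \<odot>\<^bsub>M\<^esub> x) = k \<odot>\<^bsub>N\<^esub> f x"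
  and rmodule_hom_act:
    "f \<in> rmodule_hom K A M N \<Longrightarrow> x \<in> carrier M \<Longrightarrow> a \<in> carrier A \<Longrightarrow> f (x \<triangleleft>\<^bsub>M\<^esub> a) = f x \<triangleleft>\<^bsub>N\<^esub> a"
  by (auto simp: rmodule_hom_def)

lemma rmodule_homI:
  assumes "\<And>x. x \<in> carrier M \<Longrightarrow> f x \<in> carrier N"
    and "\<And>x y. x \<in> carrier M \<Longrightarrow> y \<in> carrier M \<Longrightarrow> f (x \<oplus>\<^bsub>M\<^esub> y) = f x \<oplus>\<^bsub>N\<^esub> f y"
    and "\<And>k x. k \<in> carrier K \<Longrightarrow> x \<in> carrier M \<Longrightarrow> f (k \<odot>\<^bsub>M\<^esub> x) = k \<odot>\<^bsub>N\<^esub> f x"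
    and "\<And>x a. x \<in> carrier M \<Longrightarrow> a \<in> carrier A \<Longrightarrow> f (x \<triangleleft>\<^bsub>M\<^esub> a) = f x \<triangleleft>\<^bsub>N\<^esub> a"
  shows "f \<in> rmodule_hom K A M N"
  using assms by (auto simp: rmodule_hom_def)

lemma rmodule_hom_comp:
  assumes f: "f \<in> rmodule_hom K A L M" and g: "g \<in> rmodule_hom K A M N"
  shows "(\<lambda>x. g (f x)) \<in> rmodule_hom K A L N"
  using assms by (auto simp: rmodule_hom_def Pi_iff)

lemma rmodule_iso_trans:
  assumes "rmodule_iso K A L M" "rmodule_iso K A M N"
  shows "rmodule_iso K A L N"
  using assms rmodule_hom_comp bij_betw_trans unfolding rmodule_iso_def comp_def by meson

text \<open>Negation is multiplication by the scalar \<open>-1\<close>, so closure under it follows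
  from closure under scalars.\<close>

lemma right_submoduleI:
  assumes "module K M" "N \<subseteq> carrier M" "\<zero>\<^bsub>M\<^esub> \<in> N"
    and "\<And>x y. x \<in> N \<Longrightarrow> y \<in> N \<Longrightarrow> x \<oplus>\<^bsub>M\<^esub> y \<in> N"
    and "\<And>k x. k \<in> carrier K \<Longrightarrow> x \<in> N \<Longrightarrow> k \<odot>\<^bsub>M\<^esub> x \<in> N"
    and "\<And>x a. x \<in> N \<Longrightarrow> a \<in> carrier A \<Longrightarrow> x \<triangleleft>\<^bsub>M\<^esub> a \<in> N"
  shows "right_submodule K A N M"
proof -
  interpret module K M by fact
  have "\<ominus>\<^bsub>M\<^esub> x \<in> N" if "x \<in> N" for x
  proof -
    have "\<ominus>\<^bsub>M\<^esub> x = (\<ominus>\<^bsub>K\<^esub> \<one>\<^bsub>K\<^esub>) \<odot>\<^bsub>M\<^esub> x"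
      using that assms(2) by (subst smult_l_minus) auto
    then show ?thesis using assms(5) that by simp
  qed
  then show ?thesis
    unfolding right_submodule_def using assms by (intro conjI submoduleI) auto
qed

lemma right_submoduleD:
  assumes "module K M" "right_submodule K A N M"
  shows "N \<subseteq> carrier M" "\<zero>\<^bsub>M\<^esub> \<in> N"
    "\<And>x y. x \<in> N \<Longrightarrow> y \<in> N \<Longrightarrow> x \<oplus>\<^bsub>M\<^esub> y \<in> N"
    "\<And>x. x \<in> N \<Longrightarrow> \<ominus>\<^bsub>M\<^esub> x \<in> N"
    "\<And>k x. k \<in> carrier K \<Longrightarrow> x \<in> N \<Longrightarrow> k \<odot>\<^bsub>M\<^esub> x \<in> N"
    "\<And>x a. x \<in> N \<Longrightarrow> a \<in> carrier A \<Longrightarrow> x \<triangleleft>\<^bsub>M\<^esub> a \<in> N"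
proof -
  interpret module K M by fact
  have N: "submodule N K M" using assms by (simp add: right_submodule_def)
  show "\<zero>\<^bsub>M\<^esub> \<in> N" using subgroup.one_closed[OF submodule.axioms(1)[OF N]] by simp
  show "N \<subseteq> carrier M" "\<And>x y. x \<in> N \<Longrightarrow> y \<in> N \<Longrightarrow> x \<oplus>\<^bsub>M\<^esub> y \<in> N" "\<And>x. x \<in> N \<Longrightarrow> \<ominus>\<^bsub>M\<^esub> x \<in> N"
    "\<And>k x. k \<in> carrier K \<Longrightarrow> x \<in> N \<Longrightarrow> k \<odot>\<^bsub>M\<^esub> x \<in> N"
    using submoduleE[OF N] by auto
  show "\<And>x a. x \<in> N \<Longrightarrow> a \<in> carrier A \<Longrightarrow> x \<triangleleft>\<^bsub>M\<^esub> a \<in> N"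
    using assms by (auto simp: right_submodule_def)
qed

lemmas right_moduleI = right_module.intro[OF _ right_module_axioms.intro]

text \<open>Every axiom can be pulled back along the surjection \<open>f\<close>. Nothing is
  presupposed of \<open>N\<close>, not even that it is a group, so that \<open>f\<close> respects
  zero is a premise. Quotients and transported copies get their module structure in this
  way.\<close>

lemma module_image:
  assumes "module K M"
    and im: "f ` carrier M = carrier N" and zero: "f \<zero>\<^bsub>M\<^esub> = \<zero>\<^bsub>N\<^esub>"
    and add: "\<And>x y. x \<in> carrier M \<Longrightarrow> y \<in> carrier M \<Longrightarrow> f (x \<oplus>\<^bsub>M\<^esub> y) = f x \<oplus>\<^bsub>N\<^esub> f y"
    and smult: "\<And>k x. k \<in> carrier K \<Longrightarrow> x \<in> carrier M \<Longrightarrow> f (k \<odot>\<^bsub>M\<^esub> x) = k \<odot>\<^bsub>N\<^esub> f x"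
  shows "module K N"
proof -
  interpret M: module K M by fact

  have pre: "\<exists>x'\<in>carrier M. x = f x'" if "x \<in> carrier N" for x
    using that im by blast
  have closed: "x \<in> carrier M \<Longrightarrow> f x \<in> carrier N" for x
    using im by blast
  have "abelian_group N"
  proof (rule abelian_groupI)
    fix x y z assume "x \<in> carrier N" "y \<in> carrier N" "z \<in> carrier N"
    then obtain x' y' z' where xyz: "x' \<in> carrier M" "y' \<in> carrier M" "z' \<in> carrier M"
      "x = f x'" "y = f y'" "z = f z'" using pre[of x] pre[of y] pre[of z] by auto
    show "x \<oplus>\<^bsub>N\<^esub> y \<oplus>\<^bsub>N\<^esub> z = x \<oplus>\<^bsub>N\<^esub> (y \<oplus>\<^bsub>N\<^esub> z)"
      using xyz by (simp add: M.a_assoc flip: add)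
    show "x \<oplus>\<^bsub>N\<^esub> y = y \<oplus>\<^bsub>N\<^esub> x" "x \<oplus>\<^bsub>N\<^esub> y \<in> carrier N"
      using xyz by (simp_all add: M.a_comm closed flip: add)
    show "\<zero>\<^bsub>N\<^esub> \<oplus>\<^bsub>N\<^esub> x = x" using xyz by (simp flip: add zero)
    show "\<exists>y\<in>carrier N. y \<oplus>\<^bsub>N\<^esub> x = \<zero>\<^bsub>N\<^esub>"
      using xyz by (intro bexI[of _ "f (\<ominus>\<^bsub>M\<^esub> x')"]) (auto simp: M.l_neg closed simp flip: add zero)
  next
    show "\<zero>\<^bsub>N\<^esub> \<in> carrier N" using closed[of "\<zero>\<^bsub>M\<^esub>"] zero by simp
  qed
  then show ?thesis
  proof (rule moduleI[OF M.R.cring_axioms])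
    fix k l x assume k: "k \<in> carrier K" and l: "l \<in> carrier K" and "x \<in> carrier N"
    then obtain x' where x: "x' \<in> carrier M" "x = f x'" using pre by blast
    show "k \<odot>\<^bsub>N\<^esub> x \<in> carrier N" using k x closed smult[of k x'] M.smult_closed by metis
    show "(k \<oplus>\<^bsub>K\<^esub> l) \<odot>\<^bsub>N\<^esub> x = k \<odot>\<^bsub>N\<^esub> x \<oplus>\<^bsub>N\<^esub> l \<odot>\<^bsub>N\<^esub> x"
      using k l x by (simp add: M.smult_l_distr flip: smult add)
    show "(k \<otimes>\<^bsub>K\<^esub> l) \<odot>\<^bsub>N\<^esub> x = k \<odot>\<^bsub>N\<^esub> (l \<odot>\<^bsub>N\<^esub> x)"
      using k l x by (simp add: M.smult_assoc1 flip: smult)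

    fix y assume "y \<in> carrier N"
    then obtain y' where y: "y' \<in> carrier M" "y = f y'" using pre by blast
    show "k \<odot>\<^bsub>N\<^esub> (x \<oplus>\<^bsub>N\<^esub> y) = k \<odot>\<^bsub>N\<^esub> x \<oplus>\<^bsub>N\<^esub> k \<odot>\<^bsub>N\<^esub> y"
      using k x y by (simp add: M.smult_r_distr flip: smult add)
  next
    fix x assume "x \<in> carrier N"
    then show "\<one>\<^bsub>K\<^esub> \<odot>\<^bsub>N\<^esub> x = x"
      using pre[of x] by (auto simp flip: smult)
  qed
qed

lemma (in semigroup_over_cring) right_module_image:
  assumes M: "right_module K A M" and f: "f \<in> rmodule_hom K A M N"
    and im: "f ` carrier M = carrier N" and zero: "f \<zero>\<^bsub>M\<^esub> = \<zero>\<^bsub>N\<^esub>"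
  shows "right_module K A N"
proof -
  interpret M: right_module K A M by fact
  note hom = rmodule_hom_add[OF f] rmodule_hom_smult[OF f] rmodule_hom_act[OF f]
  have pre: "\<exists>x'\<in>carrier M. x = f x'" if "x \<in> carrier N" for x
    using that im by blast
  show ?thesis
  proof (rule right_moduleI)
    show "module K N" by (rule module_image[OF M.module_axioms im zero]) (use hom in auto)
  next
    fix m a assume "m \<in> carrier N" and a: "a \<in> carrier A"
    then obtain m' where m: "m' \<in> carrier M" "m = f m'" using pre by blast
    show "m \<triangleleft>\<^bsub>N\<^esub> a \<in> carrier N"
      using m a M.act_closed im by (simp add: hom(3)[symmetric] flip: im)
    show "(k \<odot>\<^bsub>N\<^esub> m) \<triangleleft>\<^bsub>N\<^esub> a = k \<odot>\<^bsub>N\<^esub> (m \<triangleleft>\<^bsub>N\<^esub> a)"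
      "m \<triangleleft>\<^bsub>N\<^esub> (k \<odot>\<^bsub>A\<^esub> a) = k \<odot>\<^bsub>N\<^esub> (m \<triangleleft>\<^bsub>N\<^esub> a)" if "k \<in> carrier K" for k
      using m a that M.act_smult_left[of k m' a] M.act_smult_right[of k m' a]
        hom(2)[of k "m' \<triangleleft>\<^bsub>M\<^esub> a"] hom(2)[of k m'] hom(3)[of "k \<odot>\<^bsub>M\<^esub> m'" a] hom(3)[of m' a]
        hom(3)[of m' "k \<odot>\<^bsub>A\<^esub> a"] M.act_closed[of m' a]
      by simp_all
    show "m \<triangleleft>\<^bsub>N\<^esub> (a \<oplus>\<^bsub>A\<^esub> b) = (m \<triangleleft>\<^bsub>N\<^esub> a) \<oplus>\<^bsub>N\<^esub> (m \<triangleleft>\<^bsub>N\<^esub> b)"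
      "m \<triangleleft>\<^bsub>N\<^esub> (a \<otimes>\<^bsub>A\<^esub> b) = (m \<triangleleft>\<^bsub>N\<^esub> a) \<triangleleft>\<^bsub>N\<^esub> b" if b: "b \<in> carrier A" for b
      using m a b M.act_add_right[of m' a b] M.act_mult[of m' a b] M.act_closed[of m']
        hom(3)[of m' "a \<oplus>\<^bsub>A\<^esub> b"] hom(3)[of m' "a \<otimes>\<^bsub>A\<^esub> b"] hom(3)[of m' a] hom(3)[of m' b]
        hom(3)[of "m' \<triangleleft>\<^bsub>M\<^esub> a" b] hom(1)[of "m' \<triangleleft>\<^bsub>M\<^esub> a" "m' \<triangleleft>\<^bsub>M\<^esub> b"]
      by simp_all
    fix n assume "n \<in> carrier N"
    then obtain n' where n: "n' \<in> carrier M" "n = f n'" using pre by blast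
    show "(m \<oplus>\<^bsub>N\<^esub> n) \<triangleleft>\<^bsub>N\<^esub> a = (m \<triangleleft>\<^bsub>N\<^esub> a) \<oplus>\<^bsub>N\<^esub> (n \<triangleleft>\<^bsub>N\<^esub> a)"
      using m n a M.act_add_left[of m' n' a] M.act_closed[of _ a] hom(3)[of "m' \<oplus>\<^bsub>M\<^esub> n'" a]
        hom(3)[of m' a] hom(3)[of n' a] hom(1)[of m' n'] hom(1)[of "m' \<triangleleft>\<^bsub>M\<^esub> a" "n' \<triangleleft>\<^bsub>M\<^esub> a"]
      by simp
  qed
qed

context right_module
begin

lemma zero_act [simp]:
  assumes "a \<in> carrier A"
  shows "\<zero>\<^bsub>M\<^esub> \<triangleleft>\<^bsub>M\<^esub> a = \<zero>\<^bsub>M\<^esub>"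
  using act_smult_left[OF R.zero_closed M.zero_closed assms] act_closed[OF M.zero_closed assms] by simp

lemma minus_act:
  assumes "m \<in> carrier M" "a \<in> carrier A"
  shows "(\<ominus>\<^bsub>M\<^esub> m) \<triangleleft>\<^bsub>M\<^esub> a = \<ominus>\<^bsub>M\<^esub> (m \<triangleleft>\<^bsub>M\<^esub> a)"
  using assms act_add_left[of "\<ominus>\<^bsub>M\<^esub> m" m a]
  by (intro M.minus_equality[symmetric]) (auto simp: act_closed M.l_neg)

lemma hom_zero:
  assumes "module K N" "f \<in> rmodule_hom K A M N"
  shows "f \<zero>\<^bsub>M\<^esub> = \<zero>\<^bsub>N\<^esub>"
proof -
  interpret N: module K N by fact
  have "f \<zero>\<^bsub>M\<^esub> \<in> carrier N" using rmodule_hom_carrier[OF assms(2)] by simp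
  then show ?thesis
    using rmodule_hom_smult[OF assms(2) R.zero_closed M.zero_closed] by simp
qed

lemma hom_minus:
  assumes "module K N" "f \<in> rmodule_hom K A M N" "x \<in> carrier M"
  shows "f (\<ominus>\<^bsub>M\<^esub> x) = \<ominus>\<^bsub>N\<^esub> f x"
proof -
  interpret N: module K N by fact
  have "f x \<in> carrier N" "f (\<ominus>\<^bsub>M\<^esub> x) \<in> carrier N" using rmodule_hom_carrier[OF assms(2)] assms by auto
  then show ?thesis
    using rmodule_hom_add[OF assms(2), of "\<ominus>\<^bsub>M\<^esub> x" x] hom_zero[OF assms(1,2)] assms(3)
    by (intro N.minus_equality[symmetric]) (auto simp: M.l_neg)
qed

lemma hom_inj_onI:
  assumes "module K N" "f \<in> rmodule_hom K A M N"
    and "\<And>x. x \<in> carrier M \<Longrightarrow> f x = \<zero>\<^bsub>N\<^esub> \<Longrightarrow> x = \<zero>\<^bsub>M\<^esub>"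
  shows "inj_on f (carrier M)"
proof (rule inj_onI)
  fix x y assume xy: "x \<in> carrier M" "y \<in> carrier M" "f x = f y"
  interpret N: module K N by fact
  have "f y \<in> carrier N" using rmodule_hom_carrier[OF assms(2)] xy by simp
  then have "f (x \<oplus>\<^bsub>M\<^esub> \<ominus>\<^bsub>M\<^esub> y) = \<zero>\<^bsub>N\<^esub>"
    using xy rmodule_hom_add[OF assms(2)] hom_minus[OF assms(1,2)] by (simp add: N.r_neg)
  then have "x \<oplus>\<^bsub>M\<^esub> \<ominus>\<^bsub>M\<^esub> y = \<zero>\<^bsub>M\<^esub>" using assms(3) xy by simp
  then have "\<ominus>\<^bsub>M\<^esub> (\<ominus>\<^bsub>M\<^esub> y) = x" using xy by (intro M.minus_equality) auto
  then show "x = y" using xy by simp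
qed

lemma hom_inverse:
  assumes f: "f \<in> rmodule_hom K A M N" and bij: "bij_betw f (carrier M) (carrier N)"
  shows "inv_into (carrier M) f \<in> rmodule_hom K A N M"
proof -
  let ?g = "inv_into (carrier M) f"
  have im: "carrier N = f ` carrier M" using bij by (simp add: bij_betw_def)
  have inv: "?g (f x) = x" if "x \<in> carrier M" for x
    using bij that by (simp add: bij_betw_def)
  show ?thesis
    by (rule rmodule_homI)
      (auto simp: im inv act_closed
        simp flip: rmodule_hom_add[OF f] rmodule_hom_smult[OF f] rmodule_hom_act[OF f])
qed

lemma iso_sym: "rmodule_iso K A M N \<Longrightarrow> rmodule_iso K A N M"
  unfolding rmodule_iso_def using hom_inverse bij_betw_inv_into by blast

lemma iso_refl: "rmodule_iso K A M M"
  unfolding rmodule_iso_def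
  by (rule bexI[of _ "\<lambda>x. x"]) (auto intro!: rmodule_homI simp: bij_betw_def)

lemma right_submodule_preimage:
  assumes N: "module K N" and f: "f \<in> rmodule_hom K A M N" and N': "right_submodule K A N' N"
  shows "right_submodule K A {x \<in> carrier M. f x \<in> N'} M"
  by (rule right_submoduleI)
    (use right_submoduleD[OF N N'] module_axioms hom_zero[OF N f] in
      \<open>auto simp: act_closed rmodule_hom_add[OF f] rmodule_hom_smult[OF f] rmodule_hom_act[OF f]\<close>)

lemma restrict_submodule:
  assumes N: "right_submodule K A N M"
  shows "right_module K A (M\<lparr>carrier := N\<rparr>)"
proof -
  note D = right_submoduleD[OF module_axioms N]
  have N_carrier: "x \<in> N \<Longrightarrow> x \<in> carrier M" for x using D(1) by auto
  have "abelian_group (M\<lparr>carrier := N\<rparr>)"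
  proof (rule abelian_groupI)
    fix x assume "x \<in> carrier (M\<lparr>carrier := N\<rparr>)"
    then show "\<exists>y\<in>carrier (M\<lparr>carrier := N\<rparr>). y \<oplus>\<^bsub>M\<lparr>carrier := N\<rparr>\<^esub> x = \<zero>\<^bsub>M\<lparr>carrier := N\<rparr>\<^esub>"
      using D by (intro bexI[of _ "\<ominus>\<^bsub>M\<^esub> x"]) (auto simp: N_carrier M.l_neg)
  qed (use D in \<open>auto simp: N_carrier M.a_ac\<close>)
  then have "module K (M\<lparr>carrier := N\<rparr>)"
    by (intro moduleI)
      (use D R.cring_axioms in \<open>auto simp: N_carrier smult_l_distr smult_r_distr smult_assoc1\<close>)
  then show ?thesis
    by (rule right_moduleI)
      (use D in \<open>auto simp: N_carrier act_add_left act_add_right act_smult_left act_smult_right act_mult\<close>)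
qed

lemma right_submodule_of_restrict:
  assumes N: "right_submodule K A N M" and "N' \<subseteq> N"
  shows "right_submodule K A N' (M\<lparr>carrier := N\<rparr>) \<longleftrightarrow> right_submodule K A N' M"
proof -
  interpret N: right_module K A "M\<lparr>carrier := N\<rparr>" by (rule restrict_submodule[OF N])
  show ?thesis
  proof
    assume "right_submodule K A N' (M\<lparr>carrier := N\<rparr>)"
    note D' = right_submoduleD[OF N.module_axioms this]
    show "right_submodule K A N' M"
      by (rule right_submoduleI)
        (use D' module_axioms right_submoduleD(1)[OF module_axioms N] in auto)
  next
    assume "right_submodule K A N' M"
    note D' = right_submoduleD[OF module_axioms this]
    show "right_submodule K A N' (M\<lparr>carrier := N\<rparr>)"
      by (rule right_submoduleI)
        (use D' N.module_axioms assms(2) in auto)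
  qed
qed

text \<open>The coset map is treated as a homomorphism into a mere record; being onto, it then makes
  the quotient a module by \<open>right_module_image\<close>.\<close>

lemma quotient_rmodule_facts:
  assumes N: "right_submodule K A N M"
  defines "Q \<equiv> quotient_rmodule M N" and "q \<equiv> \<lambda>x. N +>\<^bsub>M\<^esub> x"
  shows quotient_map_hom: "q \<in> rmodule_hom K A M Q"
    and quotient_map_image: "q ` carrier M = carrier Q"
    and quotient_map_zero_iff: "x \<in> carrier M \<Longrightarrow> q x = \<zero>\<^bsub>Q\<^esub> \<longleftrightarrow> x \<in> N"
proof -
  note D = right_submoduleD[OF module_axioms N]
  have "submodule N K M" using N by (simp add: right_submodule_def)
  then have sub: "subgroup N (add_monoid M)" by (rule submodule.axioms(1))
  interpret abelian_subgroup N M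
    using sub M.abelian_group_axioms by (intro abelian_subgroupI3 additive_subgroup.intro)
  have grp: "group (add_monoid M)" by (rule M.a_group)
  \<comment> \<open>With \<open>f\<close> a scalar multiplication or the action of an algebra
    element, this evaluates the unions in the definition of the quotient at a
    representative.\<close>
  have UN: "(\<Union>y\<in>N +>\<^bsub>M\<^esub> x. N +>\<^bsub>M\<^esub> f y) = N +>\<^bsub>M\<^esub> f x"
    if "x \<in> carrier M" "\<And>x y. x \<in> carrier M \<Longrightarrow> y \<in> carrier M \<Longrightarrow> f (x \<oplus>\<^bsub>M\<^esub> y) = f x \<oplus>\<^bsub>M\<^esub> f y"
      "\<And>x. x \<in> carrier M \<Longrightarrow> f x \<in> carrier M" "f ` N \<subseteq> N" for f x
    unfolding a_r_coset_def
    by (rule UN_r_coset_hom[OF grp grp sub sub]) (use that in \<open>auto simp: hom_def\<close>)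
  show hom: "q \<in> rmodule_hom K A M Q"
  proof (rule rmodule_homI)
    fix x assume x: "x \<in> carrier M"
    show "q x \<in> carrier Q" using x a_rcosetsI[OF D(1)] by (simp add: q_def Q_def quotient_rmodule_def)
    show "q (x \<oplus>\<^bsub>M\<^esub> y) = q x \<oplus>\<^bsub>Q\<^esub> q y" if "y \<in> carrier M" for y
      using x that a_rcos_sum by (simp add: q_def Q_def quotient_rmodule_def)
    show "q (k \<odot>\<^bsub>M\<^esub> x) = k \<odot>\<^bsub>Q\<^esub> q x" if "k \<in> carrier K" for k
    proof -
      have "(\<Union>y\<in>N +>\<^bsub>M\<^esub> x. N +>\<^bsub>M\<^esub> (k \<odot>\<^bsub>M\<^esub> y)) = N +>\<^bsub>M\<^esub> (k \<odot>\<^bsub>M\<^esub> x)"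
        by (rule UN) (use x that D in \<open>auto simp: smult_r_distr\<close>)
      then show ?thesis by (simp add: q_def Q_def quotient_rmodule_def)
    qed
    show "q (x \<triangleleft>\<^bsub>M\<^esub> a) = q x \<triangleleft>\<^bsub>Q\<^esub> a" if "a \<in> carrier A" for a
    proof -
      have "(\<Union>y\<in>N +>\<^bsub>M\<^esub> x. N +>\<^bsub>M\<^esub> (y \<triangleleft>\<^bsub>M\<^esub> a)) = N +>\<^bsub>M\<^esub> (x \<triangleleft>\<^bsub>M\<^esub> a)"
        by (rule UN) (use x that D in \<open>auto simp: act_add_left act_closed\<close>)
      then show ?thesis by (simp add: q_def Q_def quotient_rmodule_def)
    qed
  qed
  show im: "q ` carrier M = carrier Q"
    by (auto simp: q_def Q_def quotient_rmodule_def A_RCOSETS_def RCOSETS_def a_r_coset_def)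
  have zero: "q x = \<zero>\<^bsub>Q\<^esub> \<longleftrightarrow> x \<in> N" if "x \<in> carrier M" for x
    using that a_rcos_const[of x] a_rcos_self[of x] by (auto simp: q_def Q_def quotient_rmodule_def)
  then show "x \<in> carrier M \<Longrightarrow> q x = \<zero>\<^bsub>Q\<^esub> \<longleftrightarrow> x \<in> N" .
qed

end

lemma (in semigroup_over_cring) quotient_right_module:
  assumes M: "right_module K A M" and N: "right_submodule K A N M"
  shows "right_module K A (quotient_rmodule M N)"
proof -
  interpret M: right_module K A M by fact
  show ?thesis
    by (rule right_module_image[OF M M.quotient_map_hom[OF N] M.quotient_map_image[OF N]])
      (use M.quotient_map_zero_iff[OF N] right_submoduleD(2)[OF M.module_axioms N] in auto)
qed

lemma simple_moduleD:
  assumes "simple_module K A M"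
  shows "right_module K A M" "\<exists>m\<in>carrier M. \<exists>a\<in>carrier A. m \<triangleleft>\<^bsub>M\<^esub> a \<noteq> \<zero>\<^bsub>M\<^esub>"
    "\<And>N. right_submodule K A N M \<Longrightarrow> N = {\<zero>\<^bsub>M\<^esub>} \<or> N = carrier M"
  using assms by (auto simp: simple_module_def)

lemma simple_module_iso:
  assumes M: "simple_module K A M" and N: "right_module K A N" and iso: "rmodule_iso K A M N"
  shows "simple_module K A N"
proof -
  interpret M: right_module K A M using M by (rule simple_moduleD)
  interpret N: right_module K A N by fact
  obtain f where f: "f \<in> rmodule_hom K A M N" and bij: "bij_betw f (carrier M) (carrier N)"
    using iso by (auto simp: rmodule_iso_def)
  note f0 = M.hom_zero[OF N.module_axioms f]
  obtain m a where ma: "m \<in> carrier M" "a \<in> carrier A" "m \<triangleleft>\<^bsub>M\<^esub> a \<noteq> \<zero>\<^bsub>M\<^esub>"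
    using simple_moduleD(2)[OF M] by blast
  have "f m \<triangleleft>\<^bsub>N\<^esub> a \<noteq> \<zero>\<^bsub>N\<^esub>"
    using ma bij f0 rmodule_hom_act[OF f ma(1,2)] M.act_closed[OF ma(1,2)]
    by (metis M.M.zero_closed bij_betw_def inj_onD)
  moreover have "N' = {\<zero>\<^bsub>N\<^esub>} \<or> N' = carrier N" if N': "right_submodule K A N' N" for N'
  proof -
    have "N' \<subseteq> f ` carrier M" using right_submoduleD(1)[OF N.module_axioms N'] bij by (simp add: bij_betw_def)
    then have "N' = f ` {x \<in> carrier M. f x \<in> N'}" by auto
    moreover have "{x \<in> carrier M. f x \<in> N'} = {\<zero>\<^bsub>M\<^esub>} \<or> {x \<in> carrier M. f x \<in> N'} = carrier M"
      using simple_moduleD(3)[OF M M.right_submodule_preimage[OF N.module_axioms f N']] .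
    ultimately show ?thesis using f0 bij by (auto simp: bij_betw_def)
  qed
  ultimately show ?thesis
    unfolding simple_module_def using N rmodule_hom_carrier[OF f] ma by blast
qed

context semigroup_over_cring
begin

lemma act_zero_right [simp]:
  assumes "right_module K A M" "m \<in> carrier M"
  shows "m \<triangleleft>\<^bsub>M\<^esub> \<zero>\<^bsub>A\<^esub> = \<zero>\<^bsub>M\<^esub>"
proof -
  interpret M: right_module K A M by fact
  show ?thesis
    using M.act_smult_right[OF K.zero_closed assms(2) A.M.zero_closed] M.act_closed[OF assms(2) A.M.zero_closed]
    by simp
qed

text \<open>Without a unit, \<open>m\<close> itself may fail to lie in \<open>m A\<close>. But the
  elements killed by all of \<open>A\<close> form a submodule \<open>?Z\<close>, which is proper
  because \<open>M A\<close> is not zero, hence trivial; so \<open>m A\<close> is a non-zero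
  submodule.\<close>

lemma simple_cyclic:
  assumes "simple_module K A M" and m: "m \<in> carrier M" "m \<noteq> \<zero>\<^bsub>M\<^esub>" and n: "n \<in> carrier M"
  shows "\<exists>a\<in>carrier A. n = m \<triangleleft>\<^bsub>M\<^esub> a"
proof -
  interpret M: right_module K A M using assms(1) by (rule simple_moduleD)
  let ?Z = "{x \<in> carrier M. \<forall>a\<in>carrier A. x \<triangleleft>\<^bsub>M\<^esub> a = \<zero>\<^bsub>M\<^esub>}"
  have "right_submodule K A ?Z M"
    by (rule right_submoduleI)
      (auto simp: M.module_axioms M.act_closed M.act_add_left M.act_smult_left simp flip: M.act_mult)
  moreover have "?Z \<noteq> carrier M" using simple_moduleD(2)[OF assms(1)] by auto
  ultimately have "m \<notin> ?Z" using simple_moduleD(3)[OF assms(1)] m by blast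
  then obtain a where a: "a \<in> carrier A" "m \<triangleleft>\<^bsub>M\<^esub> a \<noteq> \<zero>\<^bsub>M\<^esub>" using m by auto
  let ?mA = "{m \<triangleleft>\<^bsub>M\<^esub> a | a. a \<in> carrier A}"
  have "right_submodule K A ?mA M"
  proof (rule right_submoduleI)
    show "\<zero>\<^bsub>M\<^esub> \<in> ?mA" using act_zero_right[OF M.right_module_axioms m(1)] by (metis (mono_tags, lifting) A.M.zero_closed mem_Collect_eq)
    show "x \<oplus>\<^bsub>M\<^esub> y \<in> ?mA" if "x \<in> ?mA" "y \<in> ?mA" for x y
      using that m(1) M.act_add_right[symmetric] A.a_closed by auto
    show "k \<odot>\<^bsub>M\<^esub> x \<in> ?mA" if "k \<in> carrier K" "x \<in> ?mA" for k x
      using that m(1) M.act_smult_right[symmetric] A.smult_closed by auto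
    show "x \<triangleleft>\<^bsub>M\<^esub> a \<in> ?mA" if "x \<in> ?mA" "a \<in> carrier A" for x a
      using that m(1) M.act_mult[symmetric] A_mult_closed by auto
  qed (use m M.module_axioms M.act_closed in auto)
  moreover have "?mA \<noteq> {\<zero>\<^bsub>M\<^esub>}" using a by blast
  ultimately have "?mA = carrier M" using simple_moduleD(3)[OF assms(1)] by blast
  then show ?thesis using n by auto
qed

end

section \<open>Modules annihilated by the apex ideal\<close>

text \<open>Turns an equality of \<open>m a\<close> and \<open>m b\<close> into a statement on the
  annihilator of \<open>m\<close>, which is the form that \<open>corner_iso_annihilates\<close>
  provides.\<close>

lemma (in semigroup_over_cring) act_eq_iff:
  assumes M: "right_module K A M" and m: "m \<in> carrier M" and ab: "a \<in> carrier A" "b \<in> carrier A"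
  shows "m \<triangleleft>\<^bsub>M\<^esub> a = m \<triangleleft>\<^bsub>M\<^esub> b \<longleftrightarrow> m \<triangleleft>\<^bsub>M\<^esub> (a \<oplus>\<^bsub>A\<^esub> \<ominus>\<^bsub>A\<^esub> b) = \<zero>\<^bsub>M\<^esub>"
proof -
  interpret M: right_module K A M by fact
  have "m \<triangleleft>\<^bsub>M\<^esub> (\<ominus>\<^bsub>A\<^esub> b) \<oplus>\<^bsub>M\<^esub> m \<triangleleft>\<^bsub>M\<^esub> b = \<zero>\<^bsub>M\<^esub>"
    using M.act_add_right[of m "\<ominus>\<^bsub>A\<^esub> b" b] m ab M by (simp add: A.M.l_neg)
  then have "m \<triangleleft>\<^bsub>M\<^esub> (\<ominus>\<^bsub>A\<^esub> b) = \<ominus>\<^bsub>M\<^esub> (m \<triangleleft>\<^bsub>M\<^esub> b)"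
    using m ab by (intro M.M.minus_equality[symmetric]) (auto simp: M.act_closed)
  then show ?thesis
    using m ab M.M.minus_equality[of "m \<triangleleft>\<^bsub>M\<^esub> a" "\<ominus>\<^bsub>M\<^esub> (m \<triangleleft>\<^bsub>M\<^esub> b)"]
    by (auto simp: M.act_closed M.act_add_right M.M.r_neg)
qed

lemma (in semigroup_over_cring) annihilator_ideal:
  assumes M: "right_module K A M" and s: "s \<in> annihilator K S M" and t: "t \<in> pideal s"
  shows "t \<in> annihilator K S M"
proof -
  interpret M: right_module K A M by fact
  have sS: "s \<in> carrier S" and ann: "\<And>m. m \<in> carrier M \<Longrightarrow> m \<triangleleft>\<^bsub>M\<^esub> bas s = \<zero>\<^bsub>M\<^esub>"
    using s by (auto simp: annihilator_def)
  have tS: "t \<in> carrier S" using t pideal_subset[OF sS] by blast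
  have "m \<triangleleft>\<^bsub>M\<^esub> bas t = \<zero>\<^bsub>M\<^esub>" if m: "m \<in> carrier M" for m
  proof -
    from t show ?thesis
    proof (cases rule: pideal_cases)
      case self
      then show ?thesis using m ann by simp
    next
      case (left x)
      then have "m \<triangleleft>\<^bsub>M\<^esub> bas t = m \<triangleleft>\<^bsub>M\<^esub> bas x \<triangleleft>\<^bsub>M\<^esub> bas s"
        using m sS by (simp add: bas_mult flip: M.act_mult)
      then show ?thesis using ann[OF M.act_closed[OF m bas_closed]] left by simp
    next
      case (right y)
      then have "m \<triangleleft>\<^bsub>M\<^esub> bas t = m \<triangleleft>\<^bsub>M\<^esub> bas s \<triangleleft>\<^bsub>M\<^esub> bas y"
        using m sS by (simp add: bas_mult flip: M.act_mult)
      then show ?thesis using ann[OF m] right by simp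
    next
      case (both x y)
      then have "m \<triangleleft>\<^bsub>M\<^esub> bas t = m \<triangleleft>\<^bsub>M\<^esub> bas x \<triangleleft>\<^bsub>M\<^esub> bas s \<triangleleft>\<^bsub>M\<^esub> bas y"
        using m sS by (simp add: bas_mult mult_closed flip: M.act_mult)
      then show ?thesis using ann[OF M.act_closed[OF m bas_closed]] both by simp
    qed
  qed
  then show ?thesis using tS by (simp add: annihilator_def)
qed

context J_class
begin

text \<open>These are the modules over \<open>KS/KI\<close>. Only one half of having apex
  \<open>J\<close> is demanded, namely that \<open>I\<close> is killed; the other half, that nothing
  else is, follows in \<open>is_apexI\<close> once the corner is non-zero.\<close>

definition apex_module :: "('k, 's \<Rightarrow> 'k, 'm, 'z) rmodule_scheme \<Rightarrow> bool" where
  "apex_module M \<longleftrightarrow> right_module K A M \<and> (\<forall>m\<in>carrier M. \<forall>c\<in>KI. m \<triangleleft>\<^bsub>M\<^esub> c = \<zero>\<^bsub>M\<^esub>)"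

abbreviation corner :: "('k, 's \<Rightarrow> 'k, 'm, 'z) rmodule_scheme \<Rightarrow> ('k, 's \<Rightarrow> 'k, 'm, 'z) rmodule_scheme" where
  "corner M \<equiv> corner_module K M e"

lemma apex_moduleD:
  "apex_module M \<Longrightarrow> right_module K A M"
  "apex_module M \<Longrightarrow> m \<in> carrier M \<Longrightarrow> c \<in> KI \<Longrightarrow> m \<triangleleft>\<^bsub>M\<^esub> c = \<zero>\<^bsub>M\<^esub>"
  by (auto simp: apex_module_def)

lemma apex_moduleI:
  assumes M: "right_module K A M" and apex: "is_apex K S M J"
  shows "apex_module M"
  unfolding apex_module_def
proof (intro conjI ballI M)
  interpret M: right_module K A M by fact
  fix m c assume m: "m \<in> carrier M" and c: "c \<in> KI"
  have I: "m \<triangleleft>\<^bsub>M\<^esub> bas s = \<zero>\<^bsub>M\<^esub>" if "s \<in> I" for s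
    using that apex m by (auto simp: is_apex_def annihilator_def)
  show "m \<triangleleft>\<^bsub>M\<^esub> c = \<zero>\<^bsub>M\<^esub>"
    using I_subset c
  proof (induction rule: A_induct_on)
    case zero
    show ?case by (rule act_zero_right[OF M m])
  next
    case (add k s f)
    then have "bas s \<in> carrier A" "f \<in> carrier A" using I_subset KI_subset by auto
    then show ?case using add I m by (simp add: M.act_add_right M.act_smult_right)
  qed
qed

lemma corner_simps [simp]:
  "x \<oplus>\<^bsub>corner M\<^esub> y = x \<oplus>\<^bsub>M\<^esub> y" "\<zero>\<^bsub>corner M\<^esub> = \<zero>\<^bsub>M\<^esub>" "k \<odot>\<^bsub>corner M\<^esub> x = k \<odot>\<^bsub>M\<^esub> x"
  "x \<triangleleft>\<^bsub>corner M\<^esub> a = x \<triangleleft>\<^bsub>M\<^esub> a"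
  by (simp_all add: corner_module_def)

text \<open>As \<open>e\<close> is idempotent, its image on \<open>M\<close> is its set of fixed
  points.\<close>

lemma corner_carrier:
  assumes "right_module K A M"
  shows "carrier (corner M) = {x \<in> carrier M. x \<triangleleft>\<^bsub>M\<^esub> bas e = x}"
proof -
  interpret M: right_module K A M by fact
  show ?thesis
    by (auto simp: corner_module_def M.act_closed bas_e_idem simp flip: M.act_mult) metis
qed

lemma corner_unital:
  assumes "right_module K A M"
  shows "unital_right_module K KG (corner M)"
proof -
  interpret M: right_module K A M by fact
  note cc = corner_carrier[OF assms]
  have act: "x \<triangleleft>\<^bsub>M\<^esub> b \<triangleleft>\<^bsub>M\<^esub> bas e = x \<triangleleft>\<^bsub>M\<^esub> b" if "x \<in> carrier M" "b \<in> carrier KG" for x b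
    using that KG_subset by (simp add: KG_e flip: M.act_mult)
  have "abelian_group (corner M)"
  proof (rule abelian_groupI)
    fix x assume "x \<in> carrier (corner M)"
    then show "\<exists>y\<in>carrier (corner M). y \<oplus>\<^bsub>corner M\<^esub> x = \<zero>\<^bsub>corner M\<^esub>"
      by (intro bexI[of _ "\<ominus>\<^bsub>M\<^esub> x"]) (auto simp: cc M.M.l_neg M.minus_act)
  qed (auto simp: cc M.M.a_ac M.act_add_left)
  then have "module K (corner M)"
    by (intro moduleI)
      (auto simp: cc K.cring_axioms M.smult_l_distr M.smult_r_distr M.smult_assoc1 M.act_smult_left)
  then have "right_module K KG (corner M)"
    by (rule right_moduleI)
      (auto simp: cc M.act_closed KG_subset act M.act_add_left M.act_add_right M.act_smult_left
        M.act_smult_right M.act_mult KG_ops KG_mult)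
  then show ?thesis
    by (intro unital_right_module.intro unital_right_module_axioms.intro) (auto simp: cc KG_ops)
qed

text \<open>As \<open>x = x e\<close>, the element \<open>a\<close> may be replaced by
  \<open>e a e = proj a + c\<close> with \<open>c\<close> in \<open>KI\<close>, and \<open>c\<close>
  kills \<open>M\<close>.\<close>

lemma corner_act:
  assumes "apex_module M" "x \<in> carrier (corner M)" "a \<in> carrier A"
  shows "x \<triangleleft>\<^bsub>M\<^esub> a \<triangleleft>\<^bsub>M\<^esub> bas e = x \<triangleleft>\<^bsub>M\<^esub> proj a"
proof -
  interpret M: right_module K A M using assms(1) by (rule apex_moduleD)
  have x: "x \<in> carrier M" "x \<triangleleft>\<^bsub>M\<^esub> bas e = x"
    using assms(2) corner_carrier[OF M.right_module_axioms] by auto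
  obtain c where c: "c \<in> KI" "bas e \<otimes>\<^bsub>A\<^esub> a \<otimes>\<^bsub>A\<^esub> bas e = proj a \<oplus>\<^bsub>A\<^esub> c"
    using corner_decomp[OF assms(3)] by auto
  have "x \<triangleleft>\<^bsub>M\<^esub> a \<triangleleft>\<^bsub>M\<^esub> bas e = x \<triangleleft>\<^bsub>M\<^esub> bas e \<triangleleft>\<^bsub>M\<^esub> a \<triangleleft>\<^bsub>M\<^esub> bas e" using x by simp
  also have "\<dots> = x \<triangleleft>\<^bsub>M\<^esub> (proj a \<oplus>\<^bsub>A\<^esub> c)"
    using x(1) assms(3) by (simp flip: c(2) add: M.act_mult)
  also have "\<dots> = x \<triangleleft>\<^bsub>M\<^esub> proj a"
    using x assms c KG_subset[OF proj_closed] KI_subset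
    by (simp add: M.act_add_right apex_moduleD(2)[OF assms(1)] M.act_closed)
  finally show ?thesis .
qed

lemma corner_submodule:
  assumes "right_module K A M" "right_submodule K A N M"
  shows "right_submodule K KG (N \<inter> carrier (corner M)) (corner M)"
proof -
  interpret M: right_module K A M by fact
  interpret C: unital_right_module K KG "corner M" by (rule corner_unital[OF assms(1)])
  note D = right_submoduleD[OF M.module_axioms assms(2)]
  show ?thesis
  proof (rule right_submoduleI[OF C.module_axioms])
    show "x \<triangleleft>\<^bsub>corner M\<^esub> a \<in> N \<inter> carrier (corner M)"
      if "x \<in> N \<inter> carrier (corner M)" "a \<in> carrier KG" for x a
      using that D(6) C.act_closed[of x a] KG_subset by auto
  qed (use D C.M.zero_closed C.M.a_closed C.smult_closed in auto)
qed

text \<open>A non-zero \<open>w\<close> in a \<open>KG\<close>-submodule \<open>N\<close> of the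
  corner reaches every \<open>x\<close> of \<open>M e\<close> as \<open>w a\<close>, because
  \<open>M\<close> is simple. Cutting with \<open>e\<close> turns this into
  \<open>x = w (proj a)\<close>, which stays in \<open>N\<close>.\<close>

lemma simple_corner:
  assumes M: "simple_module K A M" and apex: "is_apex K S M J"
  shows "simple_unital_module K KG (corner M)"
proof -
  have rM: "right_module K A M" using M by (rule simple_moduleD)
  have aM: "apex_module M" using apex_moduleI[OF rM apex] .
  interpret M: right_module K A M by (rule rM)
  interpret C: unital_right_module K KG "corner M" by (rule corner_unital[OF rM])
  note cc = corner_carrier[OF rM]
  \<comment> \<open>The apex makes the corner non-zero: \<open>e\<close> is outside
    \<open>I\<close>, and \<open>I\<close> is the whole annihilator.\<close>
  have "e \<notin> annihilator K S M" using apex e_notin_I by (simp add: is_apex_def)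
  then obtain m where "m \<in> carrier M" "m \<triangleleft>\<^bsub>M\<^esub> bas e \<noteq> \<zero>\<^bsub>M\<^esub>"
    by (auto simp: annihilator_def)
  then have m: "m \<triangleleft>\<^bsub>M\<^esub> bas e \<in> carrier (corner M)" "m \<triangleleft>\<^bsub>M\<^esub> bas e \<triangleleft>\<^bsub>M\<^esub> bas e \<noteq> \<zero>\<^bsub>M\<^esub>"
    by (auto simp: cc M.act_closed bas_e_idem simp flip: M.act_mult)
  have "N = {\<zero>\<^bsub>M\<^esub>} \<or> N = carrier (corner M)" if N: "right_submodule K KG N (corner M)" for N
  proof (rule disjCI)
    note D = right_submoduleD[OF C.module_axioms N]
    assume "N \<noteq> carrier (corner M)"
    have "carrier (corner M) \<subseteq> N" if w: "w \<in> N" "w \<noteq> \<zero>\<^bsub>M\<^esub>" for w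
    proof
      fix x assume x: "x \<in> carrier (corner M)"
      have wM: "w \<in> carrier (corner M)" using D(1) w by auto
      obtain a where a: "a \<in> carrier A" "x = w \<triangleleft>\<^bsub>M\<^esub> a"
        using simple_cyclic[OF M, of w x] w wM x cc by auto
      have "x = x \<triangleleft>\<^bsub>M\<^esub> bas e" using x cc by auto
      also have "\<dots> = w \<triangleleft>\<^bsub>M\<^esub> proj a" using corner_act[OF aM wM a(1)] a by simp
      also have "\<dots> \<in> N" using D(6)[OF w(1) proj_closed[OF a(1)]] by simp
      finally show "x \<in> N" .
    qed
    then show "N = {\<zero>\<^bsub>M\<^esub>}" using D(1,2) \<open>N \<noteq> carrier (corner M)\<close> by auto
  qed
  then have "simple_module K KG (corner M)"
    unfolding simple_module_def using C.right_module_axioms m bas_e_KG by auto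
  then show ?thesis
    using C.unital_right_module_axioms by (simp add: simple_unital_module_def)
qed

text \<open>If some \<open>s\<close> outside \<open>I\<close> killed \<open>M\<close>, then so would
  \<open>e\<close>, which lies in the ideal generated by \<open>s\<close>.\<close>

lemma is_apexI:
  assumes M: "apex_module M" and m: "m \<in> carrier M" "m \<triangleleft>\<^bsub>M\<^esub> bas e \<noteq> \<zero>\<^bsub>M\<^esub>"
  shows "is_apex K S M J"
proof -
  interpret M: right_module K A M using M by (rule apex_moduleD)
  have "s \<in> I" if s: "s \<in> annihilator K S M" for s
  proof (rule ccontr)
    assume "s \<notin> I"
    then have "e \<in> pideal s" using s by (simp add: I_iff annihilator_def)
    then have "e \<in> annihilator K S M" by (rule annihilator_ideal[OF M.right_module_axioms s])
    then show False using m by (simp add: annihilator_def)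
  qed
  moreover have "s \<in> annihilator K S M" if "s \<in> I" for s
    using that apex_moduleD(2)[OF M] KI_closed(4) I_subset by (auto simp: annihilator_def)
  ultimately have "annihilator K S M = I" by blast
  then show ?thesis using J by (simp add: is_apex_def)
qed

text \<open>\<open>w a e\<close> is a non-zero element of the intersection of \<open>N\<close> with
  \<open>M e\<close>, which is a \<open>KG\<close>-submodule of the simple corner.\<close>

lemma submodule_contains_corner:
  assumes M: "right_module K A M" and simple: "simple_unital_module K KG (corner M)"
    and N: "right_submodule K A N M" and w: "w \<in> N" "a \<in> carrier A" "w \<triangleleft>\<^bsub>M\<^esub> (a \<otimes>\<^bsub>A\<^esub> bas e) \<noteq> \<zero>\<^bsub>M\<^esub>"
  shows "carrier (corner M) \<subseteq> N"
proof -
  interpret M: right_module K A M by fact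
  note D = right_submoduleD[OF M.module_axioms N]
  have wM: "w \<in> carrier M" using D(1) w by auto
  have "w \<triangleleft>\<^bsub>M\<^esub> (a \<otimes>\<^bsub>A\<^esub> bas e) \<in> N \<inter> carrier (corner M)"
    using D(6) w wM by (auto simp: corner_carrier[OF M] M.act_closed A_mult_assoc bas_e_idem simp flip: M.act_mult)
  then have "N \<inter> carrier (corner M) \<noteq> {\<zero>\<^bsub>corner M\<^esub>}" using w by auto
  moreover have "simple_module K KG (corner M)" using simple by (simp add: simple_unital_module_def)
  ultimately have "N \<inter> carrier (corner M) = carrier (corner M)"
    using simple_moduleD(3)[OF _ corner_submodule[OF M N]] by blast
  then show ?thesis by blast
qed

lemma simple_corner_nonzero:
  assumes M: "right_module K A M" and simple: "simple_unital_module K KG (corner M)"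
  shows "\<exists>w\<in>carrier (corner M). w \<in> carrier M \<and> w \<triangleleft>\<^bsub>M\<^esub> bas e = w \<and> w \<noteq> \<zero>\<^bsub>M\<^esub>"
proof -
  have sm: "simple_module K KG (corner M)" using simple by (simp add: simple_unital_module_def)
  interpret C: right_module K KG "corner M" using sm by (rule simple_moduleD)
  obtain m a where ma: "m \<in> carrier (corner M)" "a \<in> carrier KG" "m \<triangleleft>\<^bsub>M\<^esub> a \<noteq> \<zero>\<^bsub>M\<^esub>"
    using simple_moduleD(2)[OF sm] by auto
  then have "m \<noteq> \<zero>\<^bsub>M\<^esub>" using C.zero_act[OF ma(2)] by auto
  then show ?thesis using ma corner_carrier[OF M] by auto
qed

text \<open>Stated for any module generated by its corner in the sense of \<open>gen\<close>;
  \<open>Ind\<close> is the intended case. A submodule not contained in \<open>R\<close> contains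
  \<open>M e\<close>, hence is all of \<open>M\<close>. So \<open>R\<close> contains every proper
  submodule, and it is proper itself because it meets \<open>M e\<close> only in zero.\<close>

lemma radical:
  assumes M: "apex_module M" and simple: "simple_unital_module K KG (corner M)"
    and gen: "\<And>N. right_submodule K A N M \<Longrightarrow> carrier (corner M) \<subseteq> N \<Longrightarrow> N = carrier M"
  defines "R \<equiv> Ind_radical K S e M"
  shows radical_maximal: "maximal_submodule K A R M"
    and radical_unique: "maximal_submodule K A N M \<Longrightarrow> N = R"
    and radical_quotient: "simple_over K S J e (corner M) (quotient_rmodule M R)"
proof -
  have rM: "right_module K A M" using M by (rule apex_moduleD)
  interpret M: right_module K A M by (rule rM)
  have R: "right_submodule K A R M"
    unfolding R_def Ind_radical_def
    by (rule right_submoduleI)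
      (auto simp: M.module_axioms M.act_closed M.act_add_left M.act_smult_left simp flip: M.act_mult A_mult_assoc)
  obtain w where w: "w \<in> carrier (corner M)" "w \<in> carrier M" "w \<triangleleft>\<^bsub>M\<^esub> bas e = w" "w \<noteq> \<zero>\<^bsub>M\<^esub>"
    using simple_corner_nonzero[OF rM simple] by auto
  \<comment> \<open>Take \<open>a = e\<close> in the definition of the radical:
    \<open>x = x (e e) = 0\<close>.\<close>
  have corner_R: "x = \<zero>\<^bsub>M\<^esub>" if "x \<in> carrier (corner M)" "x \<in> R" for x
    using that bas_e_idem unfolding R_def Ind_radical_def corner_carrier[OF rM]
    by (metis (mono_tags, lifting) bas_closed e_closed mem_Collect_eq)
  have wR: "w \<notin> R" using corner_R w by auto
  have proper: "N \<subseteq> R" if N: "right_submodule K A N M" "N \<noteq> carrier M" for N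
  proof (rule ccontr)
    assume "\<not> N \<subseteq> R"
    then obtain x a where "x \<in> N" "a \<in> carrier A" "x \<triangleleft>\<^bsub>M\<^esub> (a \<otimes>\<^bsub>A\<^esub> bas e) \<noteq> \<zero>\<^bsub>M\<^esub>"
      using right_submoduleD(1)[OF M.module_axioms N(1)] unfolding R_def Ind_radical_def by blast
    then have "carrier (corner M) \<subseteq> N" by (rule submodule_contains_corner[OF rM simple N(1)])
    then show False using gen N by auto
  qed
  show max: "maximal_submodule K A R M"
    unfolding maximal_submodule_def using R wR w proper by blast
  show "N = R" if "maximal_submodule K A N M"
    using that R wR w proper unfolding maximal_submodule_def by blast
  let ?Q = "quotient_rmodule M R" and ?q = "\<lambda>x. R +>\<^bsub>M\<^esub> x"
  have rQ: "right_module K A ?Q" by (rule quotient_right_module[OF rM R])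
  interpret Q: right_module K A ?Q by (rule rQ)
  note q = M.quotient_map_hom[OF R] and im = M.quotient_map_image[OF R] and zero = M.quotient_map_zero_iff[OF R]
  have apexQ: "apex_module ?Q"
    unfolding apex_module_def
  proof (intro conjI ballI rQ)
    fix m c assume "m \<in> carrier ?Q" and c: "c \<in> KI"
    then obtain m' where m': "m' \<in> carrier M" "m = ?q m'" using im by blast
    then have "m \<triangleleft>\<^bsub>?Q\<^esub> c = ?q \<zero>\<^bsub>M\<^esub>"
      using rmodule_hom_act[OF q m'(1) KI_subset[OF c]] apex_moduleD(2)[OF M m'(1) c] by simp
    then show "m \<triangleleft>\<^bsub>?Q\<^esub> c = \<zero>\<^bsub>?Q\<^esub>"
      using M.hom_zero[OF Q.module_axioms q] by simp
  qed
  have qw: "?q w \<in> carrier ?Q" "?q w \<triangleleft>\<^bsub>?Q\<^esub> bas e \<noteq> \<zero>\<^bsub>?Q\<^esub>"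
    using rmodule_hom_carrier[OF q w(2)] rmodule_hom_act[OF q w(2), of "bas e"] w zero[OF w(2)] wR by auto
  have simpleQ: "simple_module K A ?Q"
    unfolding simple_module_def
  proof (intro conjI allI impI rQ)
    show "\<exists>m\<in>carrier ?Q. \<exists>a\<in>carrier A. m \<triangleleft>\<^bsub>?Q\<^esub> a \<noteq> \<zero>\<^bsub>?Q\<^esub>" using qw by blast
    fix N assume N: "right_submodule K A N ?Q"
    let ?N = "{x \<in> carrier M. ?q x \<in> N}"
    have "N \<subseteq> ?q ` carrier M" using right_submoduleD(1)[OF Q.module_axioms N] by (simp only: im)
    then have N_eq: "N = ?q ` ?N" by auto
    have "right_submodule K A ?N M" by (rule M.right_submodule_preimage[OF Q.module_axioms q N])
    then consider "?N = carrier M" | "?N \<subseteq> R" using proper by blast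
    then show "N = {\<zero>\<^bsub>?Q\<^esub>} \<or> N = carrier ?Q"
    proof cases
      case 1
      then show ?thesis using N_eq im by simp
    next
      case 2
      have "x = \<zero>\<^bsub>?Q\<^esub>" if x: "x \<in> N" for x
      proof -
        obtain y where "y \<in> ?N" "x = ?q y" using x N_eq by blast
        then show ?thesis using 2 zero[of y] by auto
      qed
      then show ?thesis using right_submoduleD(2)[OF Q.module_axioms N] by blast
    qed
  qed
  interpret C: unital_right_module K KG "corner M" by (rule corner_unital[OF rM])
  interpret CQ: unital_right_module K KG "corner ?Q" by (rule corner_unital[OF rQ])
  \<comment> \<open>The coset map restricts to an isomorphism of corners: its kernel
    \<open>R\<close> meets \<open>M e\<close> trivially, and a preimage of a corner element can be
    multiplied by \<open>e\<close>.\<close>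
  have q': "?q \<in> rmodule_hom K KG (corner M) (corner ?Q)"
  proof (rule rmodule_homI)
    fix x assume x: "x \<in> carrier (corner M)"
    then have xM: "x \<in> carrier M" "x \<triangleleft>\<^bsub>M\<^esub> bas e = x" by (auto simp: corner_carrier[OF rM])
    show "?q x \<in> carrier (corner ?Q)"
      using rmodule_hom_carrier[OF q xM(1)] rmodule_hom_act[OF q xM(1), of "bas e"] xM
      by (auto simp: corner_carrier[OF rQ])
    show "?q (k \<odot>\<^bsub>corner M\<^esub> x) = k \<odot>\<^bsub>corner ?Q\<^esub> ?q x" if "k \<in> carrier K" for k
      using rmodule_hom_smult[OF q that xM(1)] by simp
    show "?q (x \<triangleleft>\<^bsub>corner M\<^esub> a) = ?q x \<triangleleft>\<^bsub>corner ?Q\<^esub> a" if "a \<in> carrier KG" for a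
      using rmodule_hom_act[OF q xM(1) KG_subset[OF that]] by simp
    show "?q (x \<oplus>\<^bsub>corner M\<^esub> y) = ?q x \<oplus>\<^bsub>corner ?Q\<^esub> ?q y" if "y \<in> carrier (corner M)" for y
      using rmodule_hom_add[OF q xM(1)] that by (simp add: corner_carrier[OF rM])
  qed
  have "bij_betw ?q (carrier (corner M)) (carrier (corner ?Q))"
    unfolding bij_betw_def
  proof
    show "inj_on ?q (carrier (corner M))"
      by (rule C.hom_inj_onI[OF CQ.module_axioms q'])
        (use zero corner_R in \<open>auto simp: corner_carrier[OF rM]\<close>)
    show "?q ` carrier (corner M) = carrier (corner ?Q)"
    proof
      show "?q ` carrier (corner M) \<subseteq> carrier (corner ?Q)" using rmodule_hom_carrier[OF q'] by auto
      show "carrier (corner ?Q) \<subseteq> ?q ` carrier (corner M)"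
      proof
        fix x assume x: "x \<in> carrier (corner ?Q)"
        then have "x \<in> ?q ` carrier M" by (simp only: im corner_carrier[OF rQ] mem_Collect_eq)
        then obtain y where y: "y \<in> carrier M" "x = ?q y" by auto
        have "x = ?q (y \<triangleleft>\<^bsub>M\<^esub> bas e)"
          using rmodule_hom_act[OF q y(1), of "bas e"] x y by (auto simp: corner_carrier[OF rQ])
        moreover have "y \<triangleleft>\<^bsub>M\<^esub> bas e \<in> carrier (corner M)" using y by (auto simp: corner_module_def)
        ultimately show "x \<in> ?q ` carrier (corner M)" by blast
      qed
    qed
  qed
  then have "rmodule_iso K KG (corner M) (corner ?Q)" using q' by (auto simp: rmodule_iso_def)
  then have "rmodule_iso K KG (corner ?Q) (corner M)" by (rule C.iso_sym)
  then show "simple_over K S J e (corner M) ?Q"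
    using simpleQ is_apexI[OF apexQ qw] by (simp add: simple_over_def)
qed

text \<open>The generating set is stable under scalars and under right multiplication. Both
  operations are additive, so they also preserve the group generated by it.\<close>

lemma socle_submodule:
  assumes rM: "right_module K A M"
  shows "right_submodule K A (Coind_socle K S e M) M"
proof -
  interpret M: right_module K A M by (rule rM)
  let ?X = "{(m \<triangleleft>\<^bsub>M\<^esub> bas e) \<triangleleft>\<^bsub>M\<^esub> a | m a. m \<in> carrier M \<and> a \<in> carrier A}"
  let ?Z = "Coind_socle K S e M"
  have X: "?X \<subseteq> carrier M" by (auto simp: M.act_closed)
  have Z: "?Z = generate (add_monoid M) ?X" by (simp add: Coind_socle_def)
  have ZM: "x \<in> ?Z \<Longrightarrow> x \<in> carrier M" for x
    using group.generate_incl[OF M.M.a_group, of ?X] X by (auto simp: Z)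
  have add: "x \<in> ?Z \<Longrightarrow> y \<in> ?Z \<Longrightarrow> x \<oplus>\<^bsub>M\<^esub> y \<in> ?Z" for x y
    unfolding Z using generate.eng[of x "add_monoid M"] by simp
  have zero: "\<zero>\<^bsub>M\<^esub> \<in> ?Z" unfolding Z using generate.one[of "add_monoid M"] by simp
  have neg: "x \<in> ?X \<Longrightarrow> \<ominus>\<^bsub>M\<^esub> x \<in> ?Z" for x
    unfolding Z a_inv_def by (rule generate.inv)
  have closed: "h x \<in> ?Z"
    if x: "x \<in> ?Z" and h: "\<And>x. x \<in> ?X \<Longrightarrow> h x \<in> ?X" "h \<zero>\<^bsub>M\<^esub> = \<zero>\<^bsub>M\<^esub>"
      "\<And>x. x \<in> carrier M \<Longrightarrow> h (\<ominus>\<^bsub>M\<^esub> x) = \<ominus>\<^bsub>M\<^esub> h x"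
      "\<And>x y. x \<in> carrier M \<Longrightarrow> y \<in> carrier M \<Longrightarrow> h (x \<oplus>\<^bsub>M\<^esub> y) = h x \<oplus>\<^bsub>M\<^esub> h y" for h x
    using x unfolding Z
  proof (induction rule: generate.induct)
    case one
    then show ?case using h zero by (simp add: Z)
  next
    case (incl x)
    then show ?case using h(1) generate.incl[of "h x" ?X] by blast
  next
    case (inv x)
    then have "h (\<ominus>\<^bsub>M\<^esub> x) = \<ominus>\<^bsub>M\<^esub> h x" using X h(3) by blast
    moreover have "\<ominus>\<^bsub>M\<^esub> h x \<in> ?Z" using neg h(1) inv by blast
    ultimately show ?case by (simp add: Z a_inv_def)
  next
    case (eng x y)
    then have "x \<in> carrier M" "y \<in> carrier M" using ZM by (auto simp: Z)
    then show ?case using add eng h(4) by (simp add: Z)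
  qed
  show ?thesis
  proof (rule right_submoduleI[OF M.module_axioms _ zero add])
    show "?Z \<subseteq> carrier M" using ZM by auto
    fix x assume x: "x \<in> ?Z"
    show "k \<odot>\<^bsub>M\<^esub> x \<in> ?Z" if k: "k \<in> carrier K" for k
    proof (rule closed[OF x])
      show "k \<odot>\<^bsub>M\<^esub> x \<in> ?X" if "x \<in> ?X" for x
      proof -
        obtain m a where ma: "m \<in> carrier M" "a \<in> carrier A" "x = (m \<triangleleft>\<^bsub>M\<^esub> bas e) \<triangleleft>\<^bsub>M\<^esub> a"
          using \<open>x \<in> ?X\<close> by blast
        then have "k \<odot>\<^bsub>M\<^esub> x = (m \<triangleleft>\<^bsub>M\<^esub> bas e) \<triangleleft>\<^bsub>M\<^esub> (k \<odot>\<^bsub>A\<^esub> a)"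
          using k by (simp add: M.act_smult_right M.act_closed)
        then show ?thesis using ma k A.smult_closed by blast
      qed
    qed (use k in \<open>simp_all add: M.smult_r_distr M.smult_r_minus\<close>)
    show "x \<triangleleft>\<^bsub>M\<^esub> b \<in> ?Z" if b: "b \<in> carrier A" for b
    proof (rule closed[OF x, of "\<lambda>x. x \<triangleleft>\<^bsub>M\<^esub> b"])
      show "x \<triangleleft>\<^bsub>M\<^esub> b \<in> ?X" if "x \<in> ?X" for x
      proof -
        obtain m a where ma: "m \<in> carrier M" "a \<in> carrier A" "x = (m \<triangleleft>\<^bsub>M\<^esub> bas e) \<triangleleft>\<^bsub>M\<^esub> a"
          using \<open>x \<in> ?X\<close> by blast
        then have "x \<triangleleft>\<^bsub>M\<^esub> b = (m \<triangleleft>\<^bsub>M\<^esub> bas e) \<triangleleft>\<^bsub>M\<^esub> (a \<otimes>\<^bsub>A\<^esub> b)"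
          using b by (simp add: M.act_mult M.act_closed)
        then show ?thesis using ma b A_mult_closed by blast
      qed
    qed (use b in \<open>simp_all add: M.act_add_left M.minus_act\<close>)
  qed
qed

lemma corner_subset_socle:
  assumes "right_module K A M"
  shows "carrier (corner M) \<subseteq> Coind_socle K S e M"
proof
  interpret M: right_module K A M by fact
  fix x assume "x \<in> carrier (corner M)"
  then have "x \<in> carrier M" "x = x \<triangleleft>\<^bsub>M\<^esub> bas e \<triangleleft>\<^bsub>M\<^esub> bas e" by (auto simp: corner_carrier[OF assms])
  then show "x \<in> Coind_socle K S e M"
    unfolding Coind_socle_def by (intro generate.incl) (use bas_closed e_closed in blast)
qed

lemma socle_least:
  assumes rM: "right_module K A M" and N: "right_submodule K A N M" and sub: "carrier (corner M) \<subseteq> N"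
  shows "Coind_socle K S e M \<subseteq> N"
proof -
  interpret M: right_module K A M by (rule rM)
  have "submodule N K M" using N by (simp add: right_submodule_def)
  then have "subgroup N (add_monoid M)" by (rule submodule.axioms(1))
  moreover have "m \<triangleleft>\<^bsub>M\<^esub> bas e \<triangleleft>\<^bsub>M\<^esub> a \<in> N" if "m \<in> carrier M" "a \<in> carrier A" for m a
  proof -
    have "m \<triangleleft>\<^bsub>M\<^esub> bas e \<in> carrier (corner M)" using that by (auto simp: corner_module_def)
    then show ?thesis using sub right_submoduleD(6)[OF M.module_axioms N] that by blast
  qed
  ultimately show ?thesis
    unfolding Coind_socle_def by (intro group.generate_subgroup_incl[OF M.M.a_group]) auto
qed

text \<open>Dual to \<open>radical\<close>, with \<open>Coind\<close> as the intended case: by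
  \<open>cogen\<close>, a non-zero submodule has an element \<open>w\<close> with some
  \<open>w a e\<close> non-zero, so it contains \<open>M e\<close> and with it the submodule
  \<open>Z\<close> generated by \<open>M e\<close>.\<close>

lemma socle:
  assumes M: "apex_module M" and simple: "simple_unital_module K KG (corner M)"
    and cogen: "\<And>w. w \<in> carrier M \<Longrightarrow> (\<And>a. a \<in> carrier A \<Longrightarrow> w \<triangleleft>\<^bsub>M\<^esub> (a \<otimes>\<^bsub>A\<^esub> bas e) = \<zero>\<^bsub>M\<^esub>) \<Longrightarrow> w = \<zero>\<^bsub>M\<^esub>"
  defines "Z \<equiv> Coind_socle K S e M"
  shows socle_minimal: "minimal_submodule K A Z M"
    and socle_unique: "minimal_submodule K A N M \<Longrightarrow> N = Z"
    and socle_simple: "simple_over K S J e (corner M) (M\<lparr>carrier := Z\<rparr>)"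
proof -
  have rM: "right_module K A M" using M by (rule apex_moduleD)
  interpret M: right_module K A M by (rule rM)
  have Z: "right_submodule K A Z M" unfolding Z_def by (rule socle_submodule[OF rM])
  obtain w where w: "w \<in> carrier (corner M)" "w \<in> carrier M" "w \<triangleleft>\<^bsub>M\<^esub> bas e = w" "w \<noteq> \<zero>\<^bsub>M\<^esub>"
    using simple_corner_nonzero[OF rM simple] by auto
  have wZ: "w \<in> Z" using w corner_subset_socle[OF rM] by (auto simp: Z_def)
  have nonzero: "Z \<subseteq> N" if N: "right_submodule K A N M" "N \<noteq> {\<zero>\<^bsub>M\<^esub>}" for N
  proof -
    note D = right_submoduleD[OF M.module_axioms N(1)]
    obtain x where x: "x \<in> N" "x \<noteq> \<zero>\<^bsub>M\<^esub>" using N D(2) by blast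
    then obtain a where "a \<in> carrier A" "x \<triangleleft>\<^bsub>M\<^esub> (a \<otimes>\<^bsub>A\<^esub> bas e) \<noteq> \<zero>\<^bsub>M\<^esub>" using cogen D(1) by blast
    then have "carrier (corner M) \<subseteq> N" by (rule submodule_contains_corner[OF rM simple N(1) x(1)])
    then show ?thesis unfolding Z_def by (rule socle_least[OF rM N(1)])
  qed
  have Z0: "Z \<noteq> {\<zero>\<^bsub>M\<^esub>}" using wZ w by auto
  show "minimal_submodule K A Z M"
    unfolding minimal_submodule_def using Z Z0 nonzero by blast
  show "N = Z" if "minimal_submodule K A N M"
    using that Z Z0 nonzero unfolding minimal_submodule_def by blast
  let ?Z = "M\<lparr>carrier := Z\<rparr>"
  have rZ: "right_module K A ?Z" by (rule M.restrict_submodule[OF Z])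
  interpret Z: right_module K A ?Z by (rule rZ)
  have ZM: "Z \<subseteq> carrier M" using right_submoduleD(1)[OF M.module_axioms Z] .
  have "apex_module ?Z"
    unfolding apex_module_def using rZ apex_moduleD(2)[OF M] ZM by auto
  then have "is_apex K S ?Z J" using wZ w by (intro is_apexI[of _ w]) auto
  moreover have "simple_module K A ?Z"
    unfolding simple_module_def
  proof (intro conjI allI impI rZ)
    show "\<exists>m\<in>carrier ?Z. \<exists>a\<in>carrier A. m \<triangleleft>\<^bsub>?Z\<^esub> a \<noteq> \<zero>\<^bsub>?Z\<^esub>"
    proof -
      have "w \<in> carrier ?Z" "w \<triangleleft>\<^bsub>?Z\<^esub> bas e \<noteq> \<zero>\<^bsub>?Z\<^esub>" using wZ w by simp_all
      then show ?thesis using bas_closed[OF e_closed] by blast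
    qed
    fix N assume N: "right_submodule K A N ?Z"
    have NZ: "N \<subseteq> Z" using right_submoduleD(1)[OF Z.module_axioms N] by simp
    then have "right_submodule K A N M" using N M.right_submodule_of_restrict[OF Z] by blast
    then show "N = {\<zero>\<^bsub>?Z\<^esub>} \<or> N = carrier ?Z" using nonzero NZ by auto
  qed
  \<comment> \<open>Restricting to \<open>Z\<close> loses nothing of the corner, as
    \<open>M e\<close> is contained in \<open>Z\<close>.\<close>
  moreover have "corner ?Z = corner M"
  proof -
    have "carrier (corner ?Z) = carrier (corner M)"
      using corner_subset_socle[OF rM] ZM
      by (auto simp: corner_carrier[OF rM] corner_carrier[OF rZ, unfolded Z_def] Z_def)
    then show ?thesis by (simp add: corner_module_def)
  qed
  moreover have "rmodule_iso K KG (corner M) (corner M)"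
    using corner_unital[OF rM] right_module.iso_refl unital_right_module.axioms(1) by blast
  ultimately show "simple_over K S J e (corner M) ?Z" by (simp add: simple_over_def)
qed

text \<open>The map \<open>f\<close> is linear over \<open>KG\<close> only, so \<open>b\<close>
  cannot be moved across it directly. If \<open>f w b\<close> were not zero, cyclicity would give
  \<open>f w = f w b c\<close> for some \<open>c\<close>. Cut with \<open>e\<close>, this reads
  \<open>f w = f w (proj (b c))\<close>, and \<open>proj (b c)\<close> does pass through
  \<open>f\<close>, where it produces \<open>w b c e = 0\<close>.\<close>

lemma corner_iso_annihilates:
  assumes M: "apex_module M" and M': "apex_module M'" "simple_module K A M'"
    and f: "f \<in> rmodule_hom K KG (corner M) (corner M')" and w: "w \<in> carrier (corner M)"
    and b: "b \<in> carrier A" "w \<triangleleft>\<^bsub>M\<^esub> b = \<zero>\<^bsub>M\<^esub>"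
  shows "f w \<triangleleft>\<^bsub>M'\<^esub> b = \<zero>\<^bsub>M'\<^esub>"
proof (rule ccontr)
  assume ne: "f w \<triangleleft>\<^bsub>M'\<^esub> b \<noteq> \<zero>\<^bsub>M'\<^esub>"
  interpret M: right_module K A M using M by (rule apex_moduleD)
  interpret M': right_module K A M' using M'(1) by (rule apex_moduleD)
  interpret C: unital_right_module K KG "corner M" by (rule corner_unital[OF M.right_module_axioms])
  interpret C': unital_right_module K KG "corner M'" by (rule corner_unital[OF M'.right_module_axioms])
  have fw: "f w \<in> carrier (corner M')" using rmodule_hom_carrier[OF f w] .
  then have fw': "f w \<in> carrier M'" "f w \<triangleleft>\<^bsub>M'\<^esub> bas e = f w"
    by (auto simp: corner_carrier[OF M'.right_module_axioms])
  have wM: "w \<in> carrier M" using w by (auto simp: corner_carrier[OF M.right_module_axioms])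
  obtain c where c: "c \<in> carrier A" "f w = f w \<triangleleft>\<^bsub>M'\<^esub> b \<triangleleft>\<^bsub>M'\<^esub> c"
    using simple_cyclic[OF M'(2) M'.act_closed[OF fw'(1) b(1)] ne fw'(1)] by auto
  have "f w = f w \<triangleleft>\<^bsub>M'\<^esub> (b \<otimes>\<^bsub>A\<^esub> c) \<triangleleft>\<^bsub>M'\<^esub> bas e"
    using c fw' b by (simp add: M'.act_mult)
  also have "\<dots> = f w \<triangleleft>\<^bsub>M'\<^esub> proj (b \<otimes>\<^bsub>A\<^esub> c)"
    using b c by (intro corner_act[OF M'(1) fw]) auto
  also have "\<dots> = f (w \<triangleleft>\<^bsub>M\<^esub> proj (b \<otimes>\<^bsub>A\<^esub> c))"
    using rmodule_hom_act[OF f w, of "proj (b \<otimes>\<^bsub>A\<^esub> c)"] b c by simp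
  also have "w \<triangleleft>\<^bsub>M\<^esub> proj (b \<otimes>\<^bsub>A\<^esub> c) = w \<triangleleft>\<^bsub>M\<^esub> (b \<otimes>\<^bsub>A\<^esub> c) \<triangleleft>\<^bsub>M\<^esub> bas e"
    using b c by (intro corner_act[OF M w, symmetric]) auto
  also have "\<dots> = \<zero>\<^bsub>M\<^esub>" using b c wM by (simp add: M.act_mult)
  also have "f \<zero>\<^bsub>M\<^esub> = \<zero>\<^bsub>M'\<^esub>" using C.hom_zero[OF C'.module_axioms f] by simp
  finally have "f w = \<zero>\<^bsub>M'\<^esub>" .
  then show False using ne b by simp
qed

text \<open>That the extension of \<open>f\<close> is well-defined and that it is injective are the
  two directions of one statement: \<open>w\<close> and \<open>f w\<close> have the same annihilator
  in \<open>KS\<close>, by \<open>corner_iso_annihilates\<close> for \<open>f\<close> and for its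
  inverse.\<close>

lemma simple_modules_iso_of_corners:
  assumes M: "simple_module K A M" "is_apex K S M J" and M': "simple_module K A M'" "is_apex K S M' J"
    and iso: "rmodule_iso K KG (corner M) (corner M')"
  shows "rmodule_iso K A M M'"
proof -
  have rM: "right_module K A M" and rM': "right_module K A M'" using M M' simple_moduleD(1) by auto
  have aM: "apex_module M" and aM': "apex_module M'" using M M' rM rM' apex_moduleI by auto
  interpret M: right_module K A M by (rule rM)
  interpret M': right_module K A M' by (rule rM')
  interpret C: unital_right_module K KG "corner M" by (rule corner_unital[OF rM])
  interpret C': unital_right_module K KG "corner M'" by (rule corner_unital[OF rM'])
  obtain f where f: "f \<in> rmodule_hom K KG (corner M) (corner M')"
    and bij: "bij_betw f (carrier (corner M)) (carrier (corner M'))"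
    using iso by (auto simp: rmodule_iso_def)
  define g where "g = inv_into (carrier (corner M)) f"
  have g: "g \<in> rmodule_hom K KG (corner M') (corner M)"
    unfolding g_def by (rule C.hom_inverse[OF f bij])
  have gf: "g (f x) = x" if "x \<in> carrier (corner M)" for x
    using that bij by (simp add: g_def bij_betw_def)
  obtain w where w: "w \<in> carrier (corner M)" "w \<in> carrier M" "w \<triangleleft>\<^bsub>M\<^esub> bas e = w" "w \<noteq> \<zero>\<^bsub>M\<^esub>"
    using simple_corner_nonzero[OF rM simple_corner[OF M]] by auto
  have fw: "f w \<in> carrier (corner M')" using rmodule_hom_carrier[OF f w(1)] .
  then have fwM: "f w \<in> carrier M'" by (auto simp: corner_carrier[OF rM'])
  have g0: "g \<zero>\<^bsub>M'\<^esub> = \<zero>\<^bsub>M\<^esub>" using C'.hom_zero[OF C.module_axioms g] by simp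
  have fw0: "f w \<noteq> \<zero>\<^bsub>M'\<^esub>" using g0 gf[OF w(1)] w(4) by auto
  have iff0: "w \<triangleleft>\<^bsub>M\<^esub> b = \<zero>\<^bsub>M\<^esub> \<longleftrightarrow> f w \<triangleleft>\<^bsub>M'\<^esub> b = \<zero>\<^bsub>M'\<^esub>" if "b \<in> carrier A" for b
    using corner_iso_annihilates[OF aM aM' M'(1) f w(1) that]
      corner_iso_annihilates[OF aM' aM M(1) g fw that] gf[OF w(1)] by auto
  have iff: "w \<triangleleft>\<^bsub>M\<^esub> a = w \<triangleleft>\<^bsub>M\<^esub> b \<longleftrightarrow> f w \<triangleleft>\<^bsub>M'\<^esub> a = f w \<triangleleft>\<^bsub>M'\<^esub> b"
    if "a \<in> carrier A" "b \<in> carrier A" for a b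
    using that iff0[of "a \<oplus>\<^bsub>A\<^esub> \<ominus>\<^bsub>A\<^esub> b"] act_eq_iff[OF rM w(2) that]
      act_eq_iff[OF rM' fwM that] by simp
  have cyc: "\<exists>a. a \<in> carrier A \<and> x = w \<triangleleft>\<^bsub>M\<^esub> a" if "x \<in> carrier M" for x
    using simple_cyclic[OF M(1) w(2,4) that] by blast
  \<comment> \<open>By \<open>iff\<close>, the value does not depend on the coefficient
    chosen.\<close>
  define h where "h x = f w \<triangleleft>\<^bsub>M'\<^esub> (SOME a. a \<in> carrier A \<and> x = w \<triangleleft>\<^bsub>M\<^esub> a)" for x
  have h: "h (w \<triangleleft>\<^bsub>M\<^esub> a) = f w \<triangleleft>\<^bsub>M'\<^esub> a" if a: "a \<in> carrier A" for a
  proof -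
    let ?b = "SOME b. b \<in> carrier A \<and> w \<triangleleft>\<^bsub>M\<^esub> a = w \<triangleleft>\<^bsub>M\<^esub> b"
    have "?b \<in> carrier A \<and> w \<triangleleft>\<^bsub>M\<^esub> a = w \<triangleleft>\<^bsub>M\<^esub> ?b"
      using someI[of "\<lambda>b. b \<in> carrier A \<and> w \<triangleleft>\<^bsub>M\<^esub> a = w \<triangleleft>\<^bsub>M\<^esub> b" a] a by simp
    then show ?thesis unfolding h_def using iff[OF a, of ?b] by simp
  qed
  have "h \<in> rmodule_hom K A M M'"
  proof (rule rmodule_homI)
    fix x assume "x \<in> carrier M"
    then obtain a where a: "a \<in> carrier A" "x = w \<triangleleft>\<^bsub>M\<^esub> a" using cyc by blast
    show "h x \<in> carrier M'" using a h fwM M'.act_closed by simp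
    show "h (k \<odot>\<^bsub>M\<^esub> x) = k \<odot>\<^bsub>M'\<^esub> h x" if "k \<in> carrier K" for k
      using that a w fwM h[of "k \<odot>\<^bsub>A\<^esub> a"] h[of a] by (simp add: M.act_smult_right M'.act_smult_right)
    show "h (x \<triangleleft>\<^bsub>M\<^esub> b) = h x \<triangleleft>\<^bsub>M'\<^esub> b" if "b \<in> carrier A" for b
      using that a w fwM h[of "a \<otimes>\<^bsub>A\<^esub> b"] h[of a] by (simp add: M.act_mult M'.act_mult)
    fix y assume "y \<in> carrier M"
    then obtain b where b: "b \<in> carrier A" "y = w \<triangleleft>\<^bsub>M\<^esub> b" using cyc by blast
    show "h (x \<oplus>\<^bsub>M\<^esub> y) = h x \<oplus>\<^bsub>M'\<^esub> h y"
      using a b w fwM h[of "a \<oplus>\<^bsub>A\<^esub> b"] h[of a] h[of b] by (simp add: M.act_add_right M'.act_add_right)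
  qed
  moreover have "bij_betw h (carrier M) (carrier M')"
    unfolding bij_betw_def
  proof
    show "inj_on h (carrier M)"
      by (rule inj_onI) (metis cyc h iff)
    show "h ` carrier M = carrier M'"
    proof
      show "h ` carrier M \<subseteq> carrier M'" using rmodule_hom_carrier[OF \<open>h \<in> rmodule_hom K A M M'\<close>] by auto
      show "carrier M' \<subseteq> h ` carrier M"
      proof
        fix y assume "y \<in> carrier M'"
        then obtain a where "a \<in> carrier A" "y = f w \<triangleleft>\<^bsub>M'\<^esub> a"
          using simple_cyclic[OF M'(1) fwM fw0] by blast
        then show "y \<in> h ` carrier M" using h M.act_closed[OF w(2)] by (metis image_eqI)
      qed
    qed
  qed
  ultimately show ?thesis by (auto simp: rmodule_iso_def)
qed

lemma simple_over_unique:
  assumes M: "simple_over K S J e V M" and M': "simple_over K S J e V M'"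
  shows "rmodule_iso K A M M'"
proof (rule simple_modules_iso_of_corners)
  have "right_module K A M'" using M' simple_moduleD(1) by (auto simp: simple_over_def)
  then interpret C': unital_right_module K KG "corner M'" by (rule corner_unital)
  have "rmodule_iso K KG (corner M') V" using M' by (simp add: simple_over_def)
  then have "rmodule_iso K KG V (corner M')" by (rule C'.iso_sym)
  then show "rmodule_iso K KG (corner M) (corner M')"
    using M rmodule_iso_trans by (auto simp: simple_over_def)
qed (use M M' in \<open>auto simp: simple_over_def\<close>)

end

section \<open>Tensor products\<close>

text \<open>Scalars act on the tensor product through \<open>V\<close>, whereas \<open>A\<close>
  acts through \<open>L\<close>. The assumption \<open>L_act_smult\<close> links the two: a scalar
  in \<open>A\<close> acts on \<open>L\<close> as an element of \<open>B\<close>, which balancing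
  carries over to \<open>V\<close>.\<close>

locale tensor_product = V: unital_right_module K B V
  for K :: "('k, 'x) ring_scheme" and A :: "('k, 'a, 'y) module_scheme"
    and B :: "('k, 'b, 'z) module_scheme" and V :: "('k, 'b, 'v, 'w) rmodule_scheme"
    and L :: "('k, 'b, 'a, 'l, 'u) bimodule_scheme" +
  assumes A_closed: "\<lbrakk>a \<in> carrier A; a' \<in> carrier A\<rbrakk> \<Longrightarrow> a \<oplus>\<^bsub>A\<^esub> a' \<in> carrier A"
      "\<lbrakk>a \<in> carrier A; a' \<in> carrier A\<rbrakk> \<Longrightarrow> a \<otimes>\<^bsub>A\<^esub> a' \<in> carrier A"
      "\<lbrakk>k \<in> carrier K; a \<in> carrier A\<rbrakk> \<Longrightarrow> k \<odot>\<^bsub>A\<^esub> a \<in> carrier A"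
    and scalar_closed: "k \<in> carrier K \<Longrightarrow> k \<odot>\<^bsub>B\<^esub> \<one>\<^bsub>B\<^esub> \<in> carrier B"
    and one_closed: "\<one>\<^bsub>B\<^esub> \<in> carrier B"
    and L_add_closed: "\<lbrakk>x \<in> carrier L; y \<in> carrier L\<rbrakk> \<Longrightarrow> x \<oplus>\<^bsub>L\<^esub> y \<in> carrier L"
    and L_act_closed: "\<lbrakk>x \<in> carrier L; a \<in> carrier A\<rbrakk> \<Longrightarrow> x \<triangleleft>\<^bsub>L\<^esub> a \<in> carrier L"
    and L_lact_closed: "\<lbrakk>x \<in> carrier L; b \<in> carrier B\<rbrakk> \<Longrightarrow> b \<triangleright>\<^bsub>L\<^esub> x \<in> carrier L"
    and L_act_add_left: "\<lbrakk>x \<in> carrier L; y \<in> carrier L; a \<in> carrier A\<rbrakk> \<Longrightarrow>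
      (x \<oplus>\<^bsub>L\<^esub> y) \<triangleleft>\<^bsub>L\<^esub> a = (x \<triangleleft>\<^bsub>L\<^esub> a) \<oplus>\<^bsub>L\<^esub> (y \<triangleleft>\<^bsub>L\<^esub> a)"
    and L_act_add_right: "\<lbrakk>x \<in> carrier L; a \<in> carrier A; a' \<in> carrier A\<rbrakk> \<Longrightarrow>
      x \<triangleleft>\<^bsub>L\<^esub> (a \<oplus>\<^bsub>A\<^esub> a') = (x \<triangleleft>\<^bsub>L\<^esub> a) \<oplus>\<^bsub>L\<^esub> (x \<triangleleft>\<^bsub>L\<^esub> a')"
    and L_act_mult: "\<lbrakk>x \<in> carrier L; a \<in> carrier A; a' \<in> carrier A\<rbrakk> \<Longrightarrow>
      x \<triangleleft>\<^bsub>L\<^esub> (a \<otimes>\<^bsub>A\<^esub> a') = (x \<triangleleft>\<^bsub>L\<^esub> a) \<triangleleft>\<^bsub>L\<^esub> a'"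
    and L_act_lact: "\<lbrakk>x \<in> carrier L; a \<in> carrier A; b \<in> carrier B\<rbrakk> \<Longrightarrow>
      (b \<triangleright>\<^bsub>L\<^esub> x) \<triangleleft>\<^bsub>L\<^esub> a = b \<triangleright>\<^bsub>L\<^esub> (x \<triangleleft>\<^bsub>L\<^esub> a)"
    and L_act_smult: "\<lbrakk>x \<in> carrier L; a \<in> carrier A; k \<in> carrier K\<rbrakk> \<Longrightarrow>
      x \<triangleleft>\<^bsub>L\<^esub> (k \<odot>\<^bsub>A\<^esub> a) = (k \<odot>\<^bsub>B\<^esub> \<one>\<^bsub>B\<^esub>) \<triangleright>\<^bsub>L\<^esub> (x \<triangleleft>\<^bsub>L\<^esub> a)"
begin

abbreviation "F \<equiv> free_Abelian_group (carrier V \<times> carrier L)"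
abbreviation "rel \<equiv> tensor_relators B V L"
abbreviation "R \<equiv> generate F rel"
abbreviation "T \<equiv> tensor_rmodule B V L"

definition tens where "tens v x = R #>\<^bsub>F\<^esub> frag_of (v, x)"

lemma rel_subset: "rel \<subseteq> carrier F"
  unfolding tensor_relators_def
  by (auto simp: L_add_closed L_lact_closed V.act_closed dest!: subsetD[OF keys_diff])

lemma R_subgroup: "subgroup R F"
  using rel_subset by (intro group.generate_is_subgroup) auto

lemma R_subset: "r \<in> R \<Longrightarrow> r \<in> carrier F"
  using R_subgroup subgroup.subset by blast

lemma F_add: "f \<in> carrier F \<Longrightarrow> g \<in> carrier F \<Longrightarrow> f + g \<in> carrier F"
  using keys_add[of f g] by auto

lemma rcoset_eq:
  assumes "f \<in> carrier F" "g \<in> carrier F" "f - g \<in> R"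
  shows "R #>\<^bsub>F\<^esub> f = R #>\<^bsub>F\<^esub> g"
proof -
  have "R #>\<^bsub>F\<^esub> f = R #>\<^bsub>F\<^esub> ((f - g) \<otimes>\<^bsub>F\<^esub> g)" by simp
  also have "\<dots> = (R #>\<^bsub>F\<^esub> (f - g)) #>\<^bsub>F\<^esub> g"
    using assms R_subset[OF assms(3)] R_subset
    by (intro group.coset_mult_assoc[symmetric]) auto
  also have "R #>\<^bsub>F\<^esub> (f - g) = R"
    using group.coset_join2[OF _ R_subset[OF assms(3)] R_subgroup assms(3)] by simp
  finally show ?thesis .
qed

lemma T_carrier: "carrier T = (\<lambda>f. R #>\<^bsub>F\<^esub> f) ` carrier F"
  and T_zero: "\<zero>\<^bsub>T\<^esub> = R"
  by (auto simp: tensor_rmodule_def Let_def FactGroup_def RCOSETS_def)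

lemma T_abelian: "abelian_group T"
proof -
  interpret Q: comm_group "F Mod R"
    by (rule comm_group.abelian_FactGroup[OF abelian_free_Abelian_group R_subgroup])
  have T: "carrier T = carrier (F Mod R)" "\<zero>\<^bsub>T\<^esub> = \<one>\<^bsub>F Mod R\<^esub>" "x \<oplus>\<^bsub>T\<^esub> y = x \<otimes>\<^bsub>F Mod R\<^esub> y" for x y
    by (simp_all add: tensor_rmodule_def Let_def)
  show ?thesis
  proof (rule abelian_groupI)
    fix x assume "x \<in> carrier T"
    then show "\<exists>y\<in>carrier T. y \<oplus>\<^bsub>T\<^esub> x = \<zero>\<^bsub>T\<^esub>"
      unfolding T using Q.inv_closed Q.l_inv by blast
  qed (unfold T, simp_all add: Q.m_ac del: mult_FactGroup one_FactGroup)
qed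

lemma T_add:
  assumes "f \<in> carrier F" "g \<in> carrier F"
  shows "(R #>\<^bsub>F\<^esub> f) \<oplus>\<^bsub>T\<^esub> (R #>\<^bsub>F\<^esub> g) = R #>\<^bsub>F\<^esub> (f + g)"
proof -
  have "R \<lhd> F" by (rule comm_group.subgroup_imp_normal[OF abelian_free_Abelian_group R_subgroup])
  from normal.rcos_sum[OF this assms] show ?thesis
    by (simp add: tensor_rmodule_def Let_def FactGroup_def)
qed

lemma tens_closed: "v \<in> carrier V \<Longrightarrow> x \<in> carrier L \<Longrightarrow> tens v x \<in> carrier T"
  unfolding T_carrier tens_def by (rule imageI) simp

lemma tens_add_left:
  assumes "v \<in> carrier V" "v' \<in> carrier V" "x \<in> carrier L"
  shows "tens (v \<oplus>\<^bsub>V\<^esub> v') x = tens v x \<oplus>\<^bsub>T\<^esub> tens v' x"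
proof -

  have "frag_of (v \<oplus>\<^bsub>V\<^esub> v', x) - (frag_of (v, x) + frag_of (v', x)) \<in> rel"
    using assms unfolding tensor_relators_def by (auto simp: diff_diff_eq)
  then show ?thesis
    unfolding tens_def using assms
    by (subst T_add) (simp, simp, intro rcoset_eq F_add generate.incl, auto)
qed

lemma tens_add_right:
  assumes "v \<in> carrier V" "x \<in> carrier L" "x' \<in> carrier L"
  shows "tens v (x \<oplus>\<^bsub>L\<^esub> x') = tens v x \<oplus>\<^bsub>T\<^esub> tens v x'"
proof -

  have "frag_of (v, x \<oplus>\<^bsub>L\<^esub> x') - (frag_of (v, x) + frag_of (v, x')) \<in> rel"
    using assms unfolding tensor_relators_def by (auto simp: diff_diff_eq)
  then show ?thesis
    unfolding tens_def using assms L_add_closed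
    by (subst T_add) (simp, simp, intro rcoset_eq F_add generate.incl, auto)
qed

lemma tens_balanced:
  assumes "v \<in> carrier V" "b \<in> carrier B" "x \<in> carrier L"
  shows "tens (v \<triangleleft>\<^bsub>V\<^esub> b) x = tens v (b \<triangleright>\<^bsub>L\<^esub> x)"
proof -
  have "frag_of (v \<triangleleft>\<^bsub>V\<^esub> b, x) - frag_of (v, b \<triangleright>\<^bsub>L\<^esub> x) \<in> rel"
    using assms unfolding tensor_relators_def by blast
  then show ?thesis
    unfolding tens_def using assms V.act_closed L_lact_closed
    by (intro rcoset_eq generate.incl) auto
qed

lemma tens_zero_left:
  assumes "x \<in> carrier L"
  shows "tens \<zero>\<^bsub>V\<^esub> x = \<zero>\<^bsub>T\<^esub>"
proof -
  interpret T: abelian_group T by (rule T_abelian)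
  show ?thesis
    using tens_add_left[of "\<zero>\<^bsub>V\<^esub>" "\<zero>\<^bsub>V\<^esub>" x] tens_closed[of "\<zero>\<^bsub>V\<^esub>" x] assms
    by simp
qed

text \<open>Sums of pure tensors suffice, since the negative of a pure tensor is pure: the sign can
  be moved to the element of \<open>V\<close>.\<close>

lemma T_induct [consumes 1, case_names zero tens add]:
  assumes w: "w \<in> carrier T" and zero: "P \<zero>\<^bsub>T\<^esub>"
    and tens: "\<And>v x. v \<in> carrier V \<Longrightarrow> x \<in> carrier L \<Longrightarrow> P (tens v x)"
    and add: "\<And>w w'. \<lbrakk>w \<in> carrier T; w' \<in> carrier T; P w; P w'\<rbrakk> \<Longrightarrow> P (w \<oplus>\<^bsub>T\<^esub> w')"
  shows "P w"
proof -
  interpret T: abelian_group T by (rule T_abelian)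
  let ?c = "\<lambda>f. R #>\<^bsub>F\<^esub> f"
  have c: "Poly_Mapping.keys f \<subseteq> carrier V \<times> carrier L \<Longrightarrow> ?c f \<in> carrier T" for f
    unfolding T_carrier by (rule imageI) simp
  have diff: "?c (f - g) = ?c f \<oplus>\<^bsub>T\<^esub> ?c (- g)"
    if "Poly_Mapping.keys f \<subseteq> carrier V \<times> carrier L" "Poly_Mapping.keys g \<subseteq> carrier V \<times> carrier L" for f g
    using that by (subst T_add) auto
  have c0: "?c 0 = \<zero>\<^bsub>T\<^esub>"
    using group.coset_mult_one[of F R] R_subset by (simp add: T_zero subset_iff)
  \<comment> \<open>The induction rule for free abelian groups has a step for differences, so
    \<open>f\<close> and \<open>- f\<close> are carried along together.\<close>
  have "P (?c f) \<and> P (?c (- f))" if "Poly_Mapping.keys f \<subseteq> carrier V \<times> carrier L" for f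
  proof (rule free_Abelian_group_induct[OF that])
    show "P (?c 0) \<and> P (?c (- 0))" using zero c0 by simp
  next
    fix f g assume 2: "Poly_Mapping.keys f \<subseteq> carrier V \<times> carrier L" "Poly_Mapping.keys g \<subseteq> carrier V \<times> carrier L"
      "P (?c f) \<and> P (?c (- f))" "P (?c g) \<and> P (?c (- g))"
    have "P (?c (f - g))" using 2 diff[of f g] add c by simp
    moreover have "P (?c (g - f))" using 2 diff[of g f] add c by simp
    ultimately show "P (?c (f - g)) \<and> P (?c (- (f - g)))" by simp
  next
    fix p assume "p \<in> carrier V \<times> carrier L"
    then obtain v x where p: "p = (v, x)" "v \<in> carrier V" "x \<in> carrier L" by auto
    have "?c (- frag_of (v, x)) = \<ominus>\<^bsub>T\<^esub> tens v x"
      using p c0 unfolding tens_def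
      by (intro T.minus_equality[symmetric]) (auto simp: T_add intro!: c)
    also have "\<dots> = tens (\<ominus>\<^bsub>V\<^esub> v) x"
      using p tens_add_left[of "\<ominus>\<^bsub>V\<^esub> v" v x] tens_zero_left[of x]
      by (intro T.minus_equality) (auto simp: tens_closed V.M.l_neg)
    finally have "?c (- frag_of p) = tens (\<ominus>\<^bsub>V\<^esub> v) x" using p by simp
    moreover have "?c (frag_of p) = tens v x" using p by (simp add: tens_def)
    ultimately show "P (?c (frag_of p)) \<and> P (?c (- frag_of p))" using tens p by simp
  qed
  then show ?thesis using w unfolding T_carrier by auto
qed

text \<open>A pair of maps compatible with \<open>B\<close> sends each of the three kinds of
  relators to a relator of the same kind, so it descends to cosets. For scalars, \<open>q\<close> is
  the identity; for the action of \<open>A\<close>, \<open>p\<close> is.\<close>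

lemma induced_map:
  assumes p: "\<And>v. v \<in> carrier V \<Longrightarrow> p v \<in> carrier V"
      "\<And>v v'. v \<in> carrier V \<Longrightarrow> v' \<in> carrier V \<Longrightarrow> p (v \<oplus>\<^bsub>V\<^esub> v') = p v \<oplus>\<^bsub>V\<^esub> p v'"
      "\<And>v b. v \<in> carrier V \<Longrightarrow> b \<in> carrier B \<Longrightarrow> p (v \<triangleleft>\<^bsub>V\<^esub> b) = p v \<triangleleft>\<^bsub>V\<^esub> b"
    and q: "\<And>x. x \<in> carrier L \<Longrightarrow> q x \<in> carrier L"
      "\<And>x x'. x \<in> carrier L \<Longrightarrow> x' \<in> carrier L \<Longrightarrow> q (x \<oplus>\<^bsub>L\<^esub> x') = q x \<oplus>\<^bsub>L\<^esub> q x'"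
      "\<And>x b. x \<in> carrier L \<Longrightarrow> b \<in> carrier B \<Longrightarrow> q (b \<triangleright>\<^bsub>L\<^esub> x) = b \<triangleright>\<^bsub>L\<^esub> q x"
    and f: "f \<in> carrier F"
  defines "\<Phi> \<equiv> frag_extend (\<lambda>(v, x). frag_of (p v, q x))"
  shows "(\<Union>w\<in>R #>\<^bsub>F\<^esub> f. R #>\<^bsub>F\<^esub> \<Phi> w) = R #>\<^bsub>F\<^esub> \<Phi> f" and "\<Phi> f \<in> carrier F"
proof -
  let ?\<phi> = "\<lambda>(v, x). (p v, q x)"
  have \<Phi>: "\<Phi> = frag_extend (\<lambda>u. frag_of (?\<phi> u))"
    unfolding \<Phi>_def by (rule arg_cong[of _ _ frag_extend]) auto
  have closed: "\<Phi> f \<in> carrier F" if "f \<in> carrier F" for f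
  proof -
    have "Poly_Mapping.keys (\<Phi> f) \<subseteq> ?\<phi> ` Poly_Mapping.keys f"
      using keys_frag_extend[of "\<lambda>u. frag_of (?\<phi> u)" f] unfolding \<Phi> by auto
    also have "\<dots> \<subseteq> carrier V \<times> carrier L" using that p(1) q(1) by auto
    finally show ?thesis by simp
  qed
  then show "\<Phi> f \<in> carrier F" using f .
  have hom: "\<Phi> \<in> hom F F"
    by (rule homI) (use closed in \<open>auto simp: \<Phi>_def frag_extend_add\<close>)
  have gens: "\<Phi> (frag_of (v, x)) = frag_of (p v, q x)" "\<Phi> (f - g) = \<Phi> f - \<Phi> g" for v x f g
    by (simp_all add: \<Phi>_def frag_extend_diff)
  have rel: "\<Phi> r \<in> R" if "r \<in> rel" for r
  proof (rule generate.incl)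
    from that show "\<Phi> r \<in> rel"
      unfolding tensor_relators_def
      by (elim UnE CollectE exE conjE) (simp_all add: gens p q, (use p(1) q(1) in blast)+)
  qed
  have "\<Phi> r \<in> R" if "r \<in> R" for r
    using that
  proof (induction rule: generate.induct)
    case one
    then show ?case using generate.one[of F rel] by (simp add: \<Phi>_def)
  next
    case (incl r)
    then show ?case by (rule rel)
  next
    case (inv r)
    have "\<Phi> (- r) = inv\<^bsub>F\<^esub> \<Phi> r"
      using closed[of r] rel_subset inv by (auto simp: \<Phi>_def frag_extend_minus)
    moreover have "\<dots> \<in> R" using subgroup.m_inv_closed[OF R_subgroup rel[OF inv]] .
    ultimately show ?case using rel_subset inv by auto
  next
    case (eng r s)
    then show ?case using subgroup.m_closed[OF R_subgroup] by (simp add: \<Phi>_def frag_extend_add)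
  qed
  then show "(\<Union>w\<in>R #>\<^bsub>F\<^esub> f. R #>\<^bsub>F\<^esub> \<Phi> w) = R #>\<^bsub>F\<^esub> \<Phi> f"
    by (intro UN_r_coset_hom[OF _ _ R_subgroup R_subgroup hom _ f]) auto
qed

lemma T_smult:
  assumes k: "k \<in> carrier K" and f: "f \<in> carrier F"
  shows "k \<odot>\<^bsub>T\<^esub> (R #>\<^bsub>F\<^esub> f) = R #>\<^bsub>F\<^esub> frag_extend (\<lambda>(v, x). frag_of (k \<odot>\<^bsub>V\<^esub> v, x)) f"
    "frag_extend (\<lambda>(v, x). frag_of (k \<odot>\<^bsub>V\<^esub> v, x)) f \<in> carrier F"
  using induced_map[of "(\<odot>\<^bsub>V\<^esub>) k" "\<lambda>x. x" f] k f
  by (simp_all add: tensor_rmodule_def Let_def V.smult_r_distr V.act_smult_left)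

lemma T_act:
  assumes a: "a \<in> carrier A" and f: "f \<in> carrier F"
  shows "(R #>\<^bsub>F\<^esub> f) \<triangleleft>\<^bsub>T\<^esub> a = R #>\<^bsub>F\<^esub> frag_extend (\<lambda>(v, x). frag_of (v, x \<triangleleft>\<^bsub>L\<^esub> a)) f"
    "frag_extend (\<lambda>(v, x). frag_of (v, x \<triangleleft>\<^bsub>L\<^esub> a)) f \<in> carrier F"
  using induced_map[of "\<lambda>v. v" "\<lambda>x. x \<triangleleft>\<^bsub>L\<^esub> a" f] a f
  by (simp_all add: tensor_rmodule_def Let_def L_act_closed L_act_add_left L_act_lact)

lemma smult_tens:
  "k \<in> carrier K \<Longrightarrow> v \<in> carrier V \<Longrightarrow> x \<in> carrier L \<Longrightarrow> k \<odot>\<^bsub>T\<^esub> tens v x = tens (k \<odot>\<^bsub>V\<^esub> v) x"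
  unfolding tens_def by (subst T_smult) auto

lemma act_tens:
  "a \<in> carrier A \<Longrightarrow> v \<in> carrier V \<Longrightarrow> x \<in> carrier L \<Longrightarrow> tens v x \<triangleleft>\<^bsub>T\<^esub> a = tens v (x \<triangleleft>\<^bsub>L\<^esub> a)"
  unfolding tens_def by (subst T_act) auto

lemma T_smult_closed: "k \<in> carrier K \<Longrightarrow> w \<in> carrier T \<Longrightarrow> k \<odot>\<^bsub>T\<^esub> w \<in> carrier T"
proof -
  assume k: "k \<in> carrier K" and "w \<in> carrier T"
  then obtain f where f: "f \<in> carrier F" "w = R #>\<^bsub>F\<^esub> f" unfolding T_carrier by (elim imageE)
  show ?thesis unfolding T_carrier f(2) T_smult(1)[OF k f(1)] by (rule imageI[OF T_smult(2)[OF k f(1)]])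
qed

lemma T_act_closed: "a \<in> carrier A \<Longrightarrow> w \<in> carrier T \<Longrightarrow> w \<triangleleft>\<^bsub>T\<^esub> a \<in> carrier T"
proof -
  assume a: "a \<in> carrier A" and "w \<in> carrier T"
  then obtain f where f: "f \<in> carrier F" "w = R #>\<^bsub>F\<^esub> f" unfolding T_carrier by (elim imageE)
  show ?thesis unfolding T_carrier f(2) T_act(1)[OF a f(1)] by (rule imageI[OF T_act(2)[OF a f(1)]])
qed

lemma T_smult_add:
  assumes "k \<in> carrier K" "w \<in> carrier T" "w' \<in> carrier T"
  shows "k \<odot>\<^bsub>T\<^esub> (w \<oplus>\<^bsub>T\<^esub> w') = k \<odot>\<^bsub>T\<^esub> w \<oplus>\<^bsub>T\<^esub> k \<odot>\<^bsub>T\<^esub> w'"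
proof -
  obtain f where f: "f \<in> carrier F" "w = R #>\<^bsub>F\<^esub> f" using assms(2) unfolding T_carrier by (elim imageE)
  obtain g where g: "g \<in> carrier F" "w' = R #>\<^bsub>F\<^esub> g" using assms(3) unfolding T_carrier by (elim imageE)
  show ?thesis
    unfolding f(2) g(2) T_add[OF f(1) g(1)] T_smult(1)[OF assms(1) F_add[OF f(1) g(1)]]
      T_smult(1)[OF assms(1) f(1)] T_smult(1)[OF assms(1) g(1)] frag_extend_add
      T_add[OF T_smult(2)[OF assms(1) f(1)] T_smult(2)[OF assms(1) g(1)]] ..
qed

lemma T_add_act:
  assumes "a \<in> carrier A" "w \<in> carrier T" "w' \<in> carrier T"
  shows "(w \<oplus>\<^bsub>T\<^esub> w') \<triangleleft>\<^bsub>T\<^esub> a = w \<triangleleft>\<^bsub>T\<^esub> a \<oplus>\<^bsub>T\<^esub> w' \<triangleleft>\<^bsub>T\<^esub> a"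
proof -
  obtain f where f: "f \<in> carrier F" "w = R #>\<^bsub>F\<^esub> f" using assms(2) unfolding T_carrier by (elim imageE)
  obtain g where g: "g \<in> carrier F" "w' = R #>\<^bsub>F\<^esub> g" using assms(3) unfolding T_carrier by (elim imageE)
  show ?thesis
    unfolding f(2) g(2) T_add[OF f(1) g(1)] T_act(1)[OF assms(1) F_add[OF f(1) g(1)]]
      T_act(1)[OF assms(1) f(1)] T_act(1)[OF assms(1) g(1)] frag_extend_add
      T_add[OF T_act(2)[OF assms(1) f(1)] T_act(2)[OF assms(1) g(1)]] ..
qed

lemma T_module: "module K T"
proof -
  interpret T: abelian_group T by (rule T_abelian)
  have zero: "k \<odot>\<^bsub>T\<^esub> \<zero>\<^bsub>T\<^esub> = \<zero>\<^bsub>T\<^esub>" if "k \<in> carrier K" for k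
    using T_smult_add[OF that T.zero_closed T.zero_closed] T_smult_closed[OF that T.zero_closed] by simp
  show ?thesis
  proof (rule moduleI[OF V.R.cring_axioms T_abelian])
    fix k w assume k: "k \<in> carrier K" and w: "w \<in> carrier T"
    show "k \<odot>\<^bsub>T\<^esub> w \<in> carrier T" using k w by (rule T_smult_closed)
    fix l assume l: "l \<in> carrier K"
    show "(k \<oplus>\<^bsub>K\<^esub> l) \<odot>\<^bsub>T\<^esub> w = k \<odot>\<^bsub>T\<^esub> w \<oplus>\<^bsub>T\<^esub> l \<odot>\<^bsub>T\<^esub> w"
      using w
    proof (induction rule: T_induct)
      case (add w w')
      then show ?case using k l T_smult_closed by (simp add: T_smult_add T.a_ac)
    qed (use k l zero in \<open>auto simp: smult_tens V.smult_l_distr tens_add_left\<close>)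
    show "(k \<otimes>\<^bsub>K\<^esub> l) \<odot>\<^bsub>T\<^esub> w = k \<odot>\<^bsub>T\<^esub> (l \<odot>\<^bsub>T\<^esub> w)"
      using w
    proof (induction rule: T_induct)
      case (add w w')
      then show ?case using k l T_smult_closed by (simp add: T_smult_add)
    qed (use k l zero in \<open>auto simp: smult_tens V.smult_assoc1\<close>)
  next
    fix w assume w: "w \<in> carrier T"
    then show "\<one>\<^bsub>K\<^esub> \<odot>\<^bsub>T\<^esub> w = w"
      by (induction rule: T_induct) (use zero in \<open>auto simp: smult_tens T_smult_add\<close>)
  qed (rule T_smult_add)
qed

lemma T_right_module: "right_module K A T"
proof -
  interpret T: module K T by (rule T_module)
  have zero: "\<zero>\<^bsub>T\<^esub> \<triangleleft>\<^bsub>T\<^esub> a = \<zero>\<^bsub>T\<^esub>" if "a \<in> carrier A" for a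
    using T_add_act[OF that T.M.zero_closed T.M.zero_closed] T_act_closed[OF that T.M.zero_closed] by simp
  have act_any: "tens v (x \<triangleleft>\<^bsub>L\<^esub> (k \<odot>\<^bsub>A\<^esub> a)) = tens (k \<odot>\<^bsub>V\<^esub> v) (x \<triangleleft>\<^bsub>L\<^esub> a)"
    if "k \<in> carrier K" "a \<in> carrier A" "v \<in> carrier V" "x \<in> carrier L" for k a v x
    using that by (simp add: L_act_smult tens_balanced[symmetric] scalar_closed L_act_closed
        V.act_smult_right one_closed V.act_one)
  show ?thesis
  proof (rule right_moduleI[OF T_module])
    fix w a assume w: "w \<in> carrier T" and a: "a \<in> carrier A"
    show "w \<triangleleft>\<^bsub>T\<^esub> a \<in> carrier T" using a w by (rule T_act_closed)
    show "(k \<odot>\<^bsub>T\<^esub> w) \<triangleleft>\<^bsub>T\<^esub> a = k \<odot>\<^bsub>T\<^esub> (w \<triangleleft>\<^bsub>T\<^esub> a)" if k: "k \<in> carrier K" for k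
      using w
    proof (induction rule: T_induct)
      case (add w w')
      then show ?case using a k T_act_closed by (simp add: T_add_act T.smult_r_distr)
    qed (use a k zero in \<open>auto simp: smult_tens act_tens L_act_closed\<close>)
    show "w \<triangleleft>\<^bsub>T\<^esub> (k \<odot>\<^bsub>A\<^esub> a) = k \<odot>\<^bsub>T\<^esub> (w \<triangleleft>\<^bsub>T\<^esub> a)" if k: "k \<in> carrier K" for k
      using w
    proof (induction rule: T_induct)
      case (add w w')
      then show ?case using a k T_act_closed A_closed by (simp add: T_add_act T.smult_r_distr)
    qed (use a k zero A_closed in \<open>auto simp: smult_tens act_tens L_act_closed act_any\<close>)
    fix b assume b: "b \<in> carrier A"
    show "w \<triangleleft>\<^bsub>T\<^esub> (a \<oplus>\<^bsub>A\<^esub> b) = w \<triangleleft>\<^bsub>T\<^esub> a \<oplus>\<^bsub>T\<^esub> w \<triangleleft>\<^bsub>T\<^esub> b"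
      using w
    proof (induction rule: T_induct)
      case (add w w')
      then show ?case using a b T_act_closed A_closed by (simp add: T_add_act T.M.a_ac)
    qed (use a b zero A_closed in \<open>auto simp: act_tens L_act_closed L_act_add_right tens_add_right\<close>)
    show "w \<triangleleft>\<^bsub>T\<^esub> (a \<otimes>\<^bsub>A\<^esub> b) = w \<triangleleft>\<^bsub>T\<^esub> a \<triangleleft>\<^bsub>T\<^esub> b"
      using w
    proof (induction rule: T_induct)
      case (add w w')
      then show ?case using a b T_act_closed A_closed by (simp add: T_add_act)
    qed (use a b zero A_closed in \<open>auto simp: act_tens L_act_closed L_act_mult\<close>)
  qed (rule T_add_act)
qed

text \<open>The part of the universal property that later detects non-zero pure tensors. The
  extension \<open>h\<close> of \<open>f\<close> to the free group kills the relators, hence all of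
  \<open>R\<close>, and a vanishing pure tensor is a generator that lies in
  \<open>R\<close>.\<close>

lemma tens_eq_zero:
  assumes W: "abelian_group W"
    and f_closed: "\<And>v x. v \<in> carrier V \<Longrightarrow> x \<in> carrier L \<Longrightarrow> f v x \<in> carrier W"
    and f_left: "\<And>v v' x. v \<in> carrier V \<Longrightarrow> v' \<in> carrier V \<Longrightarrow> x \<in> carrier L \<Longrightarrow>
      f (v \<oplus>\<^bsub>V\<^esub> v') x = f v x \<oplus>\<^bsub>W\<^esub> f v' x"
    and f_right: "\<And>v x x'. v \<in> carrier V \<Longrightarrow> x \<in> carrier L \<Longrightarrow> x' \<in> carrier L \<Longrightarrow>
      f v (x \<oplus>\<^bsub>L\<^esub> x') = f v x \<oplus>\<^bsub>W\<^esub> f v x'"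
    and f_balanced: "\<And>v b x. v \<in> carrier V \<Longrightarrow> b \<in> carrier B \<Longrightarrow> x \<in> carrier L \<Longrightarrow>
      f (v \<triangleleft>\<^bsub>V\<^esub> b) x = f v (b \<triangleright>\<^bsub>L\<^esub> x)"
    and v: "v \<in> carrier V" and x: "x \<in> carrier L" and 0: "tens v x = \<zero>\<^bsub>T\<^esub>"
  shows "f v x = \<zero>\<^bsub>W\<^esub>"
proof -
  interpret W: abelian_group W by (rule W)
  obtain h where h: "h \<in> hom F (add_monoid W)" "\<And>p. p \<in> carrier V \<times> carrier L \<Longrightarrow> h (frag_of p) = f (fst p) (snd p)"
    using comm_group.free_Abelian_group_universal[OF W.a_comm_group, of "\<lambda>p. f (fst p) (snd p)" "carrier V \<times> carrier L"]
      f_closed by (auto simp: image_subset_iff)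
  have h_frag: "h (frag_of (u, y)) = f u y" if "u \<in> carrier V" "y \<in> carrier L" for u y
    using h(2)[of "(u, y)"] that by simp
  have hW: "h g \<in> carrier W" if "g \<in> carrier F" for g using hom_in_carrier[OF h(1) that] by simp
  have h0: "h 0 = \<zero>\<^bsub>W\<^esub>" using hom_one[OF h(1) group_free_Abelian_group W.a_group] by simp
  have h_add: "h (g + g') = h g \<oplus>\<^bsub>W\<^esub> h g'" if "g \<in> carrier F" "g' \<in> carrier F" for g g'
    using hom_mult[OF h(1) that] by simp
  have F_minus: "- g \<in> carrier F" if "g \<in> carrier F" for g using that by simp
  have h_minus: "h (- g) = \<ominus>\<^bsub>W\<^esub> h g" if "g \<in> carrier F" for g
    using h_add[OF F_minus[OF that] that] h0 that hW[OF that] hW[OF F_minus[OF that]]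
    by (intro W.minus_equality[symmetric]) auto
  have h_diff: "h (g - g') = h g \<oplus>\<^bsub>W\<^esub> \<ominus>\<^bsub>W\<^esub> h g'" if "g \<in> carrier F" "g' \<in> carrier F" for g g'
    using h_add[OF that(1) F_minus[OF that(2)]] h_minus[OF that(2)] by simp
  have F_diff: "g - g' \<in> carrier F" if "g \<in> carrier F" "g' \<in> carrier F" for g g'
    using that keys_diff[of g g'] by auto
  \<comment> \<open>The form taken by the two kinds of additivity relators under
    \<open>h\<close>.\<close>
  have cancel: "(a \<oplus>\<^bsub>W\<^esub> b) \<oplus>\<^bsub>W\<^esub> \<ominus>\<^bsub>W\<^esub> a \<oplus>\<^bsub>W\<^esub> \<ominus>\<^bsub>W\<^esub> b = \<zero>\<^bsub>W\<^esub>" if "a \<in> carrier W" "b \<in> carrier W" for a b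
    using that W.r_neg[of "a \<oplus>\<^bsub>W\<^esub> b"] by (simp add: W.minus_add W.a_assoc)
  have rel0: "h r = \<zero>\<^bsub>W\<^esub>" if "r \<in> rel" for r
    using that unfolding tensor_relators_def
    by (elim UnE CollectE exE conjE)
      (simp_all add: h_diff F_diff h_frag V.act_closed L_add_closed L_lact_closed f_closed
        f_left f_right f_balanced cancel W.r_neg del: carrier_free_Abelian_group_iff)
  have "h r = \<zero>\<^bsub>W\<^esub>" if "r \<in> R" for r
    using that
  proof (induction rule: generate.induct)
    case (inv r)
    have rF: "r \<in> carrier F" by (rule subsetD[OF rel_subset inv])
    then show ?case using h_minus[OF rF] rel0[OF inv] by simp
  next
    case (eng r s)
    then show ?case using R_subset[OF eng(1)] R_subset[OF eng(2)] by (simp only: mult_free_Abelian_group h_add) simp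
  qed (use h0 rel0 in auto)
  moreover have "frag_of (v, x) \<in> R"
    using group.rcos_self[OF _ _ R_subgroup, of "frag_of (v, x)"] 0 v x by (simp add: tens_def T_zero)
  ultimately show ?thesis using h_frag[OF v x] by metis
qed

end

section \<open>Induced and coinduced modules\<close>

context J_class
begin

section \<open>The algebra \<open>KS/KI\<close> and its one-sided corners\<close>

abbreviation "Q \<equiv> apex_quotient K S J"
abbreviation "cls \<equiv> apex_class K S J"

lemma KI_abelian_subgroup: "abelian_subgroup KI A"
  using KI.subgroup_axioms A.abelian_group_axioms
  by (intro abelian_subgroupI3 additive_subgroup.intro)

lemma carrier_Q: "carrier Q = cls ` carrier A"
  by (auto simp: apex_quotient_def quotient_algebra_def FactRing_def A_RCOSETS_def RCOSETS_def
      apex_class_def a_r_coset_def)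

lemma cls_add: "a \<in> carrier A \<Longrightarrow> b \<in> carrier A \<Longrightarrow> cls a \<oplus>\<^bsub>Q\<^esub> cls b = cls (a \<oplus>\<^bsub>A\<^esub> b)"
  using abelian_subgroup.a_rcos_sum[OF KI_abelian_subgroup, of a b]
  by (simp add: apex_quotient_def quotient_algebra_def FactRing_def apex_class_def)

lemma KI_coset_map:
  assumes "a \<in> carrier A" "\<And>x. x \<in> carrier A \<Longrightarrow> f x \<in> carrier A"
    "\<And>x y. x \<in> carrier A \<Longrightarrow> y \<in> carrier A \<Longrightarrow> f (x \<oplus>\<^bsub>A\<^esub> y) = f x \<oplus>\<^bsub>A\<^esub> f y" "f ` KI \<subseteq> KI"
  shows "(\<Union>b\<in>cls a. cls (f b)) = cls (f a)"
  unfolding apex_class_def a_r_coset_def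
  by (rule UN_r_coset_hom[OF A.M.a_group A.M.a_group KI.subgroup_axioms KI.subgroup_axioms])
    (use assms in \<open>auto simp: hom_def\<close>)

lemma cls_subset: "a \<in> carrier A \<Longrightarrow> b \<in> cls a \<Longrightarrow> b \<in> carrier A"
  by (auto simp: apex_class_def a_r_coset_def r_coset_def KI_subset)

lemma cls_mult:
  assumes a: "a \<in> carrier A" and b: "b \<in> carrier A"
  shows "cls a \<otimes>\<^bsub>Q\<^esub> cls b = cls (a \<otimes>\<^bsub>A\<^esub> b)"
proof -
  have "cls a \<otimes>\<^bsub>Q\<^esub> cls b = (\<Union>x\<in>cls a. \<Union>y\<in>cls b. cls (x \<otimes>\<^bsub>A\<^esub> y))"
    by (simp add: apex_quotient_def quotient_algebra_def FactRing_def rcoset_mult_def apex_class_def)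
  also have "\<dots> = (\<Union>x\<in>cls a. cls (x \<otimes>\<^bsub>A\<^esub> b))"
  proof (rule SUP_cong[OF refl])
    fix x assume "x \<in> cls a"
    then have "x \<in> carrier A" by (rule cls_subset[OF a])
    then show "(\<Union>y\<in>cls b. cls (x \<otimes>\<^bsub>A\<^esub> y)) = cls (x \<otimes>\<^bsub>A\<^esub> b)"
      by (intro KI_coset_map b) (auto simp: A_r_distr KI_ideal)
  qed
  also have "\<dots> = cls (a \<otimes>\<^bsub>A\<^esub> b)"
    by (rule KI_coset_map[OF a]) (use b in \<open>auto simp: A_l_distr KI_ideal\<close>)
  finally show ?thesis .
qed

lemma cls_smult:
  assumes k: "k \<in> carrier K" and a: "a \<in> carrier A"
  shows "k \<odot>\<^bsub>Q\<^esub> cls a = cls (k \<odot>\<^bsub>A\<^esub> a)"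
proof -
  have "k \<odot>\<^bsub>Q\<^esub> cls a = (\<Union>b\<in>cls a. cls (k \<odot>\<^bsub>A\<^esub> b))"
    by (simp add: apex_quotient_def quotient_algebra_def apex_class_def)
  also have "\<dots> = cls (k \<odot>\<^bsub>A\<^esub> a)"
    by (rule KI_coset_map[OF a]) (use k KI_closed in \<open>auto simp: A.smult_r_distr\<close>)
  finally show ?thesis .
qed

lemma cls_KI: "c \<in> KI \<Longrightarrow> cls c = cls \<zero>\<^bsub>A\<^esub>"
  using abelian_subgroup.a_rcos_const[OF KI_abelian_subgroup] KI_closed(3)
  by (simp add: apex_class_def)

lemma cls_add_KI:
  assumes "a \<in> carrier A" "c \<in> KI"
  shows "cls (a \<oplus>\<^bsub>A\<^esub> c) = cls a"
proof -
  have "cls (a \<oplus>\<^bsub>A\<^esub> c) = cls a \<oplus>\<^bsub>Q\<^esub> cls \<zero>\<^bsub>A\<^esub>"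
    using assms KI_subset by (simp add: cls_add[symmetric] cls_KI)
  then show ?thesis using assms by (simp add: cls_add)
qed

lemma proj_cls_eq:
  assumes "a \<in> carrier A" "b \<in> carrier A" "cls a = cls b"
  shows "proj a = proj b"
proof -
  have "a \<in> cls b"
    using abelian_subgroup.a_rcos_self[OF KI_abelian_subgroup assms(1)] assms(3) by (simp add: apex_class_def)
  then obtain c where "c \<in> KI" "a = c \<oplus>\<^bsub>A\<^esub> b"
    by (auto simp: apex_class_def a_r_coset_def r_coset_def)
  then show ?thesis using assms(2) KI_subset KG_subset by (simp add: proj_add proj_KI)
qed

text \<open>The map induced by \<open>proj\<close> on \<open>KS/KI\<close>;
  \<open>proj_cls_eq\<close> makes the choice of a representative harmless.\<close>

definition proj_class :: "('s \<Rightarrow> 'k) set \<Rightarrow> 's \<Rightarrow> 'k" where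
  "proj_class x = proj (SOME a. a \<in> carrier A \<and> x = cls a)"

lemma proj_class:
  assumes "a \<in> carrier A"
  shows "proj_class (cls a) = proj a"
proof -
  let ?b = "SOME b. b \<in> carrier A \<and> cls a = cls b"
  have "?b \<in> carrier A \<and> cls a = cls ?b"
    using someI[of "\<lambda>b. b \<in> carrier A \<and> cls a = cls b" a] assms by simp
  then have "proj a = proj ?b" using proj_cls_eq[of a ?b] assms by blast
  then show ?thesis by (simp add: proj_class_def)
qed

abbreviation "LC \<equiv> left_corner K S J e"
abbreviation "RC \<equiv> right_corner K S J e"

lemma corner_ops:
  "x \<oplus>\<^bsub>LC\<^esub> y = x \<oplus>\<^bsub>Q\<^esub> y" "k \<odot>\<^bsub>LC\<^esub> x = k \<odot>\<^bsub>Q\<^esub> x" "x \<triangleleft>\<^bsub>LC\<^esub> a = x \<otimes>\<^bsub>Q\<^esub> cls a" "a \<triangleright>\<^bsub>LC\<^esub> x = cls a \<otimes>\<^bsub>Q\<^esub> x"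
  "x \<oplus>\<^bsub>RC\<^esub> y = x \<oplus>\<^bsub>Q\<^esub> y" "k \<odot>\<^bsub>RC\<^esub> x = k \<odot>\<^bsub>Q\<^esub> x" "x \<triangleleft>\<^bsub>RC\<^esub> a = x \<otimes>\<^bsub>Q\<^esub> cls a" "a \<triangleright>\<^bsub>RC\<^esub> x = cls a \<otimes>\<^bsub>Q\<^esub> x"
  by (simp_all add: left_corner_def right_corner_def apex_bimodule_def Let_def)

lemma LC_memI: "a \<in> carrier A \<Longrightarrow> bas e \<otimes>\<^bsub>A\<^esub> a = a \<Longrightarrow> cls a \<in> carrier LC"
  using cls_mult[of "bas e" a] by (auto simp: left_corner_def carrier_Q)

text \<open>The representative is normalized so that \<open>e a = a\<close> holds in
  \<open>KS\<close> itself and not only modulo \<open>KI\<close>.\<close>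

lemma LC_memE:
  assumes "x \<in> carrier LC"
  obtains a where "a \<in> carrier A" "bas e \<otimes>\<^bsub>A\<^esub> a = a" "x = cls a"
proof -
  obtain a where a: "a \<in> carrier A" "x = cls (bas e) \<otimes>\<^bsub>Q\<^esub> cls a"
    using assms by (auto simp: left_corner_def carrier_Q)
  show ?thesis
    by (rule that[of "bas e \<otimes>\<^bsub>A\<^esub> a"]) (use a in \<open>auto simp: cls_mult bas_e_idem simp flip: A_mult_assoc\<close>)
qed

lemma RC_memI: "a \<in> carrier A \<Longrightarrow> a \<otimes>\<^bsub>A\<^esub> bas e = a \<Longrightarrow> cls a \<in> carrier RC"
  using cls_mult[of a "bas e"] by (auto simp: right_corner_def carrier_Q)

lemma RC_memE:
  assumes "x \<in> carrier RC"
  obtains a where "a \<in> carrier A" "a \<otimes>\<^bsub>A\<^esub> bas e = a" "x = cls a"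
proof -
  obtain a where a: "a \<in> carrier A" "x = cls a \<otimes>\<^bsub>Q\<^esub> cls (bas e)"
    using assms by (auto simp: right_corner_def carrier_Q)
  show ?thesis
    by (rule that[of "a \<otimes>\<^bsub>A\<^esub> bas e"]) (use a in \<open>auto simp: cls_mult bas_e_idem A_mult_assoc\<close>)
qed

lemma cls_corner:
  assumes "a \<in> carrier A"
  shows "cls (bas e \<otimes>\<^bsub>A\<^esub> a \<otimes>\<^bsub>A\<^esub> bas e) = cls (proj a)"
  using corner_decomp[OF assms] cls_add_KI KG_subset[OF proj_closed[OF assms]] by auto

lemma tensor_LC:
  assumes "unital_right_module K KG V"
  shows "tensor_product K A KG V LC"
proof -
  interpret V: unital_right_module K KG V by fact
  note [simp] = corner_ops cls_add cls_mult KG_subset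
  show ?thesis
  proof (intro tensor_product.intro assms tensor_product_axioms.intro)
    show "k \<odot>\<^bsub>KG\<^esub> \<one>\<^bsub>KG\<^esub> \<in> carrier KG" if "k \<in> carrier K" for k
      using that bas_e_KG KG_closed by (simp add: KG_ops)
    show "\<one>\<^bsub>KG\<^esub> \<in> carrier KG" using bas_e_KG by (simp add: KG_ops)
  next
    fix x y assume x: "x \<in> carrier LC" and y: "y \<in> carrier LC"
    obtain f where f: "f \<in> carrier A" "bas e \<otimes>\<^bsub>A\<^esub> f = f" "x = cls f" using x by (rule LC_memE)
    obtain g where g: "g \<in> carrier A" "bas e \<otimes>\<^bsub>A\<^esub> g = g" "y = cls g" using y by (rule LC_memE)
    show "x \<oplus>\<^bsub>LC\<^esub> y \<in> carrier LC"
      using f g LC_memI[of "f \<oplus>\<^bsub>A\<^esub> g"] by (simp add: A_r_distr)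
    fix a assume a: "a \<in> carrier A"
    show "(x \<oplus>\<^bsub>LC\<^esub> y) \<triangleleft>\<^bsub>LC\<^esub> a = (x \<triangleleft>\<^bsub>LC\<^esub> a) \<oplus>\<^bsub>LC\<^esub> (y \<triangleleft>\<^bsub>LC\<^esub> a)"
      using f g a by (simp add: A_l_distr)
  next
    fix x a assume x: "x \<in> carrier LC" and a: "a \<in> carrier A"
    obtain f where f: "f \<in> carrier A" "bas e \<otimes>\<^bsub>A\<^esub> f = f" "x = cls f" using x by (rule LC_memE)
    have "bas e \<otimes>\<^bsub>A\<^esub> (f \<otimes>\<^bsub>A\<^esub> a) = f \<otimes>\<^bsub>A\<^esub> a"
      using A_mult_assoc[of "bas e" f a] f a by simp
    then show "x \<triangleleft>\<^bsub>LC\<^esub> a \<in> carrier LC"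
      using f a LC_memI[of "f \<otimes>\<^bsub>A\<^esub> a"] by simp
    show "x \<triangleleft>\<^bsub>LC\<^esub> (a \<oplus>\<^bsub>A\<^esub> b) = (x \<triangleleft>\<^bsub>LC\<^esub> a) \<oplus>\<^bsub>LC\<^esub> (x \<triangleleft>\<^bsub>LC\<^esub> b)"
      "x \<triangleleft>\<^bsub>LC\<^esub> (a \<otimes>\<^bsub>A\<^esub> b) = (x \<triangleleft>\<^bsub>LC\<^esub> a) \<triangleleft>\<^bsub>LC\<^esub> b" if "b \<in> carrier A" for b
      using f a that by (simp_all add: A_r_distr A_mult_assoc)
    show "(b \<triangleright>\<^bsub>LC\<^esub> x) \<triangleleft>\<^bsub>LC\<^esub> a = b \<triangleright>\<^bsub>LC\<^esub> (x \<triangleleft>\<^bsub>LC\<^esub> a)" if "b \<in> carrier KG" for b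
      using f a that by (simp add: A_mult_assoc)
    \<comment> \<open>The unit of \<open>KG\<close> is \<open>e\<close>, and \<open>e\<close> fixes
      the representatives of the left corner.\<close>
    show "x \<triangleleft>\<^bsub>LC\<^esub> (k \<odot>\<^bsub>A\<^esub> a) = (k \<odot>\<^bsub>KG\<^esub> \<one>\<^bsub>KG\<^esub>) \<triangleright>\<^bsub>LC\<^esub> (x \<triangleleft>\<^bsub>LC\<^esub> a)" if "k \<in> carrier K" for k
      using f a that by (simp add: KG_ops A_smult_l A_smult_r flip: A_mult_assoc)
  next
    fix x b assume x: "x \<in> carrier LC" and b: "b \<in> carrier KG"
    obtain f where f: "f \<in> carrier A" "bas e \<otimes>\<^bsub>A\<^esub> f = f" "x = cls f" using x by (rule LC_memE)
    show "b \<triangleright>\<^bsub>LC\<^esub> x \<in> carrier LC"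
      using f b LC_memI[of "b \<otimes>\<^bsub>A\<^esub> f"] by (simp add: KG_e flip: A_mult_assoc)
  qed auto
qed

text \<open>The isomorphism from \<open>V\<close> to the corner sends \<open>v\<close> to the tensor
  of \<open>v\<close> and \<open>e\<close>. It is onto because multiplying the tensor of
  \<open>v\<close> and \<open>f\<close> by \<open>e\<close> leaves only \<open>e f e\<close>, which
  is \<open>proj f\<close> modulo \<open>KI\<close> and moves across to \<open>v\<close>. The corner
  generates since \<open>f = e f\<close>: the tensor of \<open>v\<close> and \<open>f\<close> is
  that of \<open>v\<close> and \<open>e\<close>, multiplied by \<open>f\<close>.\<close>

lemma Ind_facts:
  assumes V: "simple_unital_module K KG V"
  defines "M \<equiv> Ind K S J e V"
  shows Ind_apex_module: "apex_module M"
    and Ind_corner_iso: "rmodule_iso K KG V (corner M)"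
    and Ind_generated: "\<And>N. right_submodule K A N M \<Longrightarrow> carrier (corner M) \<subseteq> N \<Longrightarrow> N = carrier M"
proof -
  interpret V: unital_right_module K KG V using V by (simp add: simple_unital_module_def)
  interpret T: tensor_product K A KG V LC by (rule tensor_LC[OF V.unital_right_module_axioms])
  have M: "M = T.T" by (simp add: M_def Ind_def)
  have rM: "right_module K A M" unfolding M by (rule T.T_right_module)
  interpret M: right_module K A M by (rule rM)
  note cc = corner_carrier[OF rM]
  have eL: "cls (bas e) \<in> carrier LC" by (rule LC_memI) (auto simp: bas_e_idem)
  have zL: "cls \<zero>\<^bsub>A\<^esub> \<in> carrier LC" by (rule LC_memI) auto
  note act = T.act_tens[folded M, unfolded corner_ops]
  \<comment> \<open>Acting with zero on this tensor gives back the same tensor, and it also gives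
    zero.\<close>
  have tens0: "T.tens v (cls \<zero>\<^bsub>A\<^esub>) = \<zero>\<^bsub>M\<^esub>" if "v \<in> carrier V" for v
    using act[OF A.M.zero_closed that zL] T.tens_closed[OF that zL] act_zero_right[OF rM]
    by (simp add: cls_mult M)
  show apex: "apex_module M"
    unfolding apex_module_def
  proof (intro conjI ballI rM)
    fix w c assume w: "w \<in> carrier M" and c: "c \<in> KI"
    show "w \<triangleleft>\<^bsub>M\<^esub> c = \<zero>\<^bsub>M\<^esub>"
      using w unfolding M
    proof (induction rule: T.T_induct)
      case (tens v x)
      obtain f where f: "f \<in> carrier A" "bas e \<otimes>\<^bsub>A\<^esub> f = f" "x = cls f" using tens(2) by (rule LC_memE)
      have "T.tens v x \<triangleleft>\<^bsub>M\<^esub> c = T.tens v (cls (f \<otimes>\<^bsub>A\<^esub> c))"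
        using act[OF KI_subset[OF c] tens] f KI_subset[OF c] by (simp add: cls_mult)
      also have "\<dots> = \<zero>\<^bsub>M\<^esub>" using cls_KI[OF KI_ideal(2)[OF c f(1)]] tens0[OF tens(1)] by simp
      finally show ?case by (simp add: M)
    qed (use KI_subset[OF c] M.zero_act[unfolded M] M.act_add_left[unfolded M] T.T_module[THEN module.axioms(2)]
        in \<open>auto simp: abelian_group_def abelian_monoid.zero_closed abelian_monoid.l_zero\<close>)
  qed
  let ?\<phi> = "\<lambda>v. T.tens v (cls (bas e))"
  have \<phi>_act: "?\<phi> v \<triangleleft>\<^bsub>M\<^esub> a = T.tens v (cls (bas e \<otimes>\<^bsub>A\<^esub> a))" if "v \<in> carrier V" "a \<in> carrier A" for v a
    using act[OF that(2,1) eL] that by (simp add: cls_mult)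
  have \<phi>_KG: "T.tens v (cls b) = ?\<phi> (v \<triangleleft>\<^bsub>V\<^esub> b)" if "v \<in> carrier V" "b \<in> carrier KG" for v b
    using T.tens_balanced[OF that eL] that by (simp add: corner_ops cls_mult KG_subset KG_e)
  have \<phi>_corner: "?\<phi> v \<in> carrier (corner M)" if "v \<in> carrier V" for v
    using that T.tens_closed[OF that eL, folded M] \<phi>_act[OF that, of "bas e"] by (simp add: cc bas_e_idem)
  have \<phi>: "?\<phi> \<in> rmodule_hom K KG V (corner M)"
  proof (rule rmodule_homI)
    fix v assume v: "v \<in> carrier V"
    show "?\<phi> v \<in> carrier (corner M)" by (rule \<phi>_corner[OF v])
    show "?\<phi> (v \<oplus>\<^bsub>V\<^esub> v') = ?\<phi> v \<oplus>\<^bsub>corner M\<^esub> ?\<phi> v'" if "v' \<in> carrier V" for v'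
      using T.tens_add_left[OF v that eL] by (simp add: M)
    show "?\<phi> (k \<odot>\<^bsub>V\<^esub> v) = k \<odot>\<^bsub>corner M\<^esub> ?\<phi> v" if "k \<in> carrier K" for k
      using T.smult_tens[OF that v eL] by (simp add: M)
    show "?\<phi> (v \<triangleleft>\<^bsub>V\<^esub> b) = ?\<phi> v \<triangleleft>\<^bsub>corner M\<^esub> b" if "b \<in> carrier KG" for b
      using \<phi>_act[OF v KG_subset[OF that]] \<phi>_KG[OF v that] that by (simp add: KG_e)
  qed
  have image: "w \<triangleleft>\<^bsub>M\<^esub> bas e \<in> ?\<phi> ` carrier V" if "w \<in> carrier M" for w
    using that unfolding M
  proof (induction rule: T.T_induct)
    case zero
    have "?\<phi> \<zero>\<^bsub>V\<^esub> = \<zero>\<^bsub>M\<^esub>" using T.tens_zero_left[OF eL] by (simp add: M)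
    then have "\<zero>\<^bsub>M\<^esub> \<triangleleft>\<^bsub>M\<^esub> bas e = ?\<phi> \<zero>\<^bsub>V\<^esub>" by simp
    then show ?case unfolding M by (rule image_eqI) simp
  next
    case (tens v x)
    obtain f where f: "f \<in> carrier A" "bas e \<otimes>\<^bsub>A\<^esub> f = f" "x = cls f" using tens(2) by (rule LC_memE)
    have "T.tens v x \<triangleleft>\<^bsub>M\<^esub> bas e = T.tens v (cls (bas e \<otimes>\<^bsub>A\<^esub> f \<otimes>\<^bsub>A\<^esub> bas e))"
      using act[OF _ tens, of "bas e"] f by (simp add: cls_mult)
    also have "\<dots> = ?\<phi> (v \<triangleleft>\<^bsub>V\<^esub> proj f)"
      using cls_corner[OF f(1)] \<phi>_KG[OF tens(1) proj_closed[OF f(1)]] by simp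
    finally show ?case unfolding M
      by (rule image_eqI) (use V.act_closed[OF tens(1) proj_closed[OF f(1)]] in simp)
  next
    case (add w w')
    then obtain v v' where v: "v \<in> carrier V" "v' \<in> carrier V" "w \<triangleleft>\<^bsub>T.T\<^esub> bas e = ?\<phi> v" "w' \<triangleleft>\<^bsub>T.T\<^esub> bas e = ?\<phi> v'"
      by blast
    then have "(w \<oplus>\<^bsub>T.T\<^esub> w') \<triangleleft>\<^bsub>T.T\<^esub> bas e = ?\<phi> (v \<oplus>\<^bsub>V\<^esub> v')"
      using add(1,2) T.T_add_act[of "bas e" w w'] T.tens_add_left[OF v(1,2) eL] by simp
    then show ?case by (rule image_eqI) (use v in simp)
  qed
  interpret C: unital_right_module K KG "corner M" by (rule corner_unital[OF rM])
  have "inj_on ?\<phi> (carrier V)"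
  proof (rule V.hom_inj_onI[OF C.module_axioms \<phi>])
    fix v assume v: "v \<in> carrier V" and 0: "?\<phi> v = \<zero>\<^bsub>corner M\<^esub>"
    \<comment> \<open>Injectivity needs a map out of the tensor product: sending
      \<open>(u, x)\<close> to \<open>u\<close> times \<open>proj_class x\<close> is balanced by
      \<open>proj_mult_KG\<close>, and it takes \<open>(v, e)\<close> back to
      \<open>v\<close>.\<close>
    have "v \<triangleleft>\<^bsub>V\<^esub> proj_class (cls (bas e)) = \<zero>\<^bsub>V\<^esub>"
    proof (rule T.tens_eq_zero[where f = "\<lambda>v x. v \<triangleleft>\<^bsub>V\<^esub> proj_class x", OF V.M.abelian_group_axioms])
      fix u x assume u: "u \<in> carrier V" and x: "x \<in> carrier LC"
      obtain f where f: "f \<in> carrier A" "bas e \<otimes>\<^bsub>A\<^esub> f = f" "x = cls f" using x by (rule LC_memE)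
      show "u \<triangleleft>\<^bsub>V\<^esub> proj_class x \<in> carrier V" using u f by (simp add: proj_class V.act_closed)
      show "(u \<triangleleft>\<^bsub>V\<^esub> b) \<triangleleft>\<^bsub>V\<^esub> proj_class x = u \<triangleleft>\<^bsub>V\<^esub> proj_class (b \<triangleright>\<^bsub>LC\<^esub> x)" if b: "b \<in> carrier KG" for b
        using u f b
        by (simp add: corner_ops cls_mult KG_subset proj_class proj_mult_KG KG_mult[symmetric] V.act_mult)
      fix u' assume "u' \<in> carrier V"
      then show "(u \<oplus>\<^bsub>V\<^esub> u') \<triangleleft>\<^bsub>V\<^esub> proj_class x = u \<triangleleft>\<^bsub>V\<^esub> proj_class x \<oplus>\<^bsub>V\<^esub> u' \<triangleleft>\<^bsub>V\<^esub> proj_class x"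
        using u f by (simp add: proj_class V.act_add_left)
    next
      fix u x y assume u: "u \<in> carrier V" and x: "x \<in> carrier LC" and y: "y \<in> carrier LC"
      obtain f where f: "f \<in> carrier A" "bas e \<otimes>\<^bsub>A\<^esub> f = f" "x = cls f" using x by (rule LC_memE)
      obtain g where g: "g \<in> carrier A" "bas e \<otimes>\<^bsub>A\<^esub> g = g" "y = cls g" using y by (rule LC_memE)
      show "u \<triangleleft>\<^bsub>V\<^esub> proj_class (x \<oplus>\<^bsub>LC\<^esub> y) = u \<triangleleft>\<^bsub>V\<^esub> proj_class x \<oplus>\<^bsub>V\<^esub> u \<triangleleft>\<^bsub>V\<^esub> proj_class y"
        using u f g by (simp add: corner_ops cls_add proj_class proj_add V.act_add_right[unfolded KG_ops])
    qed (use v eL 0 in \<open>auto simp: M\<close>)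
    then show "v = \<zero>\<^bsub>V\<^esub>" using v V.act_one[OF v] by (simp add: proj_class proj_e KG_ops)
  qed
  moreover have "?\<phi> ` carrier V = carrier (corner M)"
  proof
    show "?\<phi> ` carrier V \<subseteq> carrier (corner M)" using \<phi>_corner by auto
    show "carrier (corner M) \<subseteq> ?\<phi> ` carrier V"
    proof
      fix w assume "w \<in> carrier (corner M)"
      then have "w \<in> carrier M" "w \<triangleleft>\<^bsub>M\<^esub> bas e = w" by (auto simp: cc)
      then show "w \<in> ?\<phi> ` carrier V" using image[of w] by simp
    qed
  qed
  ultimately have "bij_betw ?\<phi> (carrier V) (carrier (corner M))" by (simp add: bij_betw_def)
  then show "rmodule_iso K KG V (corner M)" using \<phi> by (auto simp: rmodule_iso_def)
  show "N = carrier M" if N: "right_submodule K A N M" and sub: "carrier (corner M) \<subseteq> N" for N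
  proof
    note D = right_submoduleD[OF M.module_axioms N]
    show "N \<subseteq> carrier M" by (rule D(1))
    have "w \<in> N" if "w \<in> carrier T.T" for w
      using that
    proof (induction rule: T.T_induct)
      case zero
      show ?case using D(2) by (simp add: M)
    next
      case (tens v x)
      obtain f where f: "f \<in> carrier A" "bas e \<otimes>\<^bsub>A\<^esub> f = f" "x = cls f" using tens(2) by (rule LC_memE)
      have "T.tens v x = ?\<phi> v \<triangleleft>\<^bsub>M\<^esub> f" using \<phi>_act[OF tens(1) f(1)] f by simp
      then show ?case using D(6) \<phi>_corner[OF tens(1)] sub f(1) by auto
    next
      case (add w w')
      then show ?case using D(3)[of w w'] by (simp add: M)
    qed
    then show "carrier M \<subseteq> N" by (auto simp: M)
  qed
qed

lemma simple_corner_transfer: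
  assumes V: "simple_unital_module K KG V" and M: "right_module K A M" and iso: "rmodule_iso K KG V (corner M)"
  shows "simple_unital_module K KG (corner M)"
  using V corner_unital[OF M] simple_module_iso[OF _ _ iso]
  by (auto simp: simple_unital_module_def unital_right_module.axioms(1))

lemma simple_over_transfer:
  assumes V: "right_module K KG V" and M: "simple_over K S J e W M" and iso: "rmodule_iso K KG V W"
  shows "simple_over K S J e V M"
  using M rmodule_iso_trans[OF _ right_module.iso_sym[OF V iso]] by (auto simp: simple_over_def)

text \<open>The isomorphism from the corner to \<open>V\<close> is evaluation at the class of
  \<open>e\<close>. It is injective because a map fixed by \<open>e\<close> has the same value at
  \<open>f\<close> as at \<open>e f e\<close>, which is its value at \<open>e\<close> times
  \<open>proj f\<close>. Cogeneration: the value of a map at \<open>f = f e\<close> is the value at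
  \<open>e\<close> of that map acted on by \<open>f e\<close>.\<close>

lemma Coind_facts:
  assumes V: "simple_unital_module K KG V"
  defines "M \<equiv> Coind K S J e V"
  shows Coind_apex_module: "apex_module M"
    and Coind_corner_iso: "rmodule_iso K KG V (corner M)"
    and Coind_cogenerated: "\<And>\<phi>. \<phi> \<in> carrier M \<Longrightarrow>
      (\<And>a. a \<in> carrier A \<Longrightarrow> \<phi> \<triangleleft>\<^bsub>M\<^esub> (a \<otimes>\<^bsub>A\<^esub> bas e) = \<zero>\<^bsub>M\<^esub>) \<Longrightarrow> \<phi> = \<zero>\<^bsub>M\<^esub>"
proof -
  interpret V: unital_right_module K KG V using V by (simp add: simple_unital_module_def)
  let ?X = "carrier RC"
  have carr: "carrier M = rmodule_hom K KG RC V \<inter> extensional ?X"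
    and zero: "\<zero>\<^bsub>M\<^esub> = (\<lambda>x\<in>?X. \<zero>\<^bsub>V\<^esub>)" and add: "\<phi> \<oplus>\<^bsub>M\<^esub> \<psi> = (\<lambda>x\<in>?X. \<phi> x \<oplus>\<^bsub>V\<^esub> \<psi> x)"
    and smult: "k \<odot>\<^bsub>M\<^esub> \<phi> = (\<lambda>x\<in>?X. k \<odot>\<^bsub>V\<^esub> \<phi> x)"
    and act: "\<phi> \<triangleleft>\<^bsub>M\<^esub> a = (\<lambda>x\<in>?X. \<phi> (a \<triangleright>\<^bsub>RC\<^esub> x))" for \<phi> \<psi> k a
    by (simp_all add: M_def Coind_def hom_rmodule_def)
  have X_cls: "cls f \<in> ?X" if "f \<in> carrier A" "f \<otimes>\<^bsub>A\<^esub> bas e = f" for f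
    using that by (rule RC_memI)
  have X_lact: "a \<triangleright>\<^bsub>RC\<^esub> x \<in> ?X" if xX: "x \<in> ?X" and aA: "a \<in> carrier A" for x a
  proof -
    obtain f where f: "f \<in> carrier A" "f \<otimes>\<^bsub>A\<^esub> bas e = f" "x = cls f" using xX by (rule RC_memE)
    then show ?thesis
      using that X_cls[of "a \<otimes>\<^bsub>A\<^esub> f"] by (simp add: corner_ops cls_mult A_mult_assoc)
  qed
  have X_add: "x \<oplus>\<^bsub>RC\<^esub> y \<in> ?X" if xX: "x \<in> ?X" and yX: "y \<in> ?X" for x y
  proof -
    obtain f where f: "f \<in> carrier A" "f \<otimes>\<^bsub>A\<^esub> bas e = f" "x = cls f" using xX by (rule RC_memE)
    obtain g where g: "g \<in> carrier A" "g \<otimes>\<^bsub>A\<^esub> bas e = g" "y = cls g" using yX by (rule RC_memE)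
    show ?thesis
      using f g X_cls[of "f \<oplus>\<^bsub>A\<^esub> g"] by (simp add: corner_ops cls_add A_l_distr)
  qed
  have X_smult: "k \<odot>\<^bsub>RC\<^esub> x \<in> ?X" if kK: "k \<in> carrier K" and xX: "x \<in> ?X" for k x
  proof -
    obtain f where f: "f \<in> carrier A" "f \<otimes>\<^bsub>A\<^esub> bas e = f" "x = cls f" using xX by (rule RC_memE)
    show ?thesis
      using that f X_cls[of "k \<odot>\<^bsub>A\<^esub> f"] by (simp add: corner_ops cls_smult A_smult_l)
  qed
  have X_act: "x \<triangleleft>\<^bsub>RC\<^esub> b \<in> ?X" if xX: "x \<in> ?X" and bK: "b \<in> carrier KG" for x b
  proof -
    obtain f where f: "f \<in> carrier A" "f \<otimes>\<^bsub>A\<^esub> bas e = f" "x = cls f" using xX by (rule RC_memE)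
    show ?thesis
      using that f X_cls[of "f \<otimes>\<^bsub>A\<^esub> b"] by (simp add: corner_ops cls_mult KG_subset A_mult_assoc KG_e)
  qed
  have lact_add: "a \<triangleright>\<^bsub>RC\<^esub> (x \<oplus>\<^bsub>RC\<^esub> y) = a \<triangleright>\<^bsub>RC\<^esub> x \<oplus>\<^bsub>RC\<^esub> a \<triangleright>\<^bsub>RC\<^esub> y"
    if xX: "x \<in> ?X" and yX: "y \<in> ?X" and aA: "a \<in> carrier A" for x y a
  proof -
    obtain f where f: "f \<in> carrier A" "x = cls f" using xX by (rule RC_memE)
    obtain g where g: "g \<in> carrier A" "y = cls g" using yX by (rule RC_memE)
    show ?thesis using f g that by (simp add: corner_ops cls_add cls_mult A_r_distr)
  qed
  have lact_smult: "a \<triangleright>\<^bsub>RC\<^esub> (k \<odot>\<^bsub>RC\<^esub> x) = k \<odot>\<^bsub>RC\<^esub> (a \<triangleright>\<^bsub>RC\<^esub> x)" "(k \<odot>\<^bsub>A\<^esub> a) \<triangleright>\<^bsub>RC\<^esub> x = k \<odot>\<^bsub>RC\<^esub> (a \<triangleright>\<^bsub>RC\<^esub> x)"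
    if xX: "x \<in> ?X" and aA: "a \<in> carrier A" and kK: "k \<in> carrier K" for x a k
  proof -
    obtain f where f: "f \<in> carrier A" "x = cls f" using xX by (rule RC_memE)
    show "a \<triangleright>\<^bsub>RC\<^esub> (k \<odot>\<^bsub>RC\<^esub> x) = k \<odot>\<^bsub>RC\<^esub> (a \<triangleright>\<^bsub>RC\<^esub> x)" "(k \<odot>\<^bsub>A\<^esub> a) \<triangleright>\<^bsub>RC\<^esub> x = k \<odot>\<^bsub>RC\<^esub> (a \<triangleright>\<^bsub>RC\<^esub> x)"
      using f that by (simp_all add: corner_ops cls_smult cls_mult A_smult_r A_smult_l)
  qed
  have lact_act: "a \<triangleright>\<^bsub>RC\<^esub> (x \<triangleleft>\<^bsub>RC\<^esub> b) = (a \<triangleright>\<^bsub>RC\<^esub> x) \<triangleleft>\<^bsub>RC\<^esub> b"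
    if xX: "x \<in> ?X" and aA: "a \<in> carrier A" and bK: "b \<in> carrier KG" for x a b
  proof -
    obtain f where f: "f \<in> carrier A" "x = cls f" using xX by (rule RC_memE)
    show ?thesis using f that by (simp add: corner_ops cls_mult KG_subset A_mult_assoc)
  qed
  have add_lact: "(a \<oplus>\<^bsub>A\<^esub> b) \<triangleright>\<^bsub>RC\<^esub> x = a \<triangleright>\<^bsub>RC\<^esub> x \<oplus>\<^bsub>RC\<^esub> b \<triangleright>\<^bsub>RC\<^esub> x" "(a \<otimes>\<^bsub>A\<^esub> b) \<triangleright>\<^bsub>RC\<^esub> x = a \<triangleright>\<^bsub>RC\<^esub> (b \<triangleright>\<^bsub>RC\<^esub> x)"
    if xX: "x \<in> ?X" and aA: "a \<in> carrier A" and bA: "b \<in> carrier A" for x a b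
  proof -
    obtain f where f: "f \<in> carrier A" "x = cls f" using xX by (rule RC_memE)
    show "(a \<oplus>\<^bsub>A\<^esub> b) \<triangleright>\<^bsub>RC\<^esub> x = a \<triangleright>\<^bsub>RC\<^esub> x \<oplus>\<^bsub>RC\<^esub> b \<triangleright>\<^bsub>RC\<^esub> x" "(a \<otimes>\<^bsub>A\<^esub> b) \<triangleright>\<^bsub>RC\<^esub> x = a \<triangleright>\<^bsub>RC\<^esub> (b \<triangleright>\<^bsub>RC\<^esub> x)"
      using f that by (simp_all add: corner_ops cls_mult cls_add A_l_distr A_mult_assoc)
  qed
  have M_D: "\<lbrakk>\<phi> \<in> carrier M; x \<in> ?X; y \<in> ?X\<rbrakk> \<Longrightarrow> \<phi> (x \<oplus>\<^bsub>RC\<^esub> y) = \<phi> x \<oplus>\<^bsub>V\<^esub> \<phi> y"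
    "\<lbrakk>\<phi> \<in> carrier M; x \<in> ?X; k \<in> carrier K\<rbrakk> \<Longrightarrow> \<phi> (k \<odot>\<^bsub>RC\<^esub> x) = k \<odot>\<^bsub>V\<^esub> \<phi> x"
    "\<lbrakk>\<phi> \<in> carrier M; x \<in> ?X; b \<in> carrier KG\<rbrakk> \<Longrightarrow> \<phi> (x \<triangleleft>\<^bsub>RC\<^esub> b) = \<phi> x \<triangleleft>\<^bsub>V\<^esub> b" for \<phi> x y k b
    by (auto simp: carr rmodule_hom_def)
  have M_closed: "\<phi> x \<in> carrier V" if "\<phi> \<in> carrier M" "x \<in> ?X" for \<phi> x
    using that by (auto simp: carr rmodule_hom_def)
  have M_I: "\<phi> \<in> carrier M"
    if "\<phi> \<in> extensional ?X" "\<And>x. x \<in> ?X \<Longrightarrow> \<phi> x \<in> carrier V"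
      "\<And>x y. x \<in> ?X \<Longrightarrow> y \<in> ?X \<Longrightarrow> \<phi> (x \<oplus>\<^bsub>RC\<^esub> y) = \<phi> x \<oplus>\<^bsub>V\<^esub> \<phi> y"
      "\<And>k x. k \<in> carrier K \<Longrightarrow> x \<in> ?X \<Longrightarrow> \<phi> (k \<odot>\<^bsub>RC\<^esub> x) = k \<odot>\<^bsub>V\<^esub> \<phi> x"
      "\<And>x b. x \<in> ?X \<Longrightarrow> b \<in> carrier KG \<Longrightarrow> \<phi> (x \<triangleleft>\<^bsub>RC\<^esub> b) = \<phi> x \<triangleleft>\<^bsub>V\<^esub> b" for \<phi>
    using that by (auto simp: carr rmodule_hom_def)
  have M_eqI: "\<phi> = \<psi>" if "\<phi> \<in> carrier M" "\<psi> \<in> carrier M" "\<And>x. x \<in> ?X \<Longrightarrow> \<phi> x = \<psi> x" for \<phi> \<psi>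
    using that by (intro extensionalityI[of \<phi> ?X \<psi>]) (auto simp: carr)
  note X_closed = X_lact X_add X_smult X_act
  have zero_closed: "\<zero>\<^bsub>M\<^esub> \<in> carrier M"
    by (rule M_I) (auto simp: zero X_closed)
  have add_closed: "\<phi> \<oplus>\<^bsub>M\<^esub> \<psi> \<in> carrier M" if "\<phi> \<in> carrier M" "\<psi> \<in> carrier M" for \<phi> \<psi>
    by (rule M_I) (use that in \<open>auto simp: add X_closed M_D M_closed V.M.a_ac V.smult_r_distr V.act_add_left\<close>)
  have smult_closed: "k \<odot>\<^bsub>M\<^esub> \<phi> \<in> carrier M" if "k \<in> carrier K" "\<phi> \<in> carrier M" for k \<phi>
  proof (rule M_I)
    show "(k \<odot>\<^bsub>M\<^esub> \<phi>) (l \<odot>\<^bsub>RC\<^esub> x) = l \<odot>\<^bsub>V\<^esub> (k \<odot>\<^bsub>M\<^esub> \<phi>) x" if "l \<in> carrier K" "x \<in> ?X" for l x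
      using that \<open>k \<in> carrier K\<close> \<open>\<phi> \<in> carrier M\<close>
      by (simp add: smult X_closed M_D M_closed K.m_comm flip: V.smult_assoc1)
  qed (use that in \<open>auto simp: smult X_closed M_D M_closed V.smult_r_distr V.act_smult_left\<close>)
  have act_closed: "\<phi> \<triangleleft>\<^bsub>M\<^esub> a \<in> carrier M" if "\<phi> \<in> carrier M" "a \<in> carrier A" for \<phi> a
    by (rule M_I)
      (use that in \<open>auto simp: act X_closed M_D M_closed lact_add lact_smult lact_act\<close>)
  have "abelian_group M"
  proof (rule abelian_groupI)
    fix \<phi> \<psi> \<chi> assume M: "\<phi> \<in> carrier M" "\<psi> \<in> carrier M" "\<chi> \<in> carrier M"
    show "\<phi> \<oplus>\<^bsub>M\<^esub> \<psi> \<oplus>\<^bsub>M\<^esub> \<chi> = \<phi> \<oplus>\<^bsub>M\<^esub> (\<psi> \<oplus>\<^bsub>M\<^esub> \<chi>)"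
      by (rule M_eqI) (use M in \<open>auto intro!: add_closed, auto simp: add M_closed V.M.a_assoc\<close>)
    show "\<phi> \<oplus>\<^bsub>M\<^esub> \<psi> = \<psi> \<oplus>\<^bsub>M\<^esub> \<phi>"
      by (rule M_eqI) (use M in \<open>auto intro!: add_closed, auto simp: add M_closed V.M.a_comm\<close>)
    show "\<phi> \<oplus>\<^bsub>M\<^esub> \<psi> \<in> carrier M" using M by (intro add_closed)
  next
    fix \<phi> assume \<phi>: "\<phi> \<in> carrier M"
    show "\<zero>\<^bsub>M\<^esub> \<oplus>\<^bsub>M\<^esub> \<phi> = \<phi>"
      by (rule M_eqI[OF add_closed[OF zero_closed \<phi>] \<phi>]) (use \<phi> in \<open>auto simp: add zero M_closed\<close>)
    show "\<exists>\<psi>\<in>carrier M. \<psi> \<oplus>\<^bsub>M\<^esub> \<phi> = \<zero>\<^bsub>M\<^esub>"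
    proof
      \<comment> \<open>The scalar \<open>-1\<close> provides the additive inverse, as closure under
        scalars is already established.\<close>
      show closed: "(\<ominus>\<^bsub>K\<^esub> \<one>\<^bsub>K\<^esub>) \<odot>\<^bsub>M\<^esub> \<phi> \<in> carrier M" using \<phi> by (intro smult_closed) auto
      show "(\<ominus>\<^bsub>K\<^esub> \<one>\<^bsub>K\<^esub>) \<odot>\<^bsub>M\<^esub> \<phi> \<oplus>\<^bsub>M\<^esub> \<phi> = \<zero>\<^bsub>M\<^esub>"
        by (rule M_eqI[OF add_closed[OF closed \<phi>] zero_closed])
          (use \<phi> in \<open>simp add: add smult zero M_closed V.smult_l_minus V.M.l_neg\<close>)
    qed
  qed (rule zero_closed)
  then have modM: "module K M"
  proof (rule moduleI[OF K.cring_axioms])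
    fix k l \<phi> assume k: "k \<in> carrier K" and l: "l \<in> carrier K" and \<phi>: "\<phi> \<in> carrier M"
    show "(k \<oplus>\<^bsub>K\<^esub> l) \<odot>\<^bsub>M\<^esub> \<phi> = k \<odot>\<^bsub>M\<^esub> \<phi> \<oplus>\<^bsub>M\<^esub> l \<odot>\<^bsub>M\<^esub> \<phi>"
      by (rule M_eqI)
        (use k l \<phi> in \<open>auto intro!: add_closed smult_closed, auto simp: add smult M_closed V.smult_l_distr\<close>)
    show "(k \<otimes>\<^bsub>K\<^esub> l) \<odot>\<^bsub>M\<^esub> \<phi> = k \<odot>\<^bsub>M\<^esub> (l \<odot>\<^bsub>M\<^esub> \<phi>)"
      by (rule M_eqI)
        (use k l \<phi> in \<open>auto intro!: smult_closed, auto simp: smult M_closed V.smult_assoc1\<close>)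
  next
    fix k \<phi> \<psi> assume k: "k \<in> carrier K" and M: "\<phi> \<in> carrier M" "\<psi> \<in> carrier M"
    show "k \<odot>\<^bsub>M\<^esub> (\<phi> \<oplus>\<^bsub>M\<^esub> \<psi>) = k \<odot>\<^bsub>M\<^esub> \<phi> \<oplus>\<^bsub>M\<^esub> k \<odot>\<^bsub>M\<^esub> \<psi>"
      by (rule M_eqI)
        (use k M in \<open>auto intro!: add_closed smult_closed, auto simp: add smult M_closed V.smult_r_distr\<close>)
  next
    fix \<phi> assume \<phi>: "\<phi> \<in> carrier M"
    show "\<one>\<^bsub>K\<^esub> \<odot>\<^bsub>M\<^esub> \<phi> = \<phi>"
      by (rule M_eqI) (use \<phi> in \<open>auto intro!: smult_closed, auto simp: smult M_closed\<close>)
  qed (rule smult_closed)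
  have rM: "right_module K A M"
  proof (rule right_moduleI[OF modM])
    fix \<phi> a assume \<phi>: "\<phi> \<in> carrier M" and a: "a \<in> carrier A"
    show "\<phi> \<triangleleft>\<^bsub>M\<^esub> a \<in> carrier M" using \<phi> a by (rule act_closed)
    show "(\<phi> \<oplus>\<^bsub>M\<^esub> \<psi>) \<triangleleft>\<^bsub>M\<^esub> a = \<phi> \<triangleleft>\<^bsub>M\<^esub> a \<oplus>\<^bsub>M\<^esub> \<psi> \<triangleleft>\<^bsub>M\<^esub> a" if "\<psi> \<in> carrier M" for \<psi>
      by (rule M_eqI)
        (use \<phi> a that in \<open>auto intro!: add_closed act_closed, auto simp: add act M_closed X_closed\<close>)
    show "(k \<odot>\<^bsub>M\<^esub> \<phi>) \<triangleleft>\<^bsub>M\<^esub> a = k \<odot>\<^bsub>M\<^esub> (\<phi> \<triangleleft>\<^bsub>M\<^esub> a)" if "k \<in> carrier K" for k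
      by (rule M_eqI)
        (use \<phi> a that in \<open>auto intro!: smult_closed act_closed, auto simp: smult act M_closed X_closed\<close>)
    show "\<phi> \<triangleleft>\<^bsub>M\<^esub> (k \<odot>\<^bsub>A\<^esub> a) = k \<odot>\<^bsub>M\<^esub> (\<phi> \<triangleleft>\<^bsub>M\<^esub> a)" if "k \<in> carrier K" for k
      by (rule M_eqI)
        (use \<phi> a that in \<open>auto intro!: smult_closed act_closed, auto simp: smult act M_D X_closed lact_smult\<close>)
    fix b assume b: "b \<in> carrier A"
    show "\<phi> \<triangleleft>\<^bsub>M\<^esub> (a \<oplus>\<^bsub>A\<^esub> b) = \<phi> \<triangleleft>\<^bsub>M\<^esub> a \<oplus>\<^bsub>M\<^esub> \<phi> \<triangleleft>\<^bsub>M\<^esub> b"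
      by (rule M_eqI)
        (use \<phi> a b in \<open>auto intro!: add_closed act_closed, auto simp: add act M_D X_closed add_lact\<close>)
    show "\<phi> \<triangleleft>\<^bsub>M\<^esub> (a \<otimes>\<^bsub>A\<^esub> b) = \<phi> \<triangleleft>\<^bsub>M\<^esub> a \<triangleleft>\<^bsub>M\<^esub> b"
      by (rule M_eqI)
        (use \<phi> a b in \<open>auto intro!: act_closed, auto simp: act X_closed add_lact\<close>)
  qed
  interpret M: right_module K A M by (rule rM)
  note cc = corner_carrier[OF rM]
  have eX: "cls (bas e) \<in> ?X" by (rule RC_memI) (auto simp: bas_e_idem)
  have zX: "cls \<zero>\<^bsub>A\<^esub> \<in> ?X" by (rule RC_memI) auto
  \<comment> \<open>The class of zero is its own multiple by the scalar zero.\<close>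
  have at_zero: "\<phi> (cls \<zero>\<^bsub>A\<^esub>) = \<zero>\<^bsub>V\<^esub>" if "\<phi> \<in> carrier M" for \<phi>
    using M_D(2)[OF that zX K.zero_closed] M_closed[OF that zX]
    by (simp add: corner_ops cls_smult)
  show "apex_module M"
    unfolding apex_module_def
  proof (intro conjI ballI rM)
    fix \<phi> c assume \<phi>: "\<phi> \<in> carrier M" and c: "c \<in> KI"
    show "\<phi> \<triangleleft>\<^bsub>M\<^esub> c = \<zero>\<^bsub>M\<^esub>"
    proof (rule M_eqI[OF act_closed[OF \<phi> KI_subset[OF c]] zero_closed])
      fix x assume x: "x \<in> ?X"
      then obtain f where f: "f \<in> carrier A" "x = cls f" by (rule RC_memE)
      then have "c \<triangleright>\<^bsub>RC\<^esub> x = cls \<zero>\<^bsub>A\<^esub>"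
        using c KI_subset by (simp add: corner_ops cls_mult cls_KI KI_ideal)
      then show "(\<phi> \<triangleleft>\<^bsub>M\<^esub> c) x = \<zero>\<^bsub>M\<^esub> x"
        using x at_zero[OF \<phi>] by (simp add: act zero)
    qed
  qed
  let ?ev = "\<lambda>\<phi>. \<phi> (cls (bas e))"
  have at_KG: "\<phi> (cls b) = ?ev \<phi> \<triangleleft>\<^bsub>V\<^esub> b" if "\<phi> \<in> carrier M" "b \<in> carrier KG" for \<phi> b
    using M_D(3)[OF that(1) eX that(2)] that
    by (simp add: corner_ops cls_mult KG_subset KG_e)
  have ev_act: "?ev (\<phi> \<triangleleft>\<^bsub>M\<^esub> a) = \<phi> (cls (a \<otimes>\<^bsub>A\<^esub> bas e))" if "a \<in> carrier A" for \<phi> a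
    using that eX by (simp add: act corner_ops cls_mult)
  have ev: "?ev \<in> rmodule_hom K KG (corner M) V"
  proof (rule rmodule_homI)
    fix \<phi> assume "\<phi> \<in> carrier (corner M)"
    then have \<phi>: "\<phi> \<in> carrier M" by (simp add: cc)
    show "?ev \<phi> \<in> carrier V" by (rule M_closed[OF \<phi> eX])
    show "?ev (\<phi> \<oplus>\<^bsub>corner M\<^esub> \<psi>) = ?ev \<phi> \<oplus>\<^bsub>V\<^esub> ?ev \<psi>" for \<psi> using eX by (simp add: add)
    show "?ev (k \<odot>\<^bsub>corner M\<^esub> \<phi>) = k \<odot>\<^bsub>V\<^esub> ?ev \<phi>" for k using eX by (simp add: smult)
    show "?ev (\<phi> \<triangleleft>\<^bsub>corner M\<^esub> b) = ?ev \<phi> \<triangleleft>\<^bsub>V\<^esub> b" if "b \<in> carrier KG" for b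
      using ev_act[OF KG_subset[OF that], of \<phi>] at_KG[OF \<phi> that] that by (simp add: KG_e)
  qed
  interpret C: unital_right_module K KG "corner M" by (rule corner_unital[OF rM])
  have "inj_on ?ev (carrier (corner M))"
  proof (rule C.hom_inj_onI[OF V.module_axioms ev])
    fix \<phi> assume "\<phi> \<in> carrier (corner M)" and 0: "?ev \<phi> = \<zero>\<^bsub>V\<^esub>"
    then have \<phi>: "\<phi> \<in> carrier M" "\<phi> \<triangleleft>\<^bsub>M\<^esub> bas e = \<phi>" by (auto simp: cc)
    have "\<phi> = \<zero>\<^bsub>M\<^esub>"
    proof (rule M_eqI[OF \<phi>(1) zero_closed])
      fix x assume x: "x \<in> ?X"
      then obtain f where f: "f \<in> carrier A" "f \<otimes>\<^bsub>A\<^esub> bas e = f" "x = cls f" by (rule RC_memE)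
      have "\<phi> x = (\<phi> \<triangleleft>\<^bsub>M\<^esub> bas e) x" using \<phi> by simp
      also have "\<dots> = \<phi> (cls (bas e \<otimes>\<^bsub>A\<^esub> f \<otimes>\<^bsub>A\<^esub> bas e))"
        using x f by (simp add: act corner_ops cls_mult A_mult_assoc)
      also have "\<dots> = ?ev \<phi> \<triangleleft>\<^bsub>V\<^esub> proj f"
        using f by (simp add: cls_corner at_KG[OF \<phi>(1)])
      also have "\<dots> = \<zero>\<^bsub>M\<^esub> x" using 0 f x by (simp add: zero)
      finally show "\<phi> x = \<zero>\<^bsub>M\<^esub> x" .
    qed
    then show "\<phi> = \<zero>\<^bsub>corner M\<^esub>" by simp
  qed
  moreover have "?ev ` carrier (corner M) = carrier V"
  proof
    show "?ev ` carrier (corner M) \<subseteq> carrier V" using rmodule_hom_carrier[OF ev] by auto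
    show "carrier V \<subseteq> ?ev ` carrier (corner M)"
    proof
      fix v assume v: "v \<in> carrier V"
      \<comment> \<open>The preimage of \<open>v\<close>: since \<open>proj\<close> fixes
        \<open>e\<close>, the value at \<open>e\<close> is \<open>v\<close>, and
        \<open>proj_mult_KG\<close> gives linearity over \<open>KG\<close>.\<close>
      define \<psi> where "\<psi> = (\<lambda>x\<in>?X. v \<triangleleft>\<^bsub>V\<^esub> proj_class x)"
      have "\<psi> \<in> carrier M"
      proof (rule M_I)
        fix x assume x: "x \<in> ?X"
        then obtain f where f: "f \<in> carrier A" "f \<otimes>\<^bsub>A\<^esub> bas e = f" "x = cls f" by (rule RC_memE)
        show "\<psi> x \<in> carrier V" using x f v by (simp add: \<psi>_def proj_class V.act_closed)
        show "\<psi> (k \<odot>\<^bsub>RC\<^esub> x) = k \<odot>\<^bsub>V\<^esub> \<psi> x" if k: "k \<in> carrier K" for k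
          using x f v k X_smult[OF k x]
          by (simp add: \<psi>_def corner_ops cls_smult proj_class proj_smult V.act_smult_right[unfolded KG_ops])
        show "\<psi> (x \<triangleleft>\<^bsub>RC\<^esub> b) = \<psi> x \<triangleleft>\<^bsub>V\<^esub> b" if b: "b \<in> carrier KG" for b
          using x f v b X_act[OF x b]
          by (simp add: \<psi>_def corner_ops cls_mult KG_subset proj_class proj_mult_KG KG_mult[symmetric] V.act_mult)
        fix y assume y: "y \<in> ?X"
        then obtain g where g: "g \<in> carrier A" "g \<otimes>\<^bsub>A\<^esub> bas e = g" "y = cls g" by (rule RC_memE)
        show "\<psi> (x \<oplus>\<^bsub>RC\<^esub> y) = \<psi> x \<oplus>\<^bsub>V\<^esub> \<psi> y"
          using x y f g v X_add[OF x y]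
          by (simp add: \<psi>_def corner_ops cls_add proj_class proj_add V.act_add_right[unfolded KG_ops])
      qed (simp add: \<psi>_def)
      \<comment> \<open>Multiplying by \<open>e\<close> puts the map into the corner and keeps its
        value at \<open>e\<close>.\<close>
      then have "\<psi> \<triangleleft>\<^bsub>M\<^esub> bas e \<in> carrier (corner M)" by (auto simp: corner_module_def)
      moreover have "?ev (\<psi> \<triangleleft>\<^bsub>M\<^esub> bas e) = v"
        using eX v V.act_one[OF v] by (simp add: ev_act bas_e_idem \<psi>_def proj_class proj_e KG_ops)
      ultimately show "v \<in> ?ev ` carrier (corner M)" by (metis image_eqI)
    qed
  qed
  ultimately have "rmodule_iso K KG (corner M) V" using ev by (auto simp: rmodule_iso_def bij_betw_def)
  then show "rmodule_iso K KG V (corner M)" by (rule C.iso_sym)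
  show "\<phi> = \<zero>\<^bsub>M\<^esub>"
    if \<phi>: "\<phi> \<in> carrier M" and 0: "\<And>a. a \<in> carrier A \<Longrightarrow> \<phi> \<triangleleft>\<^bsub>M\<^esub> (a \<otimes>\<^bsub>A\<^esub> bas e) = \<zero>\<^bsub>M\<^esub>" for \<phi>
  proof (rule M_eqI[OF \<phi> zero_closed])
    fix x assume x: "x \<in> ?X"
    then obtain f where f: "f \<in> carrier A" "f \<otimes>\<^bsub>A\<^esub> bas e = f" "x = cls f" by (rule RC_memE)
    have "\<phi> x = ?ev (\<phi> \<triangleleft>\<^bsub>M\<^esub> (f \<otimes>\<^bsub>A\<^esub> bas e))" using f by (simp add: ev_act)
    also have "\<dots> = \<zero>\<^bsub>M\<^esub> x" using 0[OF f(1)] x eX by (simp add: zero)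
    finally show "\<phi> x = \<zero>\<^bsub>M\<^esub> x" .
  qed
qed

end

section \<open>The apex of a simple module\<close>

context semigroup_over_cring
begin

text \<open>\<open>m a u\<close> is linear in \<open>a\<close>; if all \<open>m t u\<close> with
  \<open>t\<close> in \<open>S\<close> vanished, so would \<open>m a u\<close>.\<close>

lemma act_basis_products:
  assumes M: "right_module K A M" and m: "m \<in> carrier M" and u: "u \<in> carrier S" and a: "a \<in> carrier A"
    and ne: "m \<triangleleft>\<^bsub>M\<^esub> a \<triangleleft>\<^bsub>M\<^esub> bas u \<noteq> \<zero>\<^bsub>M\<^esub>"
  shows "\<exists>t\<in>carrier S. m \<triangleleft>\<^bsub>M\<^esub> bas (t \<otimes> u) \<noteq> \<zero>\<^bsub>M\<^esub>"
proof (rule ccontr)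
  interpret M: right_module K A M by fact
  assume "\<not> ?thesis"
  then have 0: "m \<triangleleft>\<^bsub>M\<^esub> bas t \<triangleleft>\<^bsub>M\<^esub> bas u = \<zero>\<^bsub>M\<^esub>" if "t \<in> carrier S" for t
    using that m u by (auto simp: bas_mult simp flip: M.act_mult)
  have "m \<triangleleft>\<^bsub>M\<^esub> a \<triangleleft>\<^bsub>M\<^esub> bas u = \<zero>\<^bsub>M\<^esub>"
    using a by (induction rule: A_induct)
      (use m u M 0 in \<open>auto simp: M.act_add_left M.act_add_right M.act_smult_left M.act_smult_right M.act_closed\<close>)
  then show False using ne by simp
qed

text \<open>Among the elements not killing \<open>M\<close>, choose \<open>s\<close> with the
  smallest principal ideal; its class is the apex. By cyclicity, each \<open>u\<close> not killing
  \<open>M\<close> admits \<open>t\<close> such that \<open>s t u\<close> does not kill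
  \<open>M\<close>, and minimality then puts \<open>s t u\<close> into the class of
  \<open>s\<close>. For \<open>u = s\<close> this yields regularity; for general \<open>u\<close> it
  shows that \<open>s\<close> lies below \<open>u\<close>.\<close>

lemma simple_module_has_apex:
  assumes simple: "simple_module K A M"
  shows "\<exists>J. is_apex K S M J"
proof -
  have rM: "right_module K A M" using simple by (rule simple_moduleD)
  interpret M: right_module K A M by (rule rM)
  let ?N = "annihilator K S M"
  have notin: "t \<notin> ?N" if "m \<in> carrier M" "m \<triangleleft>\<^bsub>M\<^esub> bas t \<noteq> \<zero>\<^bsub>M\<^esub>" for m t
    using that by (auto simp: annihilator_def)
  \<comment> \<open>Basis elements span \<open>KS\<close>, so if all of them killed
    \<open>M\<close>, then \<open>M KS\<close> would be zero.\<close>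
  obtain s0 where s0: "s0 \<in> carrier S - ?N"
  proof (rule ccontr)
    assume "\<not> thesis"
    then have none: "\<nexists>s. s \<in> carrier S - ?N" using that by blast
    have "m \<triangleleft>\<^bsub>M\<^esub> a = \<zero>\<^bsub>M\<^esub>" if m: "m \<in> carrier M" and a: "a \<in> carrier A" for m a
      using a
    proof (induction rule: A_induct)
      case zero
      show ?case by (rule act_zero_right[OF rM m])
    next
      case (add k s f)
      then have "m \<triangleleft>\<^bsub>M\<^esub> bas s = \<zero>\<^bsub>M\<^esub>" using none m by (auto simp: annihilator_def)
      then show ?case using add m by (simp add: M.act_add_right M.act_smult_right)
    qed
    then show False using simple_moduleD(2)[OF simple] by blast
  qed
  obtain s where s: "s \<in> carrier S" "s \<notin> ?N"
    and min: "\<And>t. t \<in> carrier S \<Longrightarrow> t \<notin> ?N \<Longrightarrow> card (pideal s) \<le> card (pideal t)"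
    using ex_has_least_nat[of "\<lambda>s. s \<in> carrier S - ?N" s0 "\<lambda>s. card (pideal s)"] s0 by auto
  have eq: "pideal t = pideal s" if t: "t \<in> pideal s" "t \<notin> ?N" for t
  proof (rule card_seteq)
    show "finite (pideal s)" using pideal_subset[OF s(1)] finite_carrier finite_subset by blast
    show "pideal t \<subseteq> pideal s" by (rule pideal_mono[OF s(1) t(1)])
    show "card (pideal s) \<le> card (pideal t)" using min t pideal_subset[OF s(1)] by blast
  qed
  obtain m where m: "m \<in> carrier M" "m \<triangleleft>\<^bsub>M\<^esub> bas s \<noteq> \<zero>\<^bsub>M\<^esub>"
    using s by (auto simp: annihilator_def)
  \<comment> \<open>Starting from \<open>m s\<close>, a non-zero \<open>w (t u)\<close> shows that
    \<open>s t u\<close> does not kill \<open>M\<close>.\<close>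
  define w where "w = m \<triangleleft>\<^bsub>M\<^esub> bas s"
  have w: "w \<in> carrier M" "w \<noteq> \<zero>\<^bsub>M\<^esub>" using m s by (auto simp: w_def M.act_closed)
  have through_s: "\<exists>t\<in>carrier S. w \<triangleleft>\<^bsub>M\<^esub> bas (t \<otimes> u) \<noteq> \<zero>\<^bsub>M\<^esub> \<and> s \<otimes> (t \<otimes> u) \<notin> ?N"
    if u: "u \<in> carrier S" "u \<notin> ?N" for u
  proof -
    obtain n where n: "n \<in> carrier M" "n \<triangleleft>\<^bsub>M\<^esub> bas u \<noteq> \<zero>\<^bsub>M\<^esub>" using u by (auto simp: annihilator_def)
    obtain a where a: "a \<in> carrier A" "n = w \<triangleleft>\<^bsub>M\<^esub> a" using simple_cyclic[OF simple w n(1)] by blast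
    obtain t where t: "t \<in> carrier S" "w \<triangleleft>\<^bsub>M\<^esub> bas (t \<otimes> u) \<noteq> \<zero>\<^bsub>M\<^esub>"
      using act_basis_products[OF rM w(1) u(1) a(1)] a n by blast
    have "m \<triangleleft>\<^bsub>M\<^esub> bas (s \<otimes> (t \<otimes> u)) = w \<triangleleft>\<^bsub>M\<^esub> bas (t \<otimes> u)"
      using m s t u by (simp add: w_def mult_closed flip: bas_mult M.act_mult)
    then show ?thesis using t notin[OF m(1)] by auto
  qed
  let ?J = "{t \<in> carrier S. pideal t = pideal s}"
  obtain t where t: "t \<in> carrier S" "w \<triangleleft>\<^bsub>M\<^esub> bas (t \<otimes> s) \<noteq> \<zero>\<^bsub>M\<^esub>" "s \<otimes> (t \<otimes> s) \<notin> ?N"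
    using through_s[OF s] by blast
  \<comment> \<open>The criterion is used with \<open>a = s\<close> and \<open>b = t s\<close>: both
    \<open>b\<close> and \<open>a b\<close> lie below \<open>s\<close> and do not kill
    \<open>M\<close>, so they generate the same ideal as \<open>s\<close>.\<close>
  have J: "?J \<in> regular_J_classes S"
  proof (rule regular_J_classI[OF s(1) mult_closed[OF t(1) s(1)]])
    show "s \<in> pideal (s \<otimes> (t \<otimes> s))"
      using eq[of "s \<otimes> (t \<otimes> s)"] t pideal_right[OF mult_closed[OF t(1) s(1)], of s] by simp
    show "pideal (t \<otimes> s) = pideal s"
      using eq[OF pideal_left[OF t(1)] notin[OF w(1) t(2)]] .
  qed
  have J_sub: "?J \<subseteq> pideal s" using pideal_refl by blast
  have "?N = apex_ideal S ?J"
  proof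
    show "?N \<subseteq> apex_ideal S ?J"
    proof
      fix u assume u: "u \<in> ?N"
      then have "s \<notin> pideal u" using annihilator_ideal[OF rM u] s by blast
      then show "u \<in> apex_ideal S ?J" using u s by (auto simp: apex_ideal_def annihilator_def)
    qed
    show "apex_ideal S ?J \<subseteq> ?N"
    proof
      fix u assume u: "u \<in> apex_ideal S ?J"
      then have uS: "u \<in> carrier S" by (simp add: apex_ideal_def)
      show "u \<in> ?N"
      proof (rule ccontr)
        assume "u \<notin> ?N"
        then obtain t where t: "t \<in> carrier S" "s \<otimes> (t \<otimes> u) \<notin> ?N" using through_s[OF uS] by blast
        have "pideal (s \<otimes> (t \<otimes> u)) = pideal s"
          using eq[OF pideal_right[OF mult_closed[OF t(1) uS]] t(2)] .
        moreover have "s \<otimes> (t \<otimes> u) \<in> pideal u"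
          using pideal_left[OF mult_closed[OF s(1) t(1)], of u] s t uS by (simp add: mult_assoc)
        ultimately have "pideal s \<subseteq> pideal u" using pideal_mono[OF uS] by metis
        then show False using u J_sub by (auto simp: apex_ideal_def)
      qed
    qed
  qed
  then show ?thesis using J by (auto simp: is_apex_def)
qed

text \<open>A class can be recovered from its ideal: a representative \<open>f\<close> of
  \<open>J\<close> lies outside the common ideal, so \<open>J'\<close> is below \<open>f\<close>. By
  symmetry, representatives of the two classes generate the same principal ideal.\<close>

lemma apex_unique:
  assumes "is_apex K S M J" "is_apex K S M J'"
  shows "J = J'"
proof -
  have J: "J \<in> regular_J_classes S" "J' \<in> regular_J_classes S" and eq: "apex_ideal S J = apex_ideal S J'"
    using assms by (auto simp: is_apex_def)
  obtain f f' where f: "f \<in> J" "f' \<in> J'" using J by (auto simp: regular_J_classes_def)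
  note Jf = regular_J_class_eq[OF J(1) f(1)] and Jf' = regular_J_class_eq[OF J(2) f(2)]
  have "J \<subseteq> pideal f" "J' \<subseteq> pideal f'" using Jf(2) Jf'(2) pideal_refl by blast+
  then have "f \<notin> apex_ideal S J" "f' \<notin> apex_ideal S J'" by (auto simp: apex_ideal_def)
  then have "J' \<subseteq> pideal f" "J \<subseteq> pideal f'" using eq Jf(1) Jf'(1) by (auto simp: apex_ideal_def)
  then have "pideal f = pideal f'"
    using f pideal_mono[OF Jf(1)] pideal_mono[OF Jf'(1)] by blast
  then show ?thesis using Jf(2) Jf'(2) by simp
qed

section \<open>Transport along isomorphisms and into other types\<close>

lemma annihilator_iso:
  assumes M: "right_module K A M" and N: "right_module K A N" and iso: "rmodule_iso K A M N"
  shows "annihilator K S M = annihilator K S N"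
proof -
  interpret M: right_module K A M by fact
  interpret N: right_module K A N by fact
  obtain f where f: "f \<in> rmodule_hom K A M N" and bij: "bij_betw f (carrier M) (carrier N)"
    using iso by (auto simp: rmodule_iso_def)
  have im: "carrier N = f ` carrier M" and inj: "inj_on f (carrier M)" using bij by (auto simp: bij_betw_def)
  have "m \<triangleleft>\<^bsub>M\<^esub> bas s = \<zero>\<^bsub>M\<^esub> \<longleftrightarrow> f m \<triangleleft>\<^bsub>N\<^esub> bas s = \<zero>\<^bsub>N\<^esub>" if "m \<in> carrier M" "s \<in> carrier S" for m s
    using that inj_on_eq_iff[OF inj M.act_closed[OF that(1) bas_closed[OF that(2)]] M.M.zero_closed]
      rmodule_hom_act[OF f that(1) bas_closed[OF that(2)]] M.hom_zero[OF N.module_axioms f] by simp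
  then show ?thesis by (auto simp: annihilator_def im)
qed

text \<open>All operations are conjugated by \<open>g\<close>, so \<open>g\<close> is an isomorphism
  by construction; the module axioms come from \<open>right_module_image\<close>.\<close>

lemma transport_structure:
  fixes M :: "('k, 's \<Rightarrow> 'k, 'm, 'z) rmodule_scheme" and g :: "'m \<Rightarrow> 'u"
  assumes M: "right_module K A M" and g: "inj_on g (carrier M)"
  shows "\<exists>N :: ('k, 's \<Rightarrow> 'k, 'u) rmodule. right_module K A N \<and> rmodule_iso K A M N"
proof -
  interpret M: right_module K A M by fact
  let ?h = "inv_into (carrier M) g"
  define N :: "('k, 's \<Rightarrow> 'k, 'u) rmodule" where
    "N = \<lparr>carrier = g ` carrier M, monoid.mult = undefined, one = undefined, ring.zero = g \<zero>\<^bsub>M\<^esub>,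
      add = (\<lambda>x y. g (?h x \<oplus>\<^bsub>M\<^esub> ?h y)), smult = (\<lambda>k x. g (k \<odot>\<^bsub>M\<^esub> ?h x)), act = (\<lambda>x a. g (?h x \<triangleleft>\<^bsub>M\<^esub> a))\<rparr>"
  have hom: "g \<in> rmodule_hom K A M N"
    by (rule rmodule_homI) (auto simp: N_def g)
  have im: "g ` carrier M = carrier N" by (simp add: N_def)
  have "right_module K A N"
    by (rule right_module_image[OF M hom im]) (simp add: N_def)
  then show ?thesis using hom im g by (auto simp: rmodule_iso_def bij_betw_def)
qed

text \<open>Choosing for each \<open>x\<close> a coefficient \<open>a\<close> with
  \<open>x = m a\<close> is injective, as \<open>x\<close> can be recovered from \<open>a\<close>.
  So a type into which the functions from \<open>'s\<close> to \<open>'k\<close> inject holds a copy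
  of every simple module, whatever the type of that module.\<close>

lemma simple_module_in_universe:
  fixes M :: "('k, 's \<Rightarrow> 'k, 'm, 'z) rmodule_scheme" and i :: "('s \<Rightarrow> 'k) \<Rightarrow> 'u"
  assumes simple: "simple_module K A M" and i: "inj i"
  shows "\<exists>N :: ('k, 's \<Rightarrow> 'k, 'u) rmodule. right_module K A N \<and> rmodule_iso K A M N"
proof -
  have rM: "right_module K A M" using simple by (rule simple_moduleD)
  interpret M: right_module K A M by (rule rM)
  obtain m a where "m \<in> carrier M" "a \<in> carrier A" "m \<triangleleft>\<^bsub>M\<^esub> a \<noteq> \<zero>\<^bsub>M\<^esub>"
    using simple_moduleD(2)[OF simple] by blast
  then have m: "m \<in> carrier M" "m \<noteq> \<zero>\<^bsub>M\<^esub>" by auto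
  define c where "c x = (SOME a. a \<in> carrier A \<and> x = m \<triangleleft>\<^bsub>M\<^esub> a)" for x
  have "x = m \<triangleleft>\<^bsub>M\<^esub> c x" if "x \<in> carrier M" for x
    using someI_ex[of "\<lambda>a. a \<in> carrier A \<and> x = m \<triangleleft>\<^bsub>M\<^esub> a"] simple_cyclic[OF simple m that]
    unfolding c_def by blast
  then have "inj_on c (carrier M)" by (metis inj_onI)
  then have "inj_on (\<lambda>x. i (c x)) (carrier M)"
    using i by (auto simp: inj_on_def inj_def)
  then show ?thesis by (rule transport_structure[OF rM])
qed

end

context J_class
begin

lemma corner_iso:
  assumes M: "right_module K A M" and N: "right_module K A N" and iso: "rmodule_iso K A M N"
  shows "rmodule_iso K KG (corner M) (corner N)"
proof -
  interpret M: right_module K A M by fact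
  obtain f where f: "f \<in> rmodule_hom K A M N" and bij: "bij_betw f (carrier M) (carrier N)"
    using iso by (auto simp: rmodule_iso_def)
  have im: "carrier N = f ` carrier M" and inj: "inj_on f (carrier M)" using bij by (auto simp: bij_betw_def)
  note cM = corner_carrier[OF M] and cN = corner_carrier[OF N]
  have fe: "f (x \<triangleleft>\<^bsub>M\<^esub> bas e) = f x \<triangleleft>\<^bsub>N\<^esub> bas e" if "x \<in> carrier M" for x
    using rmodule_hom_act[OF f that] by simp
  have "f \<in> rmodule_hom K KG (corner M) (corner N)"
  proof (rule rmodule_homI)
    fix x assume "x \<in> carrier (corner M)"
    then have x: "x \<in> carrier M" "x \<triangleleft>\<^bsub>M\<^esub> bas e = x" by (auto simp: cM)
    show "f x \<in> carrier (corner N)" using x fe[OF x(1)] rmodule_hom_carrier[OF f] by (simp add: cN)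
  qed (use f in \<open>auto simp: cM rmodule_hom_add rmodule_hom_smult rmodule_hom_act KG_subset\<close>)
  moreover have "bij_betw f (carrier (corner M)) (carrier (corner N))"
  proof (rule bij_betw_subset[OF bij])
    show "f ` carrier (corner M) = carrier (corner N)"
    proof
      show "f ` carrier (corner M) \<subseteq> carrier (corner N)" using rmodule_hom_carrier[OF calculation] by auto
      show "carrier (corner N) \<subseteq> f ` carrier (corner M)"
      proof
        fix y assume y: "y \<in> carrier (corner N)"
        then obtain x where x: "x \<in> carrier M" "y = f x" by (auto simp: cN im)
        then have "y = f (x \<triangleleft>\<^bsub>M\<^esub> bas e)" using y fe by (simp add: cN)
        moreover have "x \<triangleleft>\<^bsub>M\<^esub> bas e \<in> carrier (corner M)" using x by (auto simp: corner_module_def)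
        ultimately show "y \<in> f ` carrier (corner M)" by blast
      qed
    qed
  qed (auto simp: cM)
  ultimately show ?thesis by (auto simp: rmodule_iso_def)
qed

lemma simple_over_iso:
  assumes M: "simple_over K S J e V M" and N: "right_module K A N" and iso: "rmodule_iso K A M N"
  shows "simple_over K S J e V N"
proof -
  have sM: "simple_module K A M" and aM: "is_apex K S M J" and VM: "rmodule_iso K KG (corner M) V"
    using M by (auto simp: simple_over_def)
  have rM: "right_module K A M" using sM by (rule simple_moduleD)
  interpret C: unital_right_module K KG "corner M" by (rule corner_unital[OF rM])
  have "rmodule_iso K KG (corner N) V"
    using rmodule_iso_trans[OF C.iso_sym[OF corner_iso[OF rM N iso]] VM] .
  moreover have "is_apex K S N J"
    using aM annihilator_iso[OF rM N iso] by (simp add: is_apex_def)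
  ultimately show ?thesis
    using simple_module_iso[OF sM N iso] by (simp add: simple_over_def)
qed

section \<open>The simple module attached to a simple \<open>KG\<close>-module\<close>

lemma Ind_theorem:
  assumes V: "simple_unital_module K KG V"
  defines "M \<equiv> Ind K S J e V"
  defines "N \<equiv> Ind_radical K S e M"
  shows "maximal_submodule K A N M" "maximal_submodule K A N' M \<Longrightarrow> N' = N"
    "simple_over K S J e V (quotient_rmodule M N)"
proof -
  have rV: "right_module K KG V"
    using V by (simp add: simple_unital_module_def unital_right_module.axioms(1))
  note apex = Ind_apex_module[OF V, folded M_def] and iso = Ind_corner_iso[OF V, folded M_def]
    and gen = Ind_generated[OF V, folded M_def]
  note simple = simple_corner_transfer[OF V apex_moduleD(1)[OF apex] iso]
  show "maximal_submodule K A N M" unfolding N_def by (rule radical_maximal[OF apex simple gen])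
  show "maximal_submodule K A N' M \<Longrightarrow> N' = N" unfolding N_def by (rule radical_unique[OF apex simple gen])
  show "simple_over K S J e V (quotient_rmodule M N)" unfolding N_def
    by (rule simple_over_transfer[OF rV radical_quotient[OF apex simple gen] iso])
qed

lemma Coind_theorem:
  assumes V: "simple_unital_module K KG V"
  defines "M \<equiv> Coind K S J e V"
  defines "N \<equiv> Coind_socle K S e M"
  shows "minimal_submodule K A N M" "minimal_submodule K A N' M \<Longrightarrow> N' = N"
    "simple_over K S J e V (M\<lparr>carrier := N\<rparr>)"
proof -
  have rV: "right_module K KG V"
    using V by (simp add: simple_unital_module_def unital_right_module.axioms(1))
  note apex = Coind_apex_module[OF V, folded M_def] and iso = Coind_corner_iso[OF V, folded M_def]
    and cogen = Coind_cogenerated[OF V, folded M_def]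
  note simple = simple_corner_transfer[OF V apex_moduleD(1)[OF apex] iso]
  show "minimal_submodule K A N M" unfolding N_def by (rule socle_minimal[OF apex simple cogen])
  show "minimal_submodule K A N' M \<Longrightarrow> N' = N" unfolding N_def by (rule socle_unique[OF apex simple cogen])
  show "simple_over K S J e V (M\<lparr>carrier := N\<rparr>)" unfolding N_def
    by (rule simple_over_transfer[OF rV socle_simple[OF apex simple cogen] iso])
qed

end

section \<open>Isomorphism classes of simple modules\<close>

text \<open>\<open>h\<close> is a complete invariant with range \<open>Y\<close>: it is constant on
  each class, where \<open>the_elem\<close> extracts its value.\<close>

lemma bij_betw_quotient:
  assumes "equiv X r" "\<And>x y. x \<in> X \<Longrightarrow> y \<in> X \<Longrightarrow> (x, y) \<in> r \<longleftrightarrow> h x = h y" "h ` X = Y"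
  shows "\<exists>f. bij_betw f (X // r) Y"
proof
  let ?f = "\<lambda>C. the_elem (h ` C)"
  have f: "?f (r `` {x}) = h x" if x: "x \<in> X" for x
  proof -
    have "x \<in> r `` {x}" using equiv_class_self[OF assms(1) x] .
    moreover have "h y = h x" if "y \<in> r `` {x}" for y
      using that assms(1,2) x by (metis Image_singleton_iff equiv_class_eq_iff)
    ultimately have "h ` (r `` {x}) = {h x}" by blast
    then show ?thesis by simp
  qed
  show "bij_betw ?f (X // r) Y"
    unfolding bij_betw_def
  proof
    show "inj_on ?f (X // r)"
    proof (rule inj_onI)
      fix C D assume "C \<in> X // r" "D \<in> X // r" and eq: "?f C = ?f D"
      then obtain x y where xy: "x \<in> X" "C = r `` {x}" "y \<in> X" "D = r `` {y}" by (auto elim!: quotientE)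
      then have "(x, y) \<in> r" using eq f assms(2) by simp
      then show "C = D" using xy equiv_class_eq[OF assms(1)] by blast
    qed
    have "?f ` (X // r) = (\<lambda>x. ?f (r `` {x})) ` X" by (auto simp: quotient_def)
    also have "\<dots> = h ` X" by (rule image_cong[OF refl f])
    finally show "?f ` (X // r) = Y" using assms(3) by simp
  qed
qed

lemma (in semigroup_over_cring) equiv_simple_iso:
  "equiv {M. simple_module K A M} {(M, N). simple_module K A M \<and> simple_module K A N \<and> rmodule_iso K A M N}"
proof (intro equivI refl_onI symI transI)
qed (auto intro: right_module.iso_refl right_module.iso_sym simple_moduleD(1) rmodule_iso_trans)

lemma (in semigroup_over_cring) equiv_simple_unital_iso:
  "equiv {M. simple_unital_module K A M}
     {(M, N). simple_unital_module K A M \<and> simple_unital_module K A N \<and> rmodule_iso K A M N}"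
proof (intro equivI refl_onI symI transI)
qed (auto simp: simple_unital_module_def
    intro: right_module.iso_refl right_module.iso_sym simple_moduleD(1) rmodule_iso_trans)

text \<open>The invariant of \<open>M\<close> is the pair of its apex and the isomorphism class of
  its corner. It is complete by \<open>simple_modules_iso_of_corners\<close>, and every pair arises
  from the simple quotient of an induced module.\<close>

lemma (in semigroup_over_cring) simple_iso_classes_bij:
  fixes i :: "('s \<Rightarrow> 'k) \<Rightarrow> 'u"
  assumes e: "\<And>J. J \<in> regular_J_classes S \<Longrightarrow> e J \<in> J \<and> e J \<otimes> e J = e J" and i: "inj i"
  shows "\<exists>f. bij_betw f (simple_iso_classes K A :: ('k, 's \<Rightarrow> 'k, 'u) rmodule set set)
    (SIGMA J:regular_J_classes S. (simple_unital_iso_classes K (group_algebra_at K S (e J))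
       :: ('k, 's \<Rightarrow> 'k, 'u) rmodule set set))"
proof -
  have JC: "J_class S K J (e J)" if "J \<in> regular_J_classes S" for J
    using e[OF that] that by unfold_locales auto
  let ?X = "{M :: ('k, 's \<Rightarrow> 'k, 'u) rmodule. simple_module K A M}"
  let ?r = "{(M :: ('k, 's \<Rightarrow> 'k, 'u) rmodule, N :: ('k, 's \<Rightarrow> 'k, 'u) rmodule).
    simple_module K A M \<and> simple_module K A N \<and> rmodule_iso K A M N}"
  define rG where "rG J = {(V :: ('k, 's \<Rightarrow> 'k, 'u) rmodule, W :: ('k, 's \<Rightarrow> 'k, 'u) rmodule).
    simple_unital_module K (group_algebra_at K S (e J)) V \<and> simple_unital_module K (group_algebra_at K S (e J)) W \<and>
    rmodule_iso K (group_algebra_at K S (e J)) V W}" for J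
  \<comment> \<open>\<open>G\<close> is a finite semigroup in its own right, so the equivalence for
    unital modules comes from the instance of the locale at \<open>G\<close>.\<close>
  have equiv_rG: "equiv {V. simple_unital_module K (group_algebra_at K S (e J)) V} (rG J)"
    if "J \<in> regular_J_classes S" for J
  proof -
    interpret J_class S K J "e J" by (rule JC[OF that])
    show ?thesis unfolding rG_def by (rule G.equiv_simple_unital_iso)
  qed
  have classes: "simple_unital_iso_classes K (group_algebra_at K S (e J)) =
      {V. simple_unital_module K (group_algebra_at K S (e J)) V} // rG J" for J
    by (simp add: simple_unital_iso_classes_def rG_def)
  \<comment> \<open>For simple \<open>M\<close> the description denotes: existence is
    \<open>simple_module_has_apex\<close>, uniqueness is \<open>apex_unique\<close>.\<close>
  define apex where "apex M = (THE J. is_apex K S M J)" for M :: "('k, 's \<Rightarrow> 'k, 'u) rmodule"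
  have apex: "apex M = J" if "is_apex K S M J" for M J
    unfolding apex_def
  proof (rule the_equality)
    show "is_apex K S M J" by (rule that)
    show "J' = J" if "is_apex K S M J'" for J' using that \<open>is_apex K S M J\<close> by (rule apex_unique)
  qed
  have is_apex: "is_apex K S M (apex M)" if MX: "M \<in> ?X" for M
  proof -
    obtain J where "is_apex K S M J" using simple_module_has_apex[of M] MX by auto
    then show ?thesis using apex by simp
  qed
  define h where "h M = (apex M, rG (apex M) `` {corner_module K M (e (apex M))})" for M
  have corner: "simple_unital_module K (group_algebra_at K S (e (apex M))) (corner_module K M (e (apex M)))"
    if "M \<in> ?X" for M
  proof -
    have "apex M \<in> regular_J_classes S" using is_apex[OF that] by (simp add: is_apex_def)
    then interpret J_class S K "apex M" "e (apex M)" by (rule JC)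
    show ?thesis using simple_corner is_apex[OF that] that by blast
  qed
  have "(M, N) \<in> ?r \<longleftrightarrow> h M = h N" if MN: "M \<in> ?X" "N \<in> ?X" for M N
  proof -
    have "apex M \<in> regular_J_classes S" using is_apex[OF MN(1)] by (simp add: is_apex_def)
    then interpret J_class S K "apex M" "e (apex M)" by (rule JC)
    have rM: "right_module K A M" and rN: "right_module K A N" using MN simple_moduleD(1) by auto
    show ?thesis
    proof
      assume "(M, N) \<in> ?r"
      then have iso: "rmodule_iso K A M N" by auto
      have "is_apex K S N (apex M)"
        using is_apex[OF MN(1)] annihilator_iso[OF rM rN iso] by (simp add: is_apex_def)
      then have N: "apex N = apex M" by (rule apex)
      then have "(corner M, corner N) \<in> rG (apex M)"
        using corner[OF MN(1)] corner[OF MN(2)] corner_iso[OF rM rN iso] by (simp add: rG_def)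
      then show "h M = h N"
        unfolding h_def N using equiv_class_eq[OF equiv_rG[OF J]] by simp
    next
      assume h: "h M = h N"
      then have N: "apex N = apex M" by (simp add: h_def)
      have "rG (apex M) `` {corner M} = rG (apex M) `` {corner N}" using h by (simp add: h_def N)
      then have "(corner M, corner N) \<in> rG (apex M)"
        using eq_equiv_class[OF _ equiv_rG[OF J]] corner[OF MN(2)] N by simp
      then have "rmodule_iso K KG (corner M) (corner N)" by (simp add: rG_def)
      then have "rmodule_iso K A M N"
        using simple_modules_iso_of_corners is_apex[OF MN(1)] is_apex[OF MN(2)] MN N by auto
      then show "(M, N) \<in> ?r" using MN by simp
    qed
  qed
  moreover have "h ` ?X = (SIGMA J:regular_J_classes S. {V. simple_unital_module K (group_algebra_at K S (e J)) V} // rG J)"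
  proof (intro equalityI subsetI)
    fix p assume "p \<in> h ` ?X"
    then obtain M where M: "M \<in> ?X" "p = h M" by blast
    then show "p \<in> (SIGMA J:regular_J_classes S. {V. simple_unital_module K (group_algebra_at K S (e J)) V} // rG J)"
      using is_apex[OF M(1)] corner[OF M(1)] by (auto simp: h_def is_apex_def intro!: quotientI)
  next
    fix p assume "p \<in> (SIGMA J:regular_J_classes S. {V. simple_unital_module K (group_algebra_at K S (e J)) V} // rG J)"
    then obtain J V where J: "J \<in> regular_J_classes S" and V: "simple_unital_module K (group_algebra_at K S (e J)) V"
      and p: "p = (J, rG J `` {V})" by (auto elim!: quotientE)
    interpret J_class S K J "e J" by (rule JC[OF J])
    let ?M = "quotient_rmodule (Ind K S J (e J) V) (Ind_radical K S (e J) (Ind K S J (e J) V))"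
    have M: "simple_over K S J (e J) V ?M" by (rule Ind_theorem(3)[OF V])
    \<comment> \<open>The quotient of the induced module lives on a type built from tensors, so it
      is copied into \<open>'u\<close> in order to become a member of \<open>?X\<close>.\<close>
    then obtain N :: "('k, 's \<Rightarrow> 'k, 'u) rmodule" where "right_module K A N" "rmodule_iso K A ?M N"
      using simple_module_in_universe[OF _ i, of ?M] by (auto simp: simple_over_def)
    then have N: "simple_over K S J (e J) V N" by (rule simple_over_iso[OF M])
    then have NX: "N \<in> ?X" and aN: "apex N = J" using apex by (auto simp: simple_over_def)
    have "(corner N, V) \<in> rG J"
      using N V corner[OF NX] aN by (simp add: rG_def simple_over_def)
    then have "h N = p" unfolding h_def aN p using equiv_class_eq[OF equiv_rG[OF J]] by simp
    then show "p \<in> h ` ?X" using NX by blast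
  qed
  ultimately have "\<exists>f. bij_betw f (?X // ?r)
      (SIGMA J:regular_J_classes S. {V. simple_unital_module K (group_algebra_at K S (e J)) V} // rG J)"
    by (intro bij_betw_quotient[OF equiv_simple_iso])
  then show ?thesis by (simp add: simple_iso_classes_def classes)
qed

text \<open>In (1) to (3) the types \<open>'m\<close> and \<open>'v\<close> of the modules are
  arbitrary. Isomorphism classes, however, form a set only over a fixed type; the injection into
  \<open>'u\<close> ensures that \<open>'u\<close> contains a copy of every simple
  \<open>KS\<close>-module.\<close>

theorem theorem7:
  fixes S :: "('s, 'x) monoid_scheme"
    and K :: "('k, 'y) ring_scheme"
    and e :: "'s set \<Rightarrow> 's"
  assumes "finite_semigroup S"
    and "cring K"
    and "\<And>J. J \<in> regular_J_classes S \<Longrightarrow> e J \<in> J \<and> e J \<otimes>\<^bsub>S\<^esub> e J = e J"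
  shows
    "(\<forall>J\<in>regular_J_classes S.
        (\<forall>M :: ('k, 's \<Rightarrow> 'k, 'm) rmodule.
           simple_module K (semigroup_algebra K S) M \<and> is_apex K S M J \<longrightarrow>
           simple_unital_module K (group_algebra_at K S (e J)) (corner_module K M (e J))) \<and>
        (\<forall>V :: ('k, 's \<Rightarrow> 'k, 'v) rmodule.
           simple_unital_module K (group_algebra_at K S (e J)) V \<longrightarrow>
           (let I = Ind K S J (e J) V;
                N = Ind_radical K S (e J) I
            in maximal_submodule K (semigroup_algebra K S) N I \<and>
               (\<forall>N'. maximal_submodule K (semigroup_algebra K S) N' I \<longrightarrow> N' = N) \<and>
               simple_over K S J (e J) V (quotient_rmodule I N) \<and>
               (\<forall>M :: ('k, 's \<Rightarrow> 'k, 'm) rmodule.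
                  simple_over K S J (e J) V M \<longrightarrow>
                  rmodule_iso K (semigroup_algebra K S) M (quotient_rmodule I N)))) \<and>
        (\<forall>V :: ('k, 's \<Rightarrow> 'k, 'v) rmodule.
           simple_unital_module K (group_algebra_at K S (e J)) V \<longrightarrow>
           (let C = Coind K S J (e J) V;
                N = Coind_socle K S (e J) C
            in minimal_submodule K (semigroup_algebra K S) N C \<and>
               (\<forall>N'. minimal_submodule K (semigroup_algebra K S) N' C \<longrightarrow> N' = N) \<and>
               simple_over K S J (e J) V (C\<lparr>carrier := N\<rparr>) \<and>
               (\<forall>M :: ('k, 's \<Rightarrow> 'k, 'm) rmodule.
                  simple_over K S J (e J) V M \<longrightarrow>
                  rmodule_iso K (semigroup_algebra K S) M (C\<lparr>carrier := N\<rparr>))))) \<and>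
     (field K \<and> (\<exists>i :: ('s \<Rightarrow> 'k) \<Rightarrow> 'u. inj i) \<longrightarrow>
        (\<exists>f. bij_betw f
               (simple_iso_classes K (semigroup_algebra K S)
                  :: ('k, 's \<Rightarrow> 'k, 'u) rmodule set set)
               (SIGMA J:regular_J_classes S.
                  (simple_unital_iso_classes K (group_algebra_at K S (e J))
                     :: ('k, 's \<Rightarrow> 'k, 'u) rmodule set set))))"

proof -
  interpret semigroup_over_cring S K
    using assms(1,2) by (rule semigroup_over_cring.intro)
  show ?thesis
  proof (intro conjI ballI allI impI)
    fix J assume J: "J \<in> regular_J_classes S"
    interpret J_class S K J "e J"
      using J assms(3) by unfold_locales auto
    fix M :: "('k, 's \<Rightarrow> 'k, 'm) rmodule"
    assume "simple_module K A M \<and> is_apex K S M J"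
    then show "simple_unital_module K KG (corner M)" using simple_corner by blast
  next
    fix J assume J: "J \<in> regular_J_classes S"
    interpret J_class S K J "e J"
      using J assms(3) by unfold_locales auto
    fix V :: "('k, 's \<Rightarrow> 'k, 'v) rmodule"
    assume V: "simple_unital_module K KG V"
    show "let I = Ind K S J (e J) V;
                N = Ind_radical K S (e J) I
            in maximal_submodule K A N I \<and>
               (\<forall>N'. maximal_submodule K A N' I \<longrightarrow> N' = N) \<and>
               simple_over K S J (e J) V (quotient_rmodule I N) \<and>
               (\<forall>M :: ('k, 's \<Rightarrow> 'k, 'm) rmodule.
                  simple_over K S J (e J) V M \<longrightarrow> rmodule_iso K A M (quotient_rmodule I N))"
      unfolding Let_def
      by (intro conjI allI impI Ind_theorem[OF V] simple_over_unique[OF _ Ind_theorem(3)[OF V]])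
    show "let C = Coind K S J (e J) V;
                N = Coind_socle K S (e J) C
            in minimal_submodule K A N C \<and>
               (\<forall>N'. minimal_submodule K A N' C \<longrightarrow> N' = N) \<and>
               simple_over K S J (e J) V (C\<lparr>carrier := N\<rparr>) \<and>
               (\<forall>M :: ('k, 's \<Rightarrow> 'k, 'm) rmodule.
                  simple_over K S J (e J) V M \<longrightarrow> rmodule_iso K A M (C\<lparr>carrier := N\<rparr>))"
      unfolding Let_def
      by (intro conjI allI impI Coind_theorem[OF V] simple_over_unique[OF _ Coind_theorem(3)[OF V]])
  next
    assume "field K \<and> (\<exists>i :: ('s \<Rightarrow> 'k) \<Rightarrow> 'u. inj i)"
    then obtain i :: "('s \<Rightarrow> 'k) \<Rightarrow> 'u" where "inj i" by blast
    with assms(3) show "\<exists>f. bij_betw f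
               (simple_iso_classes K A :: ('k, 's \<Rightarrow> 'k, 'u) rmodule set set)
               (SIGMA J:regular_J_classes S.
                  (simple_unital_iso_classes K (group_algebra_at K S (e J))
                     :: ('k, 's \<Rightarrow> 'k, 'u) rmodule set set))"
      by (rule simple_iso_classes_bij)
  qed
qed

end
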